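(* Let $\Phi$ be a reduced root system with simple roots $\Pi$ and positive roots $\Phi^+$, and let $\mathcal{I}$ be an ideal of $\Phi^+$. Suppose that either $\mathcal{A}_\mathcal{I}$ is reducible, or $\mathcal{A}_\mathcal{I}$ is irreducible and there is a maximal standard parabolic subsystem $\Phi_0$ of $\Phi$ such that $(\mathcal{I},\Phi_0)$ satisfies Condition (C). Suppose that for every proper standard parabolic subsystem $\Phi'$ of $\Phi$ and every ideal $\mathcal{J}$ of $\Phi'^+$, the Poincaré polynomial $\mathcal{J}(t)$ (computed in $\Phi'$) factors as $\prod_{i=1}^{s'}(1+t+\cdots+t^{m_i^\mathcal{J}})$ with $m_i^\mathcal{J}$ the ideal exponents of $\mathcal{J}$. Then $\mathcal{I}(t)=\prod_{i=1}^{s}(1+t+\cdots+t^{m_i^\mathcal{I}})$.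
   Context: Heights $\mathrm{ht}(\sum_{\alpha\in\Pi}c_\alpha\alpha)=\sum c_\alpha$; $\alpha\preceq\beta$ iff $\beta-\alpha$ is a $\mathbb{Z}_{\ge0}$-combination of positive roots or $\alpha=\beta$. An ideal of $\Phi^+$ is $\mathcal{I}\subseteq\Phi^+$ with $\alpha\in\mathcal{I},\beta\in\Phi^+,\alpha+\beta\in\Phi^+\Rightarrow\alpha+\beta\in\mathcal{I}$; $\mathcal{I}^c=\Phi^+\setminus\mathcal{I}$; $H_\alpha$ the hyperplane orthogonal to $\alpha$; $\mathcal{A}_\mathcal{I}=\{H_\alpha:\alpha\in\mathcal{I}^c\}$. Ideal exponents: $\lambda_i=|\{\alpha\in\mathcal{I}^c:\mathrm{ht}\alpha=i\}|$, $s=\lambda_1$, $m_i^\mathcal{I}=|\{j:\lambda_j\ge s-i+1\}|$ ($1\le i\le s$). Poincaré polynomial of an ideal: for $R\subseteq\Phi^+$, a subset $S\subseteq R$ is $R$-closed if $\alpha,\beta\in S$, $\alpha+\beta\in R$ imply $\alpha+\beta\in S$. A subset $S\subseteq\mathcal{I}^c$ is of Weyl type for $\mathcal{I}$ if both $S$ and $\mathcal{I}^c\setminus S$ are $\mathcal{I}^c$-closed. Then $\mathcal{I}(t)=\sum_{S}t^{|S|}$, summed over all $S$ of Weyl type for $\mathcal{I}$. Standard parabolic subsystems: $\Phi'=\mathbb{Z}\Pi'\cap\Phi$, $\Pi'\subsetneq\Pi$, $\Phi'^+=\Phi'\cap\Phi^+$ (simple roots $\Pi'$); maximal if $|\Pi'|=|\Pi|-1$;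 $\Phi_0^c=\Phi^+\setminus\Phi_0^+$. Condition (C) for $(\mathcal{I},\Phi_0)$: $\Phi_0^c\cap\mathcal{I}^c\ne\varnothing$, it is totally ordered by $\preceq$ with exactly one root of each occurring height, and for distinct $\alpha,\beta$ in it there is $\gamma\in\Phi_0^+$ with $\alpha,\beta,\gamma$ linearly dependent. Reducible arrangement: up to linear coordinates a product of two nonempty arrangements $\{H_1\oplus V_2\}\cup\{V_1\oplus H_2\}$ in $V_1\oplus V_2$. *)

theory Defs
  imports "HOL-Analysis.Analysis" "HOL-Computational_Algebra.Polynomial"
begin

section \<open>Root systems\<close>

text \<open>Crystallographic root systems spanning the ambient Euclidean space.\<close>

definition root_system :: "'a::euclidean_space set \<Rightarrow> bool" where
  "root_system \<Phi> \<longleftrightarrow>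
     finite \<Phi> \<and> 0 \<notin> \<Phi> \<and> span \<Phi> = UNIV \<and>
     (\<forall>\<alpha>\<in>\<Phi>. \<forall>\<beta>\<in>\<Phi>. \<beta> - (2 * (\<beta> \<bullet> \<alpha>) / (\<alpha> \<bullet> \<alpha>)) *\<^sub>R \<alpha> \<in> \<Phi>) \<and>
     (\<forall>\<alpha>\<in>\<Phi>. \<forall>\<beta>\<in>\<Phi>. 2 * (\<beta> \<bullet> \<alpha>) / (\<alpha> \<bullet> \<alpha>) \<in> \<int>)"

definition reduced_roots :: "'a::euclidean_space set \<Rightarrow> bool" where
  "reduced_roots \<Phi> \<longleftrightarrow> (\<forall>\<alpha>\<in>\<Phi>. \<forall>c::real. c *\<^sub>R \<alpha> \<in> \<Phi> \<longrightarrow> c = 1 \<or> c = -1)"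

definition nonneg_comb :: "'a::euclidean_space set \<Rightarrow> 'a \<Rightarrow> bool" where
  "nonneg_comb B x \<longleftrightarrow> (\<exists>c :: 'a \<Rightarrow> nat. x = (\<Sum>b\<in>B. real (c b) *\<^sub>R b))"

definition simple_roots :: "'a::euclidean_space set \<Rightarrow> 'a set \<Rightarrow> bool" where
  "simple_roots \<Phi> \<Delta> \<longleftrightarrow>
     \<Delta> \<subseteq> \<Phi> \<and> independent \<Delta> \<and> (\<forall>\<alpha>\<in>\<Phi>. nonneg_comb \<Delta> \<alpha> \<or> nonneg_comb \<Delta> (- \<alpha>))"

definition positive_roots :: "'a::euclidean_space set \<Rightarrow> 'a set \<Rightarrow> 'a set" where
  "positive_roots \<Phi> \<Delta> = {\<alpha>\<in>\<Phi>. nonneg_comb \<Delta> \<alpha>}"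

definition ht :: "'a::euclidean_space set \<Rightarrow> 'a \<Rightarrow> real" where
  "ht \<Delta> \<alpha> = (\<Sum>\<beta>\<in>\<Delta>. representation \<Delta> \<alpha> \<beta>)"

definition root_le :: "'a::euclidean_space set \<Rightarrow> 'a \<Rightarrow> 'a \<Rightarrow> bool" where
  "root_le P \<alpha> \<beta> \<longleftrightarrow> nonneg_comb P (\<beta> - \<alpha>) \<or> \<alpha> = \<beta>"

text \<open>The standard parabolic subsystem of \<open>\<Phi>\<close> generated by a set \<open>\<Delta>'\<close> of simple roots.\<close>

definition parabolic :: "'a::euclidean_space set \<Rightarrow> 'a set \<Rightarrow> 'a set" where
  "parabolic \<Phi> \<Delta>' = {\<alpha>\<in>\<Phi>. \<exists>c :: 'a \<Rightarrow> int. \<alpha> = (\<Sum>\<beta>\<in>\<Delta>'. of_int (c \<beta>) *\<^sub>R \<beta>)}"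

section \<open>Ideals, their exponents and Poincare polynomials\<close>

text \<open>
  Below, \<open>P\<close> is a set of positive roots with simple roots \<open>\<Delta>\<close>; for a standard parabolic
  subsystem these are its own positive and simple roots. The complement of an
  ideal \<open>I\<close> is \<open>P - I\<close>.
\<close>

definition root_ideal :: "'a::euclidean_space set \<Rightarrow> 'a set \<Rightarrow> bool" where
  "root_ideal P I \<longleftrightarrow> I \<subseteq> P \<and> (\<forall>\<alpha>\<in>I. \<forall>\<beta>\<in>P. \<alpha> + \<beta> \<in> P \<longrightarrow> \<alpha> + \<beta> \<in> I)"

definition ht_count :: "'a::euclidean_space set \<Rightarrow> 'a set \<Rightarrow> 'a set \<Rightarrow> nat \<Rightarrow> nat" where
  "ht_count \<Delta> P I i = card {\<alpha>\<in>P - I. ht \<Delta> \<alpha> = real i}"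

definition ideal_exponent :: "'a::euclidean_space set \<Rightarrow> 'a set \<Rightarrow> 'a set \<Rightarrow> nat \<Rightarrow> nat" where
  "ideal_exponent \<Delta> P I i =
     card {j. 1 \<le> j \<and> ht_count \<Delta> P I j \<ge> ht_count \<Delta> P I 1 - i + 1}"

definition rel_closed :: "'a::euclidean_space set \<Rightarrow> 'a set \<Rightarrow> bool" where
  "rel_closed R S \<longleftrightarrow> S \<subseteq> R \<and> (\<forall>\<alpha>\<in>S. \<forall>\<beta>\<in>S. \<alpha> + \<beta> \<in> R \<longrightarrow> \<alpha> + \<beta> \<in> S)"

definition weyl_type :: "'a::euclidean_space set \<Rightarrow> 'a set \<Rightarrow> 'a set \<Rightarrow> bool" where
  "weyl_type P I S \<longleftrightarrow>
     S \<subseteq> P - I \<and> rel_closed (P - I) S \<and> rel_closed (P - I) ((P - I) - S)"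

definition poincare_poly :: "'a::euclidean_space set \<Rightarrow> 'a set \<Rightarrow> int poly" where
  "poincare_poly P I = (\<Sum>S | weyl_type P I S. monom 1 (card S))"

definition exponent_product :: "'a::euclidean_space set \<Rightarrow> 'a set \<Rightarrow> 'a set \<Rightarrow> int poly" where
  "exponent_product \<Delta> P I =
     (\<Prod>i = 1..ht_count \<Delta> P I 1. \<Sum>k = 0..ideal_exponent \<Delta> P I i. monom 1 k)"

section \<open>Arrangements\<close>

definition ideal_arrangement :: "'a::euclidean_space set \<Rightarrow> 'a set \<Rightarrow> 'a set set" where
  "ideal_arrangement P I = (\<lambda>\<alpha>. {x. \<alpha> \<bullet> x = 0}) ` (P - I)"

definition arrangement_in :: "'a::euclidean_space set \<Rightarrow> 'a set set \<Rightarrow> bool" where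
  "arrangement_in V A \<longleftrightarrow>
     finite A \<and> (\<forall>H\<in>A. subspace H \<and> H \<subseteq> V \<and> dim H + 1 = dim V)"

text \<open>
  Being a product up to a linear change of coordinates is expressed by an internal direct
  sum decomposition of the ambient space. Both factors are required to
  contain at least one hyperplane.
\<close>

definition reducible_arrangement :: "'a::euclidean_space set set \<Rightarrow> bool" where
  "reducible_arrangement A \<longleftrightarrow>
     (\<exists>V1 V2 A1 A2.
        subspace V1 \<and> subspace V2 \<and> V1 \<inter> V2 = {0} \<and> {x + y |x y. x \<in> V1 \<and> y \<in> V2} = UNIV \<and>
        arrangement_in V1 A1 \<and> A1 \<noteq> {} \<and> arrangement_in V2 A2 \<and> A2 \<noteq> {} \<and>
        A = (\<lambda>H. {x + y |x y. x \<in> H \<and> y \<in> V2}) ` A1 \<union>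
            (\<lambda>H. {x + y |x y. x \<in> V1 \<and> y \<in> H}) ` A2)"

abbreviation irreducible_arrangement :: "'a::euclidean_space set set \<Rightarrow> bool" where
  "irreducible_arrangement A \<equiv> \<not> reducible_arrangement A"

section \<open>Condition (C)\<close>

text \<open>
  In the last clause \<open>\<gamma>\<close> differs from \<open>\<alpha>\<close> and \<open>\<beta>\<close>, which are not in \<open>\<Phi>0\<close>, so dependence of the
  set is dependence of the three roots as a family.
\<close>

definition condition_C :: "'a::euclidean_space set \<Rightarrow> 'a set \<Rightarrow> 'a set \<Rightarrow> 'a set \<Rightarrow> bool" where
  "condition_C \<Delta> P I \<Phi>0 \<longleftrightarrow>
     (let D = (P - (\<Phi>0 \<inter> P)) \<inter> (P - I) in
        D \<noteq> {} \<and>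
        (\<forall>\<alpha>\<in>D. \<forall>\<beta>\<in>D. root_le P \<alpha> \<beta> \<or> root_le P \<beta> \<alpha>) \<and>
        inj_on (ht \<Delta>) D \<and>
        (\<forall>\<alpha>\<in>D. \<forall>\<beta>\<in>D. \<alpha> \<noteq> \<beta> \<longrightarrow> (\<exists>\<gamma>\<in>\<Phi>0 \<inter> P. dependent {\<alpha>, \<beta>, \<gamma>})))"

end

theory Submission
  imports Defs
begin

text \<open>
  Write \<open>N = \<Phi>\<^sup>+ - I\<close>; sets of Weyl type are the biclosed subsets of \<open>N\<close>, and they are even closed
  under positive real combinations lying in \<open>N\<close>. Under Condition (C), let \<open>b\<close> be the simple root
  missing from \<open>\<Phi>\<^sub>0\<close>, \<open>D\<close> the roots of \<open>N\<close> involving \<open>b\<close> and \<open>M\<close> the others. A biclosed subset \<open>S\<close>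
  of \<open>M\<close> orders \<open>D\<close> totally (compare roots normalised to \<open>b\<close>-coefficient 1; their difference is a
  multiple of a root of \<open>M\<close>), and the biclosed sets extending \<open>S\<close> are the unions of \<open>S\<close> with a down-set
  of \<open>D\<close>. So \<open>N(t) = M(t) (1 + t + \<dots> + t\<^sup>m)\<close> with \<open>m = |D|\<close>, while \<open>D\<close> has one root in each of
  the heights 1, ..., \<open>m\<close>. In the reducible case \<open>N\<close> splits along the two summands and
  \<open>N(t)\<close> is a product, unless \<open>N\<close> misses a simple root, when it already lies in a proper parabolic
  subsystem.

  The exponents are the conjugate partition of the height distribution, so adding height
  distributions concatenates exponents as soon as these distributions are decreasing. That the number
  of roots of \<open>N\<close> of height \<open>h\<close> decreases with \<open>h\<close> is proved by an \<open>sl\<^sub>2\<close>-argument: the lowering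
  operator is injective in heights at least 2.
\<close>

section \<open>Roots, coefficients and heights\<close>

text \<open>Closedness only speaks of sums of two roots, whereas comparing normalised roots yields
  arbitrary positive real coefficients: three comparisons in a cycle give a relation r g + s h + t k
  = 0 among signed roots of \<open>M\<close>. Excluding it is what convexity under real combinations
  is for; this is proved by induction on heights, without classification. All is phrased for
  \<open>lower\<close> sets, since \<open>M\<close> and the two summands are again lower and are
  complements of ideals in proper parabolic subsystems, where the hypothesis applies. No Lie algebra
  is at hand for the sl2-argument: the operators are built from root strings, and their commutator
  has to be checked directly. The hard terms come from distinct simple roots a, b and four roots d,
  d+a, d+b, d+a+b. There the weights depend on Cartan integers alone once strings of four roots are
  excluded. Such a string spans a G2, which is a whole component of the root system, and no diamond
  of this shape meets it.\<close>

locale based_root_system =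
  fixes \<Phi> \<Delta> :: "'a::euclidean_space set"
  assumes rs: "root_system \<Phi>" and red: "reduced_roots \<Phi>" and simple: "simple_roots \<Phi> \<Delta>"
begin

definition P where "P = positive_roots \<Phi> \<Delta>"

abbreviation cf :: "'a \<Rightarrow> 'a \<Rightarrow> real" where "cf b x \<equiv> representation \<Delta> x b"

abbreviation cartan :: "'a \<Rightarrow> 'a \<Rightarrow> real" where "cartan x a \<equiv> 2 * (x \<bullet> a) / (a \<bullet> a)"

lemma finite_roots: "finite \<Phi>" and zero_not_root: "0 \<notin> \<Phi>" and span_roots: "span \<Phi> = UNIV"
  and reflect: "\<And>a b. a \<in> \<Phi> \<Longrightarrow> b \<in> \<Phi> \<Longrightarrow> b - cartan b a *\<^sub>R a \<in> \<Phi>"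
  and cartan_int: "\<And>a b. a \<in> \<Phi> \<Longrightarrow> b \<in> \<Phi> \<Longrightarrow> cartan b a \<in> \<int>"
  using rs by (auto simp: root_system_def)

lemma root_nz: "a \<in> \<Phi> \<Longrightarrow> a \<noteq> 0" using zero_not_root by auto

lemma root_sq_pos: "a \<in> \<Phi> \<Longrightarrow> a \<bullet> a > 0" using root_nz by auto

lemma root_minus: "a \<in> \<Phi> \<Longrightarrow> - a \<in> \<Phi>"
proof -
  assume a: "a \<in> \<Phi>"
  have "cartan a a = 2" using root_sq_pos[OF a] by simp
  then have "a - 2 *\<^sub>R a \<in> \<Phi>" using reflect[OF a a] by simp
  then show "- a \<in> \<Phi>" by (simp add: scaleR_2)
qed

lemma root_minus_iff: "- a \<in> \<Phi> \<longleftrightarrow> a \<in> \<Phi>" using root_minus by force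

lemma root_scale: "a \<in> \<Phi> \<Longrightarrow> c *\<^sub>R a \<in> \<Phi> \<Longrightarrow> c = 1 \<or> c = -1"
  using red by (auto simp: reduced_roots_def)

lemma root_diff_commute: "a - b \<in> \<Phi> \<longleftrightarrow> b - a \<in> \<Phi>"
  using root_minus_iff[of "a - b"] by simp

text \<open>Strict Cauchy-Schwarz: equality would make \<open>b\<close> a multiple of
  \<open>a\<close>, which a reduced system allows only for \<open>b = a\<close> and
  \<open>b = - a\<close>.\<close>

lemma cartan_prod_lt_4:
  assumes "a \<in> \<Phi>" "b \<in> \<Phi>" "a \<noteq> b" "a \<noteq> - b"
  shows "cartan a b * cartan b a < 4"
proof -
  have ne: "\<bar>a \<bullet> b\<bar> \<noteq> norm a * norm b"
  proof
    assume "\<bar>a \<bullet> b\<bar> = norm a * norm b"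
    then have "norm a *\<^sub>R b = norm b *\<^sub>R a \<or> norm a *\<^sub>R b = - norm b *\<^sub>R a"
      using norm_cauchy_schwarz_abs_eq by blast
    moreover have na: "norm a > 0" using root_nz assms by simp
    moreover have inv: "b = inverse (norm a) *\<^sub>R (norm a *\<^sub>R b)" using na by simp
    ultimately have "b = inverse (norm a) *\<^sub>R (norm b *\<^sub>R a) \<or> b = inverse (norm a) *\<^sub>R (- norm b *\<^sub>R a)"
      by metis
    then have "b = (inverse (norm a) * norm b) *\<^sub>R a \<or> b = (inverse (norm a) * (- norm b)) *\<^sub>R a"
      unfolding scaleR_scaleR .
    then obtain c where "b = c *\<^sub>R a" by blast
    then show False using root_scale[OF assms(1), of c] assms by auto
  qed
  have "(a \<bullet> b)^2 < (norm a * norm b)^2"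
    using ne Cauchy_Schwarz_ineq2[of a b]
    by (metis abs_ge_zero order_le_less power2_abs power2_less_imp_less power_strict_mono zero_less_numeral)
  then have "(a \<bullet> b) * (a \<bullet> b) < (a \<bullet> a) * (b \<bullet> b)"
    by (simp add: power2_eq_square power_mult_distrib dot_square_norm algebra_simps)
  then show ?thesis using root_sq_pos assms(1,2)
    by (simp add: divide_simps inner_commute mult.commute)
qed

text \<open>Two positive integers with product below 4 cannot both be at least 2.\<close>

lemma cartan_pos_cases:
  assumes "a \<in> \<Phi>" "b \<in> \<Phi>" "a \<noteq> b" "a \<bullet> b > 0"
  shows "cartan a b = 1 \<or> cartan b a = 1"
proof -
  have anb: "a \<noteq> - b"
    using assms(4) root_sq_pos[OF assms(2)] by force
  have pos: "cartan a b > 0" "cartan b a > 0" using assms root_sq_pos by (auto simp: inner_commute)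
  obtain m n :: int where mn: "cartan a b = of_int m" "cartan b a = of_int n"
    using cartan_int assms(1,2) by (meson Ints_cases)
  have "of_int (m * n) < (4::real)" using cartan_prod_lt_4[OF assms(1-3) anb] mn by simp
  then have lt: "m * n < 4" by linarith
  have "m > 0" "n > 0" using pos mn by auto
  then have "m = 1 \<or> n = 1"
  proof (cases "m \<ge> 2 \<and> n \<ge> 2")
    case True
    then have "m * n \<ge> 2 * 2" by (intro mult_mono) auto
    then show ?thesis using lt by simp
  qed linarith
  then show ?thesis using mn by auto
qed

lemma root_diff:
  assumes "a \<in> \<Phi>" "b \<in> \<Phi>" "a \<noteq> b" "a \<bullet> b > 0"
  shows "a - b \<in> \<Phi>"
  using cartan_pos_cases[OF assms]
proof
  assume "cartan a b = 1"
  then show ?thesis using reflect[OF assms(2,1)] by (metis scaleR_one)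
next
  assume "cartan b a = 1"
  then have "b - a \<in> \<Phi>" using reflect[OF assms(1,2)] by (metis scaleR_one)
  then show ?thesis using root_diff_commute by blast
qed

lemma root_add:
  assumes "a \<in> \<Phi>" "b \<in> \<Phi>" "a \<noteq> - b" "a \<bullet> b < 0"
  shows "a + b \<in> \<Phi>"
  using root_diff[of a "- b"] root_minus assms by auto

text \<open>If the product is nonzero, the other factor has absolute value at least 1, so the bound
  on the product passes to this factor.\<close>

lemma abs_cartan_le_3:
  assumes "a \<in> \<Phi>" "b \<in> \<Phi>" "a \<noteq> b" "a \<noteq> - b"
  shows "\<bar>cartan a b\<bar> \<le> 3"
proof (cases "a \<bullet> b = 0")
  case False
  obtain m n :: int where mn: "cartan a b = of_int m" "cartan b a = of_int n"
    using cartan_int assms(1,2) by (meson Ints_cases)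
  have "of_int (m * n) < (4::real)" using cartan_prod_lt_4[OF assms] mn by simp
  then have lt: "m * n < 4" by linarith
  have "cartan b a \<noteq> 0" using False root_sq_pos[OF assms(1)] by (simp add: inner_commute)
  then have n0: "n \<noteq> 0" using mn by auto
  have "cartan a b * cartan b a \<ge> 0"
    using root_sq_pos[OF assms(1)] root_sq_pos[OF assms(2)] by (simp add: inner_commute)
  then have "of_int (m * n) \<ge> (0::real)" using mn by simp
  then have "m * n \<ge> 0" by linarith
  then have "\<bar>m\<bar> * \<bar>n\<bar> < 4" using lt by (simp flip: abs_mult)
  moreover have "\<bar>m\<bar> * 1 \<le> \<bar>m\<bar> * \<bar>n\<bar>" using n0 by (intro mult_left_mono) auto
  ultimately have "\<bar>m\<bar> \<le> 3" by linarith
  then have "\<bar>real_of_int m\<bar> \<le> 3" by linarith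
  then show ?thesis using mn by simp
qed simp

lemma simple_sub: "\<Delta> \<subseteq> \<Phi>" and indep: "independent \<Delta>"
  and pos_or_neg: "\<And>a. a \<in> \<Phi> \<Longrightarrow> nonneg_comb \<Delta> a \<or> nonneg_comb \<Delta> (- a)"
  using simple by (auto simp: simple_roots_def)

lemma finite_simple: "finite \<Delta>" using simple_sub finite_roots finite_subset by blast

lemma nonneg_comb_span: "nonneg_comb B x \<Longrightarrow> x \<in> span B"
  unfolding nonneg_comb_def by (auto intro: span_sum span_scale span_base)

lemma span_simple: "span \<Delta> = UNIV"
proof -
  have "\<Phi> \<subseteq> span \<Delta>"
    using pos_or_neg nonneg_comb_span by (metis span_neg minus_minus subsetI)
  then have "span \<Phi> \<subseteq> span \<Delta>" by (simp add: span_minimal)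
  then show ?thesis using span_roots by auto
qed

lemma in_span: "x \<in> span \<Delta>" using span_simple by auto

lemma cf_add: "cf b (x + y) = cf b x + cf b y"
  and cf_diff: "cf b (x - y) = cf b x - cf b y"
  and cf_scale: "cf b (c *\<^sub>R x) = c * cf b x"
  and cf_neg: "cf b (- x) = - cf b x"
  by (simp_all add: representation_add representation_diff representation_scale representation_neg indep in_span)

lemma cf_simple: "a \<in> \<Delta> \<Longrightarrow> cf b a = (if b = a then 1 else 0)"
  by (simp add: representation_basis indep)

lemma cf_outside: "b \<notin> \<Delta> \<Longrightarrow> cf b x = 0"
  using representation_ne_zero by blast

lemma cf_expand: "x = (\<Sum>b\<in>\<Delta>. cf b x *\<^sub>R b)"
  using sum_representation_eq[OF indep in_span finite_simple] by simp

lemma cf_eqI: "(\<And>b. b \<in> \<Delta> \<Longrightarrow> cf b x = cf b y) \<Longrightarrow> x = y"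
proof -
  assume eq: "\<And>b. b \<in> \<Delta> \<Longrightarrow> cf b x = cf b y"
  have "(\<Sum>b\<in>\<Delta>. cf b x *\<^sub>R b) = (\<Sum>b\<in>\<Delta>. cf b y *\<^sub>R b)"
    using eq by (intro sum.cong) auto
  then show "x = y" by (simp only: cf_expand[symmetric])
qed

lemma cf_sum: "cf c (\<Sum>b\<in>A. f b) = (\<Sum>b\<in>A. cf c (f b))"
  by (simp add: representation_sum indep in_span)

lemma cf_comb: "A \<subseteq> \<Delta> \<Longrightarrow> cf c (\<Sum>b\<in>A. f b *\<^sub>R b) = (if c \<in> A then f c else 0)"
proof -
  assume A: "A \<subseteq> \<Delta>"
  have "cf c (\<Sum>b\<in>A. f b *\<^sub>R b) = (\<Sum>b\<in>A. if c = b then f b else 0)"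
    unfolding cf_sum by (rule sum.cong) (use A in \<open>auto simp: cf_scale cf_simple\<close>)
  also have "\<dots> = (if c \<in> A then f c else 0)"
    using finite_subset[OF A finite_simple] by simp
  finally show ?thesis .
qed

lemma nonneg_comb_iff: "nonneg_comb \<Delta> x \<longleftrightarrow> (\<forall>b\<in>\<Delta>. cf b x \<in> \<nat>)"
proof
  assume "nonneg_comb \<Delta> x"
  then obtain c :: "'a \<Rightarrow> nat" where "x = (\<Sum>b\<in>\<Delta>. real (c b) *\<^sub>R b)"
    unfolding nonneg_comb_def by auto
  then show "\<forall>b\<in>\<Delta>. cf b x \<in> \<nat>" by (auto simp: cf_comb)
next
  assume "\<forall>b\<in>\<Delta>. cf b x \<in> \<nat>"
  then have "\<forall>b\<in>\<Delta>. \<exists>k. cf b x = real k" by (auto elim: Nats_cases)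
  then have "\<exists>c. \<forall>b\<in>\<Delta>. cf b x = real (c b)" by (rule bchoice)
  then obtain c where "\<forall>b\<in>\<Delta>. cf b x = real (c b)" by auto
  then have "(\<Sum>b\<in>\<Delta>. real (c b) *\<^sub>R b) = (\<Sum>b\<in>\<Delta>. cf b x *\<^sub>R b)" by (intro sum.cong) auto
  then have "x = (\<Sum>b\<in>\<Delta>. real (c b) *\<^sub>R b)" by (simp only: cf_expand[symmetric])
  then show "nonneg_comb \<Delta> x" unfolding nonneg_comb_def by auto
qed

lemma P_iff: "x \<in> P \<longleftrightarrow> x \<in> \<Phi> \<and> (\<forall>b\<in>\<Delta>. cf b x \<in> \<nat>)"
  by (auto simp: P_def positive_roots_def nonneg_comb_iff)

lemma P_root: "x \<in> P \<Longrightarrow> x \<in> \<Phi>" by (simp add: P_iff)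

lemma finite_P: "finite P" using finite_roots P_root by (meson finite_subset subsetI)

lemma P_cf_nat: "x \<in> P \<Longrightarrow> cf b x \<in> \<nat>"
  using cf_outside P_iff by (cases "b \<in> \<Delta>") auto

lemma P_cf_nonneg: "x \<in> P \<Longrightarrow> cf b x \<ge> 0"
  using P_cf_nat Nats_altdef1 by (metis Nats_cases of_nat_0_le_iff)

lemma root_pos_or_neg: "x \<in> \<Phi> \<Longrightarrow> x \<in> P \<or> - x \<in> P"
  using pos_or_neg root_minus by (auto simp: P_def positive_roots_def)

lemma P_of_cf_pos: "x \<in> \<Phi> \<Longrightarrow> cf b x > 0 \<Longrightarrow> x \<in> P"
  using root_pos_or_neg P_cf_nonneg[of "- x" b] by (fastforce simp: cf_neg)

lemma P_nz_cf: "x \<in> P \<Longrightarrow> \<exists>b\<in>\<Delta>. cf b x \<ge> 1"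
proof (rule ccontr)
  assume x: "x \<in> P" and n: "\<not> (\<exists>b\<in>\<Delta>. cf b x \<ge> 1)"
  have "cf b x = 0" if "b \<in> \<Delta>" for b
  proof -
    obtain k where "cf b x = real k" using P_cf_nat[OF x] by (meson Nats_cases)
    then show ?thesis using n that by (cases k) auto
  qed
  then have "x = 0" using cf_expand[of x] by simp
  then show False using root_nz P_root x by blast
qed

abbreviation H where "H x \<equiv> ht \<Delta> x"

lemma H_add: "H (x + y) = H x + H y"
  and H_diff: "H (x - y) = H x - H y"
  and H_scale: "H (c *\<^sub>R x) = c * H x"
  and H_neg: "H (- x) = - H x"
  by (simp_all add: ht_def cf_add cf_diff cf_scale cf_neg sum.distrib sum_subtractf sum_distrib_left sum_negf)

lemma H_zero: "H 0 = 0" using H_scale[of 0 0] by simp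

lemma H_simple: "a \<in> \<Delta> \<Longrightarrow> H a = 1"
  by (simp add: ht_def cf_simple finite_simple sum.delta)

lemma H_ge_cf: "x \<in> P \<Longrightarrow> H x \<ge> cf b x"
proof (cases "b \<in> \<Delta>")
  case True
  then show "x \<in> P \<Longrightarrow> H x \<ge> cf b x"
    unfolding ht_def by (intro member_le_sum) (auto simp: P_cf_nonneg finite_simple)
next
  case False
  then show "x \<in> P \<Longrightarrow> H x \<ge> cf b x"
    unfolding ht_def by (simp add: cf_outside sum_nonneg P_cf_nonneg)
qed

lemma H_ge_1: "x \<in> P \<Longrightarrow> H x \<ge> 1"
  using P_nz_cf H_ge_cf by (meson order_trans)

lemma sum_in_Nats: "(\<And>a. a \<in> A \<Longrightarrow> f a \<in> \<nat>) \<Longrightarrow> sum f A \<in> \<nat>"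
  by (induction A rule: infinite_finite_induct) auto

lemma H_nat: "x \<in> P \<Longrightarrow> H x \<in> \<nat>"
  unfolding ht_def by (rule sum_in_Nats) (auto intro: P_cf_nat)

definition hn :: "'a \<Rightarrow> nat" where "hn x = nat \<lfloor>H x\<rfloor>"

lemma H_hn: "x \<in> P \<Longrightarrow> H x = real (hn x)"
  unfolding hn_def using H_nat[of x] by (auto elim!: Nats_cases)

lemma P_of_H_pos: "x \<in> \<Phi> \<Longrightarrow> H x > 0 \<Longrightarrow> x \<in> P"
  using root_pos_or_neg[of x] H_ge_1[of "- x"] by (auto simp: H_neg)

lemma P_diff_cases: "x - y \<in> \<Phi> \<Longrightarrow> x - y \<in> P \<or> y - x \<in> P"
  using root_pos_or_neg[of "x - y"] by auto

lemma P_add: "x \<in> P \<Longrightarrow> y \<in> P \<Longrightarrow> x + y \<in> \<Phi> \<Longrightarrow> x + y \<in> P"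
  using P_of_H_pos[of "x + y"] H_ge_1[of x] H_ge_1[of y] by (auto simp: H_add)

lemma simple_P: "a \<in> \<Delta> \<Longrightarrow> a \<in> P"
  using simple_sub by (auto simp: P_iff cf_simple)

lemma P_not_neg: "x \<in> P \<Longrightarrow> y \<in> P \<Longrightarrow> x \<noteq> - y"
  using H_ge_1[of x] H_ge_1[of y] by (auto simp: H_neg)

lemma P_H_1_simple:
  assumes "x \<in> P" "H x = 1" shows "x \<in> \<Delta>"
proof -
  obtain b where b: "b \<in> \<Delta>" "cf b x \<ge> 1" using P_nz_cf assms(1) by blast
  have fin: "finite (\<Delta> - {b})" using finite_simple by simp
  have "H x = cf b x + (\<Sum>c\<in>\<Delta> - {b}. cf c x)"
    unfolding ht_def using b finite_simple by (simp add: sum.remove)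
  moreover have nn: "(\<Sum>c\<in>\<Delta> - {b}. cf c x) \<ge> 0" by (simp add: sum_nonneg P_cf_nonneg assms(1))
  ultimately have s0: "(\<Sum>c\<in>\<Delta> - {b}. cf c x) = 0" "cf b x = 1" using assms(2) b by linarith+
  then have "\<forall>c\<in>\<Delta> - {b}. cf c x = 0"
    using sum_nonneg_eq_0_iff[OF fin, of "\<lambda>c. cf c x"] P_cf_nonneg[OF assms(1)] by simp
  then have "x = b" using s0 b by (intro cf_eqI) (auto simp: cf_simple)
  then show ?thesis using b by simp
qed

lemma simple_diff_not_root:
  assumes "a \<in> \<Delta>" "b \<in> \<Delta>" shows "a - b \<notin> \<Phi>"
proof
  assume "a - b \<in> \<Phi>"
  then have "a - b \<in> P \<or> b - a \<in> P" by (rule P_diff_cases)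
  then show False using H_ge_1[of "a - b"] H_ge_1[of "b - a"] H_simple assms by (auto simp: H_diff)
qed

lemma simple_inner_nonpos: "a \<in> \<Delta> \<Longrightarrow> b \<in> \<Delta> \<Longrightarrow> a \<noteq> b \<Longrightarrow> a \<bullet> b \<le> 0"
  using root_diff simple_diff_not_root simple_sub by (meson leI subsetD)

end


section \<open>Biclosed sets and convexity\<close>

text \<open>For \<open>N = P\<close> these are the inversion sets of the Weyl group elements. The
  notion is symmetric in \<open>S\<close> and \<open>N - S\<close>, and many arguments below are
  applied to both.\<close>

definition biclosed :: "'a::euclidean_space set \<Rightarrow> 'a set \<Rightarrow> bool" where
  "biclosed N S \<longleftrightarrow> rel_closed N S \<and> rel_closed N (N - S)"

lemma biclosed_sub: "biclosed N S \<Longrightarrow> S \<subseteq> N"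
  by (simp add: biclosed_def rel_closed_def)

lemma biclosed_add: "biclosed N S \<Longrightarrow> x \<in> S \<Longrightarrow> y \<in> S \<Longrightarrow> x + y \<in> N \<Longrightarrow> x + y \<in> S"
  by (simp add: biclosed_def rel_closed_def)

lemma biclosed_Diff: "biclosed N S \<Longrightarrow> biclosed N (N - S)"
  by (auto simp: biclosed_def rel_closed_def double_diff)

context based_root_system
begin

text \<open>The complement of an ideal of \<open>P\<close>, stated without the ideal, because the
  same set is later also read as a complement inside a parabolic subsystem.\<close>

definition lower :: "'a set \<Rightarrow> bool" where
  "lower N \<longleftrightarrow> N \<subseteq> P \<and> (\<forall>a\<in>P. \<forall>b\<in>P. a + b \<in> N \<longrightarrow> a \<in> N \<and> b \<in> N)"

lemma lower_sub: "lower N \<Longrightarrow> N \<subseteq> P" by (simp add: lower_def)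

lemma lowerD: "lower N \<Longrightarrow> a \<in> P \<Longrightarrow> b \<in> P \<Longrightarrow> a + b \<in> N \<Longrightarrow> a \<in> N \<and> b \<in> N"
  by (auto simp: lower_def)

text \<open>Here \<open>a = \<mu> + \<eta>\<close> with a positive root \<open>\<mu>\<close>. If
  \<open>\<eta>\<close> were outside \<open>S\<close>, then \<open>\<mu>\<close> would be inside,
  since otherwise the closed complement would contain \<open>a\<close>. Replacing \<open>a\<close>
  by \<open>\<mu>\<close> lowers the total height.\<close>

lemma convex_step_neg:
  assumes N: "lower N" and S: "biclosed N S" and ab: "a \<in> S" "b \<in> S" and \<eta>: "\<eta> \<in> N"
    and comb: "\<eta> = p *\<^sub>R a + q *\<^sub>R b" and pq: "p > 0" "q > 0" and neg: "a - \<eta> \<in> P"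
    and IH: "\<And>a' b' p' q'. a' \<in> S \<Longrightarrow> b' \<in> S \<Longrightarrow> \<eta> = p' *\<^sub>R a' + q' *\<^sub>R b' \<Longrightarrow>
      p' > 0 \<Longrightarrow> q' > 0 \<Longrightarrow> H a' + H b' < H a + H b \<Longrightarrow> \<eta> \<in> S"
  shows "\<eta> \<in> S"
proof (rule ccontr)
  assume out: "\<eta> \<notin> S"
  define \<mu> where "\<mu> = a - \<eta>"
  have \<mu>P: "\<mu> \<in> P" using neg \<mu>_def by simp
  have a: "a = \<mu> + \<eta>" by (simp add: \<mu>_def)
  have inP: "a \<in> P" "b \<in> P" "\<eta> \<in> P" using ab \<eta> biclosed_sub[OF S] lower_sub[OF N] by auto
  have "\<mu> \<in> N" using lowerD[OF N \<mu>P inP(3)] a ab biclosed_sub[OF S] by auto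
  then have \<mu>S: "\<mu> \<in> S"
    using biclosed_add[OF biclosed_Diff[OF S], of \<mu> \<eta>] a ab \<eta> out biclosed_sub[OF S] by auto
  have e: "(1 - p) *\<^sub>R \<eta> = p *\<^sub>R \<mu> + q *\<^sub>R b"
  proof -
    have "\<eta> - p *\<^sub>R \<eta> = p *\<^sub>R (a - \<eta>) + q *\<^sub>R b" unfolding scaleR_diff_right by (subst comb) simp
    then show ?thesis by (simp add: \<mu>_def algebra_simps)
  qed
  \<comment> \<open>Both terms on the right have positive height; this forces \<open>p < 1\<close>
    and permits division by \<open>1 - p\<close>.\<close>
  have "(1 - p) * H \<eta> = p * H \<mu> + q * H b"
    using arg_cong[OF e, of H] by (simp add: H_scale H_add)
  also have "\<dots> > 0" using pq H_ge_1[OF \<mu>P] H_ge_1[OF inP(2)]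
    by (intro add_pos_pos mult_pos_pos) auto
  finally have p1: "1 - p > 0" using H_ge_1[OF inP(3)] by (simp add: zero_less_mult_iff)
  have "\<eta> = (1 / (1 - p)) *\<^sub>R ((1 - p) *\<^sub>R \<eta>)" using p1 by simp
  also have "\<dots> = (p / (1 - p)) *\<^sub>R \<mu> + (q / (1 - p)) *\<^sub>R b"
    unfolding e by (simp add: scaleR_add_right)
  finally have "\<eta> = (p / (1 - p)) *\<^sub>R \<mu> + (q / (1 - p)) *\<^sub>R b" .
  then have "\<eta> \<in> S"
    by (rule IH[OF \<mu>S ab(2)]) (use p1 pq H_ge_1[OF inP(3)] in \<open>auto simp: \<mu>_def H_diff\<close>)
  then show False using out by simp
qed

text \<open>The last remaining configuration, with \<open>p < q < 1\<close>, would force \<open>a\<close> and \<open>\<eta> - a\<close> to be a pair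
  of roots as in \<open>G\<^sub>2\<close>, and then \<open>cartan b (\<eta> - a)\<close> would lie strictly between 1 and 2.\<close>

lemma convex_step:
  assumes N: "lower N" and S: "biclosed N S" and ab: "a \<in> S" "b \<in> S" and \<eta>: "\<eta> \<in> N"
    and comb: "\<eta> = p *\<^sub>R a + q *\<^sub>R b" and pq: "p > 0" "q > 0" and ip: "\<eta> \<bullet> a > 0"
    and IH1: "\<And>S \<eta>' a' b' p' q'. biclosed N S \<Longrightarrow> a' \<in> S \<Longrightarrow> b' \<in> S \<Longrightarrow> \<eta>' \<in> N \<Longrightarrow>
      \<eta>' = p' *\<^sub>R a' + q' *\<^sub>R b' \<Longrightarrow> p' > 0 \<Longrightarrow> q' > 0 \<Longrightarrow> H \<eta>' < H \<eta> \<Longrightarrow> \<eta>' \<in> S"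
    and IH2: "\<And>a' b' p' q'. a' \<in> S \<Longrightarrow> b' \<in> S \<Longrightarrow> \<eta> = p' *\<^sub>R a' + q' *\<^sub>R b' \<Longrightarrow>
      p' > 0 \<Longrightarrow> q' > 0 \<Longrightarrow> H a' + H b' < H a + H b \<Longrightarrow> \<eta> \<in> S"
  shows "\<eta> \<in> S"
proof (rule ccontr)
  assume out: "\<eta> \<notin> S"
  have sub: "S \<subseteq> N" "N \<subseteq> P" using biclosed_sub[OF S] lower_sub[OF N] by auto
  have inP: "a \<in> P" "b \<in> P" "\<eta> \<in> P" using ab \<eta> sub by auto
  note R = inP[THEN P_root] and H1 = inP[THEN H_ge_1]
  have "\<eta> - a \<in> \<Phi>" using root_diff[OF R(3,1)] ip out ab by auto
  moreover have "a - \<eta> \<notin> P"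
  proof
    assume "a - \<eta> \<in> P"
    then have "\<eta> \<in> S" by (rule convex_step_neg[OF N S ab \<eta> comb pq]) (use IH2 in blast)
    then show False using out by simp
  qed
  ultimately have \<zeta>P: "\<eta> - a \<in> P" using P_diff_cases by blast
  define \<zeta> where "\<zeta> = \<eta> - a"
  have \<eta>e: "\<eta> = \<zeta> + a" and \<zeta>P: "\<zeta> \<in> P" using \<zeta>P by (auto simp: \<zeta>_def)
  have \<zeta>N: "\<zeta> \<in> N" using lowerD[OF N \<zeta>P inP(1)] \<eta> \<eta>e by auto
  have \<zeta>S: "\<zeta> \<notin> S" using biclosed_add[OF S _ ab(1), of \<zeta>] \<eta> \<eta>e out by auto
  have \<zeta>c: "\<zeta> = (p - 1) *\<^sub>R a + q *\<^sub>R b" by (simp add: \<zeta>_def comb algebra_simps)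
  note \<zeta>R = P_root[OF \<zeta>P]
  have "p \<noteq> 1"
  proof
    assume "p = 1"
    then have "q *\<^sub>R b \<in> \<Phi>" using \<zeta>c \<zeta>R by simp
    then have "q = 1" using root_scale[OF R(2)] pq by fastforce
    then show False using \<open>p = 1\<close> \<zeta>c \<zeta>S ab by simp
  qed
  moreover have "\<not> p > 1"
    using IH1[OF S ab \<zeta>N \<zeta>c] \<zeta>S pq H1 by (auto simp: \<zeta>_def H_diff)
  ultimately have p1: "p < 1" by simp
  have qb: "q *\<^sub>R b = (1 - p) *\<^sub>R \<eta> + p *\<^sub>R \<zeta>"
  proof -
    have "q *\<^sub>R b = \<eta> - p *\<^sub>R a" using comb by (simp add: algebra_simps)
    then show ?thesis by (simp add: \<zeta>_def algebra_simps)
  qed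
  have bc: "b = ((1 - p) / q) *\<^sub>R \<eta> + (p / q) *\<^sub>R \<zeta>"
  proof -
    have "b = (1 / q) *\<^sub>R (q *\<^sub>R b)" using pq by simp
    also have "\<dots> = ((1 - p) / q) *\<^sub>R \<eta> + (p / q) *\<^sub>R \<zeta>" unfolding qb by (simp add: scaleR_add_right)
    finally show ?thesis .
  qed
  \<comment> \<open>\<open>b\<close> is a positive combination of \<open>\<eta>\<close> and
    \<open>\<zeta>\<close>, both outside \<open>S\<close>. Were it lower than \<open>\<eta>\<close>,
    the induction hypothesis for the complement \<open>N - S\<close> would put it there; this is why
    \<open>IH1\<close> ranges over all biclosed sets.\<close>
  have hb: "H b \<ge> H \<eta>"
    using IH1[OF biclosed_Diff[OF S] _ _ _ bc] ab \<zeta>N \<zeta>S \<eta> out p1 pq sub by fastforce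
  have "H \<eta> = p * H a + q * H b" using comb by (simp add: H_add H_scale)
  then have "q * H b < H \<eta>" using pq H1 by (simp add: mult_pos_pos)
  then have "q * H b < 1 * H b" using hb by linarith
  then have q1: "q < 1" using H1(2) mult_less_cancel_right_pos[of "H b" q 1] by linarith
  have \<eta>b: "\<eta> \<bullet> b \<le> 0"
  proof (rule ccontr)
    assume "\<not> \<eta> \<bullet> b \<le> 0"
    then have "\<eta> - b \<in> \<Phi>" using root_diff[OF R(3,2)] out ab by auto
    moreover have "\<eta> - b \<notin> P" using H_ge_1[of "\<eta> - b"] hb by (auto simp: H_diff)
    ultimately have "b - \<eta> \<in> P" using P_diff_cases by blast
    have comb': "\<eta> = q *\<^sub>R b + p *\<^sub>R a" using comb by (simp add: add.commute)
    have "\<eta> \<in> S"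
    proof (rule convex_step_neg[OF N S ab(2,1) \<eta> comb' pq(2,1) \<open>b - \<eta> \<in> P\<close>])
      fix a' b' and p' q' :: real
      assume "a' \<in> S" "b' \<in> S" "\<eta> = p' *\<^sub>R a' + q' *\<^sub>R b'" "p' > 0" "q' > 0" "H a' + H b' < H b + H a"
      then show "\<eta> \<in> S" using IH2[of a' b' p' q'] by (simp add: add.commute)
    qed
    then show False using out by simp
  qed
  have "0 < q * (b \<bullet> b)" using pq root_sq_pos[OF R(2)] by simp
  also have "\<dots> = (1 - p) * (\<eta> \<bullet> b) + p * (\<zeta> \<bullet> b)"
    using arg_cong[OF qb, of "\<lambda>z. z \<bullet> b"] by (simp add: inner_add_left)
  finally have "p * (\<zeta> \<bullet> b) > - ((1 - p) * (\<eta> \<bullet> b))" by simp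
  moreover have "(1 - p) * (\<eta> \<bullet> b) \<le> 0" using p1 \<eta>b by (simp add: mult_nonneg_nonpos)
  ultimately have "p * (\<zeta> \<bullet> b) > 0" by linarith
  then have \<zeta>b: "b \<bullet> \<zeta> > 0" using pq by (simp add: zero_less_mult_iff inner_commute)
  \<comment> \<open>Splitting \<open>\<zeta>\<close> off \<open>b\<close> gives
    \<open>\<theta>\<close>, which is in \<open>S\<close> because \<open>b\<close> is inside and
    \<open>\<zeta>\<close> outside. Rewriting \<open>\<eta>\<close> through \<open>a\<close> and
    \<open>\<theta>\<close> lowers the total height, and the new coefficient of \<open>a\<close> has
    the sign of \<open>p - q\<close>; so \<open>p > q\<close> is impossible.\<close>
  have "b - \<zeta> \<in> \<Phi>" using root_diff[OF R(2) \<zeta>R _ \<zeta>b] ab \<zeta>S by auto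
  moreover have "H \<zeta> < H b" using hb H1 by (simp add: \<zeta>_def H_diff)
  ultimately have \<theta>P: "b - \<zeta> \<in> P" by (intro P_of_H_pos) (auto simp: H_diff)
  define \<theta> where "\<theta> = b - \<zeta>"
  have be: "b = \<theta> + \<zeta>" and \<theta>P: "\<theta> \<in> P" using \<theta>P by (auto simp: \<theta>_def)
  have \<theta>N: "\<theta> \<in> N" using lowerD[OF N \<theta>P \<zeta>P] be ab sub by auto
  have \<theta>S: "\<theta> \<in> S"
    using biclosed_add[OF biclosed_Diff[OF S], of \<theta> \<zeta>] be ab sub \<zeta>S \<zeta>N \<theta>N by auto
  have \<theta>c: "\<theta> = (1 - p) *\<^sub>R a + (1 - q) *\<^sub>R b" by (simp add: \<theta>_def \<zeta>c algebra_simps)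
  have "(1 - q) *\<^sub>R \<eta> = (1 - q) *\<^sub>R (p *\<^sub>R a) + q *\<^sub>R ((1 - q) *\<^sub>R b)"
    unfolding comb by (simp add: algebra_simps)
  also have "(1 - q) *\<^sub>R b = \<theta> - (1 - p) *\<^sub>R a" by (simp add: \<theta>c)
  finally have "(1 - q) *\<^sub>R \<eta> = (p - q) *\<^sub>R a + q *\<^sub>R \<theta>" by (simp add: algebra_simps)
  then have "(1 / (1 - q)) *\<^sub>R ((1 - q) *\<^sub>R \<eta>) = (1 / (1 - q)) *\<^sub>R ((p - q) *\<^sub>R a + q *\<^sub>R \<theta>)" by simp
  then have \<eta>c: "\<eta> = ((p - q) / (1 - q)) *\<^sub>R a + (q / (1 - q)) *\<^sub>R \<theta>"
    using q1 by (simp add: scaleR_add_right)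
  have "H \<theta> < H b" using H_ge_1[OF \<zeta>P] by (simp add: \<theta>_def H_diff)
  then have "\<not> p > q" using IH2[OF ab(1) \<theta>S \<eta>c] out q1 pq by auto
  moreover have "p \<noteq> q"
  proof
    assume "p = q"
    then have e: "\<eta> = (q / (1 - q)) *\<^sub>R \<theta>" using \<eta>c by simp
    then have "q / (1 - q) = 1 \<or> q / (1 - q) = -1" using root_scale[OF P_root[OF \<theta>P]] R(3) by metis
    then have "q / (1 - q) = 1" using q1 pq by (smt (verit) divide_pos_pos)
    then have "\<eta> = \<theta>" using e by (metis scaleR_one)
    then show False using \<theta>S out by simp
  qed
  ultimately have pltq: "p < q" by simp
  define A Z c r where "A = a \<bullet> a" and "Z = \<zeta> \<bullet> \<zeta>" and "c = - (a \<bullet> \<zeta>)" and "r = 1 - p"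
  have A: "A > 0" and Z: "Z > 0" and r: "0 < r" "r < 1"
    using root_sq_pos[OF R(1)] root_sq_pos[OF \<zeta>R] p1 pq by (auto simp: A_def Z_def r_def)
  have cA: "c < A" using ip by (simp add: \<eta>e c_def A_def inner_add_left inner_commute[of a \<zeta>])
  have qb': "q *\<^sub>R b = r *\<^sub>R a + \<zeta>" by (simp add: qb r_def \<zeta>_def algebra_simps)
  have bz: "q * (b \<bullet> \<zeta>) = Z - r * c"
    using arg_cong[OF qb', of "\<lambda>z. z \<bullet> \<zeta>"] by (simp add: inner_add_left c_def Z_def)
  have "q * (\<eta> \<bullet> b) = \<eta> \<bullet> (r *\<^sub>R a + \<zeta>)" using qb' by (metis inner_scaleR_right)
  also have "\<dots> = r * A + Z - (1 + r) * c"
    by (simp add: \<eta>e c_def A_def Z_def inner_add_left inner_add_right inner_commute algebra_simps)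
  \<comment> \<open>This is \<open>\<eta> \<bullet> b \<le> 0\<close> in the new quantities. With
    \<open>c < A\<close> it yields \<open>Z < c\<close>, so \<open>cartan a \<zeta>\<close> lies
    below -2 and must be -3.\<close>
  finally have e: "r * A + Z - (1 + r) * c \<le> 0" using \<eta>b pq
    by (metis mult_nonneg_nonpos less_imp_le)
  then have e': "r * (A - c) \<le> c - Z" by (simp add: algebra_simps)
  moreover have "r * (A - c) > 0" using r cA by simp
  ultimately have Zc: "Z < c" by linarith
  have ne: "a \<noteq> \<zeta>" "a \<noteq> - \<zeta>" using ab \<zeta>S P_not_neg[OF inP(1) \<zeta>P] by auto
  have k: "cartan a \<zeta> = - 2 * c / Z" by (simp add: c_def Z_def)
  have "- 2 * c / Z < -2" using Zc Z by (simp add: field_simps)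
  moreover have "\<bar>cartan a \<zeta>\<bar> \<le> 3" by (rule abs_cartan_le_3[OF R(1) \<zeta>R ne])
  moreover have "cartan a \<zeta> \<in> \<int>" by (rule cartan_int[OF \<zeta>R R(1)])
  ultimately have k3: "cartan a \<zeta> = -3"
  proof -
    assume *: "- 2 * c / Z < -2" "\<bar>cartan a \<zeta>\<bar> \<le> 3" "cartan a \<zeta> \<in> \<int>"
    obtain m where m: "cartan a \<zeta> = of_int m" using *(3) by (auto elim: Ints_cases)
    have "of_int m < (-2::real)" "of_int m \<ge> (-3::real)" using * m k by linarith+
    then have "m = -3" by linarith
    then show ?thesis using m by simp
  qed
  then have c32: "c = 3 / 2 * Z" using k Z by (simp add: field_simps)
  obtain m where m: "cartan \<zeta> a = of_int m" using cartan_int[OF R(1) \<zeta>R] by (auto elim: Ints_cases)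
  have ma: "of_int m = - 2 * c / A" using m by (simp add: c_def A_def inner_commute)
  have "-3 * of_int m < (4::real)" using cartan_prod_lt_4[OF R(1) \<zeta>R ne] k3 m by simp
  moreover have "of_int m < (0::real)" unfolding ma using Zc Z A by (simp add: divide_simps)
  ultimately have "m = -1" by linarith
  then have cA2: "A = 2 * c" using ma A by (simp add: field_simps)
  have "r * (3 / 2 * Z) \<le> 1 / 2 * Z" using e' cA2 c32 by simp
  then have "(3 * r) * Z \<le> 1 * Z" by (simp add: mult.commute)
  then have r3: "3 * r \<le> 1" using Z mult_le_cancel_right_pos by blast
  obtain n where n: "cartan b \<zeta> = of_int n" using cartan_int[OF \<zeta>R R(2)] by (auto elim: Ints_cases)
  have "q * (2 * (b \<bullet> \<zeta>)) = (2 - 3 * r) * Z" using bz c32 by (simp add: algebra_simps)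
  then have "q * cartan b \<zeta> = 2 - 3 * r" using Z by (simp add: Z_def field_simps)
  then have nq: "q * of_int n = 3 * p - 1" using n by (simp add: r_def)
  \<comment> \<open>The lower bound comes from \<open>3 * r \<le> 1\<close> and
    \<open>q < 1\<close>, the upper one from \<open>p < q < 1\<close>: 3p - 1 < 3q - 1 < 2q.\<close>
  have "q * of_int n > q * 1" using nq r3 q1 by (simp add: r_def)
  then have "of_int n > (1::real)" using pq by simp
  moreover have "q * of_int n < q * 2" using nq pltq q1 by simp
  then have "of_int n < (2::real)" using pq by simp
  ultimately have "n > 1" "n < 2" by linarith+
  then show False by simp
qed

text \<open>Lexicographic induction, outside on the height of \<open>\<eta>\<close>, inside on the
  sum of the heights of \<open>a\<close> and \<open>b\<close>. \<open>S\<close> is quantified within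
  the induction because a step passes to the complement.\<close>

lemma biclosed_convex:
  assumes N: "lower N" and "biclosed N S" "a \<in> S" "b \<in> S" "\<eta> \<in> N"
    and "\<eta> = p *\<^sub>R a + q *\<^sub>R b" and "p > 0" "q > 0"
  shows "\<eta> \<in> S"
proof -
  have "\<forall>S a b \<eta> p q. hn \<eta> = n \<longrightarrow> biclosed N S \<longrightarrow> a \<in> S \<longrightarrow> b \<in> S \<longrightarrow> \<eta> \<in> N \<longrightarrow>
     \<eta> = p *\<^sub>R a + q *\<^sub>R b \<longrightarrow> p > 0 \<longrightarrow> q > 0 \<longrightarrow> \<eta> \<in> S" for n
  proof (induction n rule: less_induct)
    case (less n)
    have "\<forall>S a b \<eta> p q. hn a + hn b = m \<longrightarrow> hn \<eta> = n \<longrightarrow> biclosed N S \<longrightarrow> a \<in> S \<longrightarrow> b \<in> S \<longrightarrow> \<eta> \<in> N \<longrightarrow>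
      \<eta> = p *\<^sub>R a + q *\<^sub>R b \<longrightarrow> p > 0 \<longrightarrow> q > 0 \<longrightarrow> \<eta> \<in> S" for m
    proof (induction m rule: less_induct)
      case (less m)
      note inner = less
      show ?case
      proof (intro allI impI)
        fix S a b \<eta> and p q :: real
        assume m: "hn a + hn b = m" and n: "hn \<eta> = n" and S: "biclosed N S" and ab: "a \<in> S" "b \<in> S"
          and \<eta>: "\<eta> \<in> N" and comb: "\<eta> = p *\<^sub>R a + q *\<^sub>R b" and pq: "p > 0" "q > 0"
        have sub: "S \<subseteq> N" "N \<subseteq> P" using biclosed_sub[OF S] lower_sub[OF N] by auto
        have I1: "\<And>S \<eta>' a' b' p' q'. biclosed N S \<Longrightarrow> a' \<in> S \<Longrightarrow> b' \<in> S \<Longrightarrow> \<eta>' \<in> N \<Longrightarrow>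
          \<eta>' = p' *\<^sub>R a' + q' *\<^sub>R b' \<Longrightarrow> p' > 0 \<Longrightarrow> q' > 0 \<Longrightarrow> H \<eta>' < H \<eta> \<Longrightarrow> \<eta>' \<in> S"
        proof -
          fix S \<eta>' a' b' and p' q' :: real
          assume *: "biclosed N S" "a' \<in> S" "b' \<in> S" "\<eta>' \<in> N"
            "\<eta>' = p' *\<^sub>R a' + q' *\<^sub>R b'" "p' > 0" "q' > 0" "H \<eta>' < H \<eta>"
          have "\<eta>' \<in> P" "\<eta> \<in> P" using *(4) \<eta> sub by auto
          then have "hn \<eta>' < n" using *(8) H_hn n by simp
          then show "\<eta>' \<in> S" using \<open>\<And>y. y < n \<Longrightarrow> _\<close> * by blast
        qed
        have I2: "\<And>a' b' p' q'. a' \<in> S \<Longrightarrow> b' \<in> S \<Longrightarrow> \<eta> = p' *\<^sub>R a' + q' *\<^sub>R b' \<Longrightarrow>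
          p' > 0 \<Longrightarrow> q' > 0 \<Longrightarrow> H a' + H b' < H a + H b \<Longrightarrow> \<eta> \<in> S"
        proof -
          fix a' b' and p' q' :: real
          assume *: "a' \<in> S" "b' \<in> S" "\<eta> = p' *\<^sub>R a' + q' *\<^sub>R b'" "p' > 0" "q' > 0" "H a' + H b' < H a + H b"
          have "a' \<in> P" "b' \<in> P" "a \<in> P" "b \<in> P" using * ab sub by auto
          then have "hn a' + hn b' < m" using *(6) H_hn m by simp
          then show "\<eta> \<in> S" using inner * n S \<eta> by blast
        qed
        \<comment> \<open>\<open>\<eta>\<close> pairs positively with itself, hence with one of the
          two generators, and the claim is symmetric in them.\<close>
        have "0 < \<eta> \<bullet> \<eta>" using \<eta> sub root_sq_pos P_root by blast
        also have "\<eta> \<bullet> \<eta> = p * (\<eta> \<bullet> a) + q * (\<eta> \<bullet> b)"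
          by (subst (2) comb) (simp add: inner_add_right)
        finally have "\<eta> \<bullet> a > 0 \<or> \<eta> \<bullet> b > 0"
          using pq by (smt (verit) mult_nonneg_nonpos)
        then show "\<eta> \<in> S"
        proof
          assume "\<eta> \<bullet> a > 0"
          then show ?thesis by (rule convex_step[OF N S ab \<eta> comb pq _ I1 I2])
        next
          assume b: "\<eta> \<bullet> b > 0"
          have comb': "\<eta> = q *\<^sub>R b + p *\<^sub>R a" using comb by (simp add: add.commute)
          show ?thesis
          proof (rule convex_step[OF N S ab(2,1) \<eta> comb' pq(2,1) b])
            fix a' b' and p' q' :: real
            assume "a' \<in> S" "b' \<in> S" "\<eta> = p' *\<^sub>R a' + q' *\<^sub>R b'" "p' > 0" "q' > 0" "H a' + H b' < H b + H a"
            then show "\<eta> \<in> S" using I2[of a' b' p' q'] by (simp add: add.commute)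
          qed (use I1 in blast)
        qed
      qed
    qed
    then show ?case by blast
  qed
  then show ?thesis using assms by blast
qed

text \<open>Condition (C) only provides a root \<open>\<gamma>\<close> of the parabolic subsystem; this puts it into \<open>N\<close>.\<close>

lemma lower_cone_memb:
  assumes N: "lower N" and \<gamma>: "\<gamma> \<in> P" "cf b \<gamma> = 0"
  shows "x \<in> N \<Longrightarrow> y \<in> N \<Longrightarrow> cf b x > 0 \<Longrightarrow> y = p *\<^sub>R x + q *\<^sub>R \<gamma> \<Longrightarrow> p > 0 \<Longrightarrow> q > 0 \<Longrightarrow> \<gamma> \<in> N"
proof (induction "hn x + hn y" arbitrary: x y p q rule: less_induct)
  case less
  note comb = less.prems(4)
  have inP: "x \<in> P" "y \<in> P" using less.prems lower_sub[OF N] by auto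
  note R = inP[THEN P_root] P_root[OF \<gamma>(1)] and H1 = inP[THEN H_ge_1]
  have cy: "cf b y = p * cf b x" using comb by (simp add: cf_add cf_scale \<gamma>)
  then have cyp: "cf b y > 0" using less.prems by simp
  have "0 < y \<bullet> y" using root_sq_pos[OF R(2)] .
  also have "y \<bullet> y = p * (y \<bullet> x) + q * (y \<bullet> \<gamma>)" by (subst (2) comb) (simp add: inner_add_right)
  finally have "y \<bullet> \<gamma> > 0 \<or> y \<bullet> x > 0" using less.prems by (smt (verit) mult_nonneg_nonpos)
  then show ?case
  proof
    \<comment> \<open>\<open>y - \<gamma>\<close> keeps the positive coefficient at
      \<open>b\<close>, so it is a positive root and \<open>\<gamma>\<close> is a summand of
      \<open>y\<close>.\<close>
    assume "y \<bullet> \<gamma> > 0"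
    moreover have "y \<noteq> \<gamma>" using cyp \<gamma> by auto
    ultimately have "y - \<gamma> \<in> \<Phi>" using root_diff[OF R(2,3)] by simp
    then have "y - \<gamma> \<in> P" by (rule P_of_cf_pos[of _ b]) (use cyp \<gamma> in \<open>simp add: cf_diff\<close>)
    then show ?thesis using lowerD[OF N _ \<gamma>(1), of "y - \<gamma>"] less.prems by simp
  next
    assume ip: "y \<bullet> x > 0"
    have "y \<noteq> x"
    proof
      assume "y = x"
      then have "p = 1" using cy less.prems(3) by simp
      then have "q *\<^sub>R \<gamma> = 0" using comb \<open>y = x\<close> by simp
      then show False using less.prems root_nz R(3) by simp
    qed
    then have "y - x \<in> \<Phi>" using root_diff[OF R(2,1)] ip by simp
    then have "y - x \<in> P \<or> x - y \<in> P" by (rule P_diff_cases)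
    then show ?thesis
    proof
      assume pos: "y - x \<in> P"
      have yxN: "y - x \<in> N" using lowerD[OF N pos inP(1)] less.prems by simp
      have e: "y - x = (p - 1) *\<^sub>R x + q *\<^sub>R \<gamma>" by (subst comb) (simp add: algebra_simps)
      \<comment> \<open>The coefficient of \<open>y - x\<close> at \<open>b\<close> is
        \<open>(p - 1) * cf b x\<close>, which gives \<open>p \<ge> 1\<close>; then \<open>y\<close>
        can be replaced by \<open>y - x\<close>.\<close>
      have "0 \<le> cf b (y - x)" using P_cf_nonneg pos by blast
      then have "0 \<le> (p - 1) * cf b x" using cy by (simp add: cf_diff algebra_simps)
      then have "p \<ge> 1" using less.prems(3) by (simp add: zero_le_mult_iff)
      show ?thesis
      proof (cases "p = 1")
        case True
        then have "y - x = q *\<^sub>R \<gamma>" using e by simp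
        moreover from this have "q = 1" using root_scale[OF R(3), of q] P_root[OF pos] less.prems by auto
        ultimately show ?thesis using yxN by simp
      next
        case False
        have "hn x + hn (y - x) < hn x + hn y"
          using H_hn[OF inP(2)] H_hn[OF pos] H1 by (simp add: H_diff)
        then show ?thesis using less.hyps[OF _ less.prems(1) yxN less.prems(3) e] \<open>p \<ge> 1\<close> False less.prems by simp
      qed
    next
      assume pos: "x - y \<in> P"
      have xyN: "x - y \<in> N" using lowerD[OF N pos inP(2)] less.prems by simp
      \<comment> \<open>Substituting x = (x - y) + y replaces \<open>x\<close> by the lower root
        \<open>x - y\<close>.\<close>
      have e: "(1 - p) *\<^sub>R y = p *\<^sub>R (x - y) + q *\<^sub>R \<gamma>"
      proof -
        have "y - p *\<^sub>R y = p *\<^sub>R x + q *\<^sub>R \<gamma> - p *\<^sub>R y" by (subst comb) simp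
        then show ?thesis by (simp add: algebra_simps)
      qed
      have "(1 - p) * H y = p * H (x - y) + q * H \<gamma>"
        using arg_cong[OF e, of H] by (simp add: H_scale H_add)
      also have "\<dots> > 0" using less.prems H_ge_1[OF pos] H_ge_1[OF \<gamma>(1)]
        by (intro add_pos_pos mult_pos_pos) auto
      finally have p1: "1 - p > 0" using H1 by (simp add: zero_less_mult_iff)
      have "y = (1 / (1 - p)) *\<^sub>R ((1 - p) *\<^sub>R y)" using p1 by simp
      also have "\<dots> = (p / (1 - p)) *\<^sub>R (x - y) + (q / (1 - p)) *\<^sub>R \<gamma>"
        unfolding e by (simp add: scaleR_add_right)
      finally have e': "y = (p / (1 - p)) *\<^sub>R (x - y) + (q / (1 - p)) *\<^sub>R \<gamma>" .
      have "hn (x - y) + hn y < hn x + hn y"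
        using H_hn[OF inP(1)] H_hn[OF pos] H1 by (simp add: H_diff)
      moreover have "cf b (x - y) > 0" using cy p1 less.prems by (simp add: cf_diff)
      ultimately show ?thesis using less.hyps[OF _ xyN less.prems(2) _ e'] p1 less.prems by simp
    qed
  qed
qed

text \<open>Either some simple root with room between \<open>x\<close> and \<open>y\<close> pairs
  positively with \<open>y\<close> and can be subtracted from it, or the positive square of
  \<open>y - x\<close> yields one that pairs negatively with \<open>x\<close>. In the second case
  \<open>x\<close> climbs to \<open>x + a\<close>, still below \<open>y\<close>.\<close>

lemma descent_between:
  assumes "y \<in> P"
  shows "x \<in> P \<Longrightarrow> x \<noteq> y \<Longrightarrow> \<forall>c\<in>\<Delta>. cf c x \<le> cf c y \<Longrightarrow>
    \<exists>a\<in>\<Delta>. y - a \<in> P \<and> cf a x < cf a y"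
proof (induction "hn y - hn x" arbitrary: x rule: less_induct)
  case less
  note R = P_root[OF assms] P_root[OF less.prems(1)]
  let ?d = "y - x"
  show ?case
  proof (cases "\<exists>a\<in>\<Delta>. cf a x < cf a y \<and> y \<bullet> a > 0")
    case True
    then obtain a where a: "a \<in> \<Delta>" "cf a x < cf a y" "y \<bullet> a > 0" by auto
    have "y \<noteq> a"
    proof
      assume ya: "y = a"
      obtain c where c: "c \<in> \<Delta>" "cf c x \<ge> 1" using P_nz_cf less.prems(1) by blast
      then have "cf c x \<le> cf c a" using less.prems(3) ya by simp
      then show False using a c ya by (auto simp: cf_simple split: if_splits)
    qed
    then have "y - a \<in> \<Phi>" using root_diff[OF R(1)] a simple_sub by auto
    moreover have "H (y - a) > 0"
    proof -
      have "H y \<noteq> 1"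
      proof
        assume "H y = 1"
        then have "cf a y = 0" using P_H_1_simple[OF assms] \<open>y \<noteq> a\<close> by (simp add: cf_simple)
        then show False using a P_cf_nonneg[OF less.prems(1), of a] by simp
      qed
      then have "H y > 1" using H_ge_1[OF assms] by simp
      then show ?thesis using a by (simp add: H_diff H_simple)
    qed
    ultimately show ?thesis using P_of_H_pos a by blast
  next
    case False
    have xd: "\<exists>a\<in>\<Delta>. cf a x < cf a y \<and> x \<bullet> a < 0"
    proof (rule ccontr)
      assume n: "\<not> ?thesis"
      have "?d \<bullet> ?d = ?d \<bullet> (\<Sum>c\<in>\<Delta>. cf c ?d *\<^sub>R c)" by (simp only: cf_expand[symmetric])
      also have "\<dots> = (\<Sum>c\<in>\<Delta>. cf c ?d * (?d \<bullet> c))" by (simp add: inner_sum_right)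
      also have "\<dots> \<le> 0"
      proof (rule sum_nonpos)
        fix c assume c: "c \<in> \<Delta>"
        show "cf c ?d * (?d \<bullet> c) \<le> 0"
        proof (cases "cf c x < cf c y")
          case True
          then have "?d \<bullet> c \<le> 0" using False n c by (force simp: inner_diff_left)
          then show ?thesis using True by (simp add: cf_diff mult_nonneg_nonpos)
        next
          case False
          then show ?thesis using less.prems(3) c by (force simp: cf_diff)
        qed
      qed
      finally show False using less.prems(2) by (metis inner_gt_zero_iff linorder_not_less right_minus_eq)
    qed
    then obtain a where a: "a \<in> \<Delta>" "cf a x < cf a y" "x \<bullet> a < 0" by auto
    have "x + a \<in> \<Phi>" using root_add[OF R(2)] P_not_neg less.prems a simple_P simple_sub by blast
    then have xa: "x + a \<in> P" using P_add less.prems a simple_P by blast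
    show ?thesis
    proof (cases "x + a = y")
      case True
      then have "y - a = x" by auto
      then show ?thesis using less.prems(1) a by auto
    next
      case False
      have le: "\<forall>c\<in>\<Delta>. cf c (x + a) \<le> cf c y"
      proof
        fix c assume c: "c \<in> \<Delta>"
        show "cf c (x + a) \<le> cf c y"
        proof (cases "c = a")
          case True
          then show ?thesis using a P_cf_nat[OF assms, of a] P_cf_nat[OF less.prems(1), of a]
            by (auto simp: cf_add cf_simple elim!: Nats_cases)
        qed (use less.prems(3) c a in \<open>auto simp: cf_add cf_simple\<close>)
      qed
      have "H (x + a) \<le> H y" unfolding ht_def by (rule sum_mono) (use le in auto)
      then have "hn (x + a) \<le> hn y" using H_hn[OF assms] H_hn[OF xa] by simp
      moreover have "hn x < hn (x + a)"
        using H_hn[OF xa] H_hn[OF less.prems(1)] a by (simp add: H_add H_simple)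
      ultimately have "hn y - hn (x + a) < hn y - hn x" by simp
      then obtain e where e: "e \<in> \<Delta>" "y - e \<in> P" "cf e (x + a) < cf e y"
        using less.hyps[OF _ xa False le] by blast
      then have "cf e x < cf e y" using a by (auto simp: cf_add cf_simple split: if_splits)
      then show ?thesis using e by blast
    qed
  qed
qed

text \<open>The case \<open>x = b\<close> of \<open>descent_between\<close>. Its strict inequality
  at \<open>a\<close> keeps the coefficient at \<open>b\<close> positive even when
  \<open>a = b\<close>.\<close>

lemma descent:
  assumes y: "y \<in> P" "cf b y > 0" "y \<noteq> b" "b \<in> \<Delta>"
  obtains a where "a \<in> \<Delta>" "y - a \<in> P" "cf b (y - a) > 0"
proof -
  have b1: "cf b y \<ge> 1" using y P_cf_nat[OF y(1), of b] by (auto elim!: Nats_cases)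
  have "\<forall>c\<in>\<Delta>. cf c b \<le> cf c y" using b1 P_cf_nonneg y by (auto simp: cf_simple)
  then obtain a where a: "a \<in> \<Delta>" "y - a \<in> P" "cf a b < cf a y"
    using descent_between[OF y(1) simple_P[OF y(4)]] y(3) by blast
  moreover have "cf b (y - a) > 0" using a y b1 by (auto simp: cf_diff cf_simple split: if_splits)
  ultimately show ?thesis using that by blast
qed

text \<open>The descent keeps \<open>b\<close> in the support, stays inside the lower set, and can
  stop only at \<open>b\<close>.\<close>

lemma lower_support:
  assumes N: "lower N" and b: "b \<in> \<Delta>"
  shows "y \<in> N \<Longrightarrow> cf b y > 0 \<Longrightarrow> b \<in> N"
proof (induction "hn y" arbitrary: y rule: less_induct)
  case less
  have yP: "y \<in> P" using less.prems lower_sub[OF N] by auto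
  show ?case
  proof (cases "y = b")
    case False
    then obtain a where a: "a \<in> \<Delta>" "y - a \<in> P" "cf b (y - a) > 0"
      using descent[OF yP less.prems(2) _ b] by blast
    have "y - a \<in> N" using lowerD[OF N a(2) simple_P[OF a(1)]] less.prems by simp
    moreover have "hn (y - a) < hn y" using H_hn[OF yP] H_hn[OF a(2)] a by (simp add: H_diff H_simple)
    ultimately show ?thesis using less.hyps a by blast
  qed (use less in simp)
qed

end


section \<open>Splitting off a totally ordered layer\<close>

text \<open>Down-sets of a strict total order form a chain, so their sizes are distinct; adding a
  least missing element shows that every size occurs.\<close>

lemma card_bij_down_sets:
  fixes R :: "'b \<Rightarrow> 'b \<Rightarrow> bool"
  assumes fin: "finite D" and irr: "\<And>x. x \<in> D \<Longrightarrow> \<not> R x x"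
    and tr: "\<And>x y z. x \<in> D \<Longrightarrow> y \<in> D \<Longrightarrow> z \<in> D \<Longrightarrow> R x y \<Longrightarrow> R y z \<Longrightarrow> R x z"
    and tot: "\<And>x y. x \<in> D \<Longrightarrow> y \<in> D \<Longrightarrow> x \<noteq> y \<Longrightarrow> R x y \<or> R y x"
  shows "bij_betw card {T. T \<subseteq> D \<and> (\<forall>y\<in>T. \<forall>x\<in>D. R x y \<longrightarrow> x \<in> T)} {0..card D}"
    (is "bij_betw card ?DS _")
  unfolding bij_betw_def
proof
  show "inj_on card ?DS"
  proof (rule inj_onI)
    fix T T' assume T: "T \<in> ?DS" and T': "T' \<in> ?DS" and c: "card T = card T'"
    have fT: "finite T" "finite T'" using T T' fin finite_subset by auto
    have "T \<subseteq> T' \<or> T' \<subseteq> T"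
    proof (rule ccontr)
      assume "\<not> ?thesis"
      then obtain u v where uv: "u \<in> T" "u \<notin> T'" "v \<in> T'" "v \<notin> T" by auto
      then have "R u v \<or> R v u" using tot[of u v] T T' by auto
      then show False using uv T T' by auto
    qed
    then show "T = T'" using c fT by (metis card_subset_eq)
  qed
next
  have "\<exists>T\<in>?DS. card T = k" if "k \<le> card D" for k
    using that
  proof (induction k)
    case 0
    show ?case by (rule bexI[of _ "{}"]) auto
  next
    case (Suc k)
    then obtain T where T: "T \<in> ?DS" "card T = k" by auto
    then have "D - T \<noteq> {}" using Suc.prems by auto
    \<comment> \<open>A least element outside \<open>T\<close> is found as one with the fewest
      predecessors.\<close>
    define pr where "pr x = {y \<in> D. R y x}" for x
    obtain x where x: "x \<in> D - T" "\<And>y. y \<in> D - T \<Longrightarrow> card (pr x) \<le> card (pr y)"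
      using \<open>D - T \<noteq> {}\<close> ex_has_least_nat[of "\<lambda>x. x \<in> D - T" _ "\<lambda>x. card (pr x)"] by blast
    have "insert x T \<in> ?DS"
    proof -
      have "z \<in> T" if z: "z \<in> D" "R z x" for z
      proof (rule ccontr)
        assume "z \<notin> T"
        moreover have "pr z \<subset> pr x" using z x(1) irr[of z] tr[of _ z x] unfolding pr_def by blast
        then have "card (pr z) < card (pr x)" using fin by (intro psubset_card_mono) (auto simp: pr_def)
        ultimately show False using x(2)[of z] z by auto
      qed
      then show ?thesis using T x by auto
    qed
    moreover have "card (insert x T) = Suc k" using T x fin finite_subset by (subst card_insert_disjoint) auto
    ultimately show ?case by blast
  qed
  then have "{0..card D} \<subseteq> card ` ?DS" by force
  moreover have "card ` ?DS \<subseteq> {0..card D}" using fin by (auto intro: card_mono)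
  ultimately show "card ` ?DS = {0..card D}" by blast
qed

definition weyl_poly :: "'a::euclidean_space set \<Rightarrow> int poly" where
  "weyl_poly N = (\<Sum>S | biclosed N S. monom 1 (card S))"

lemma poincare_poly_eq: "poincare_poly P I = weyl_poly (P - I)"
proof -
  have "weyl_type P I S = biclosed (P - I) S" for S
    by (auto simp: weyl_type_def biclosed_def rel_closed_def)
  then show ?thesis by (simp add: poincare_poly_def weyl_poly_def)
qed

lemma finite_biclosed: "finite N \<Longrightarrow> finite {S. biclosed N S}"
  by (rule finite_subset[of _ "Pow N"]) (auto dest: biclosed_sub)

context based_root_system
begin

section \<open>The order on normalised roots\<close>

definition nrm :: "'a \<Rightarrow> 'a \<Rightarrow> 'a" where "nrm b x = (1 / cf b x) *\<^sub>R x"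

text \<open>Roots with a positive coefficient at \<open>b\<close> are normalised to coefficient 1. The set \<open>S\<close>
  together with \<open>- (M - S)\<close> is a choice of positive system on \<open>M \<union> - M\<close>, and it orders the
  normalised roots.\<close>

definition before :: "'a \<Rightarrow> 'a set \<Rightarrow> 'a set \<Rightarrow> 'a \<Rightarrow> 'a \<Rightarrow> bool" where
  "before b M S x y \<longleftrightarrow> (\<exists>r>0. \<exists>g. (g \<in> S \<or> - g \<in> M - S) \<and> nrm b x - nrm b y = r *\<^sub>R g)"

lemma beforeI:
  "r > 0 \<Longrightarrow> g \<in> S \<or> - g \<in> M - S \<Longrightarrow> nrm b x - nrm b y = r *\<^sub>R g \<Longrightarrow> before b M S x y"
  unfolding before_def by blast

text \<open>Solved for \<open>- k\<close>, the relation makes it a positive combination of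
  \<open>g\<close> and \<open>h\<close>, and convexity would put it into \<open>S\<close>.\<close>

lemma cone_no_relation:
  assumes M: "lower M" and S: "biclosed M S" and g: "g \<in> S" "h \<in> S" "- k \<in> M - S"
    and r: "r > 0" "s > 0" "t > 0"
  shows "r *\<^sub>R g + s *\<^sub>R h + t *\<^sub>R k \<noteq> 0"
proof
  assume "r *\<^sub>R g + s *\<^sub>R h + t *\<^sub>R k = 0"
  then have "t *\<^sub>R (- k) = r *\<^sub>R g + s *\<^sub>R h"
    by (simp add: eq_neg_iff_add_eq_0 neg_eq_iff_add_eq_0 add.commute add.left_commute)
  then have "(1 / t) *\<^sub>R (t *\<^sub>R (- k)) = (1 / t) *\<^sub>R (r *\<^sub>R g + s *\<^sub>R h)" by simp
  then have "- k = (r / t) *\<^sub>R g + (s / t) *\<^sub>R h" using r by (simp add: scaleR_add_right)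
  then have "- k \<in> S" using biclosed_convex[OF M S g(1,2)] g r by auto
  then show False using g by simp
qed

text \<open>If all three signs agree, heights exclude the relation. If only two agree, it is
  \<open>cone_no_relation\<close> for \<open>S\<close> or, after negation, for
  \<open>M - S\<close>.\<close>

lemma signed_no_relation:
  assumes M: "lower M" and S: "biclosed M S"
    and g: "g \<in> S \<or> - g \<in> M - S" "h \<in> S \<or> - h \<in> M - S" "k \<in> S \<or> - k \<in> M - S"
    and r: "r > 0" "s > 0" "t > 0"
  shows "r *\<^sub>R g + s *\<^sub>R h + t *\<^sub>R k \<noteq> 0"
proof
  assume e: "r *\<^sub>R g + s *\<^sub>R h + t *\<^sub>R k = 0"
  have sub: "S \<subseteq> P" "M \<subseteq> P" using biclosed_sub[OF S] lower_sub[OF M] by auto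
  have He: "r * H g + s * H h + t * H k = 0"
    using arg_cong[OF e, of H] by (simp add: H_add H_scale H_zero)
  have Hpos: "x \<in> S \<Longrightarrow> q > 0 \<Longrightarrow> q * H x > 0" for x and q :: real
    using H_ge_1[of x] sub by (intro mult_pos_pos) (auto dest: H_ge_1)
  have Hneg: "- x \<in> M - S \<Longrightarrow> q > 0 \<Longrightarrow> q * H x < 0" for x and q :: real
    using H_ge_1[of "- x"] sub by (intro mult_pos_neg) (auto simp: H_neg)
  have perm: "s *\<^sub>R h + r *\<^sub>R g + t *\<^sub>R k = 0" "r *\<^sub>R g + t *\<^sub>R k + s *\<^sub>R h = 0"
    "s *\<^sub>R h + t *\<^sub>R k + r *\<^sub>R g = 0"
    using e by (simp_all add: add_ac)
  have neg: "q *\<^sub>R (- x) + q' *\<^sub>R (- x') + q'' *\<^sub>R (- x'') = - (q *\<^sub>R x + q' *\<^sub>R x' + q'' *\<^sub>R x'')"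
    for q q' q'' :: real and x x' x'' :: 'a by simp
  have negs: "r *\<^sub>R (- g) + s *\<^sub>R (- h) + t *\<^sub>R (- k) = 0" "r *\<^sub>R (- g) + t *\<^sub>R (- k) + s *\<^sub>R (- h) = 0"
    "s *\<^sub>R (- h) + t *\<^sub>R (- k) + r *\<^sub>R (- g) = 0"
    unfolding neg e perm by simp_all
  note R = cone_no_relation[OF M S] and R' = cone_no_relation[OF M biclosed_Diff[OF S]]
  have dd: "M - (M - S) = S" using biclosed_sub[OF S] by auto
  consider "g \<in> S" "h \<in> S" "k \<in> S" | "g \<in> S" "h \<in> S" "- k \<in> M - S" | "g \<in> S" "- h \<in> M - S" "k \<in> S"
    | "- g \<in> M - S" "h \<in> S" "k \<in> S" | "- g \<in> M - S" "- h \<in> M - S" "k \<in> S"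
    | "- g \<in> M - S" "h \<in> S" "- k \<in> M - S" | "g \<in> S" "- h \<in> M - S" "- k \<in> M - S"
    | "- g \<in> M - S" "- h \<in> M - S" "- k \<in> M - S"
    using g by (elim disjE) blast+
  then show False
  proof cases
    case 1
    then show False using He Hpos[of g r] Hpos[of h s] Hpos[of k t] r by linarith
  next
    case 2
    then show False using R[of g h k r s t] e r by blast
  next
    case 3
    then show False using R[of g k h r t s] perm r by blast
  next
    case 4
    then show False using R[of h k g s t r] perm r by blast
  next
    case 5
    then show False using R'[of "- g" "- h" "- k" r s t] negs r dd by simp
  next
    case 6
    then show False using R'[of "- g" "- k" "- h" r t s] negs r dd by simp
  next
    case 7
    then show False using R'[of "- h" "- k" "- g" s t r] negs r dd by simp
  next
    case 8
    then show False using He Hneg[of g r] Hneg[of h s] Hneg[of k t] r by linarith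
  qed
qed

text \<open>\<open>\<gamma>\<close> has no coefficient at \<open>b\<close>, so a dependence relation
  balances the coefficients of \<open>x\<close> and \<open>y\<close> there, and its first two terms
  form a multiple of the difference of the normalised roots.\<close>

lemma nrm_gap:
  assumes x: "x \<in> P" "cf b x > 0" and y: "y \<in> P" "cf b y > 0" and "x \<noteq> y"
    and \<gamma>: "\<gamma> \<in> P" "cf b \<gamma> = 0" and dep: "dependent {x, y, \<gamma>}"
  obtains r where "r \<noteq> 0" "nrm b x - nrm b y = r *\<^sub>R \<gamma>"
proof -
  have ne: "x \<noteq> \<gamma>" "y \<noteq> \<gamma>" using x y \<gamma> by auto
  obtain u where u: "\<exists>v\<in>{x, y, \<gamma>}. u v \<noteq> 0" "(\<Sum>v\<in>{x, y, \<gamma>}. u v *\<^sub>R v) = 0"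
    using dep dependent_finite[of "{x, y, \<gamma>}"] by auto
  define \<alpha> \<beta> \<delta> where "\<alpha> = u x" and "\<beta> = u y" and "\<delta> = u \<gamma>"
  have e: "\<alpha> *\<^sub>R x + \<beta> *\<^sub>R y + \<delta> *\<^sub>R \<gamma> = 0"
    using u(2) ne \<open>x \<noteq> y\<close> by (simp add: \<alpha>_def \<beta>_def \<delta>_def add.assoc)
  have ce: "\<alpha> * cf b x + \<beta> * cf b y = 0"
    using arg_cong[OF e, of "cf b"] \<gamma> by (simp add: cf_add cf_scale representation_zero)
  have xX: "x = cf b x *\<^sub>R nrm b x" "y = cf b y *\<^sub>R nrm b y" using x y by (auto simp: nrm_def)
  have "\<alpha> *\<^sub>R x + \<beta> *\<^sub>R y = (\<alpha> * cf b x) *\<^sub>R nrm b x + (\<beta> * cf b y) *\<^sub>R nrm b y"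
    by (metis xX scaleR_scaleR)
  also have "\<beta> * cf b y = - (\<alpha> * cf b x)" using ce by simp
  finally have k: "(\<alpha> * cf b x) *\<^sub>R (nrm b x - nrm b y) = - (\<delta> *\<^sub>R \<gamma>)"
    using e by (simp add: scaleR_diff_right eq_neg_iff_add_eq_0)
  have "\<alpha> \<noteq> 0"
  proof
    assume "\<alpha> = 0"
    then have "\<beta> = 0" using ce y by simp
    moreover have "\<delta> *\<^sub>R \<gamma> = 0" using k \<open>\<alpha> = 0\<close> by simp
    ultimately show False using u(1) \<open>\<alpha> = 0\<close> root_nz[OF P_root[OF \<gamma>(1)]] by (auto simp: \<alpha>_def \<beta>_def \<delta>_def)
  qed
  then have ax: "\<alpha> * cf b x \<noteq> 0" using x by simp
  have "nrm b x - nrm b y = (1 / (\<alpha> * cf b x)) *\<^sub>R ((\<alpha> * cf b x) *\<^sub>R (nrm b x - nrm b y))"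
    using ax by simp
  also have "\<dots> = (- \<delta> / (\<alpha> * cf b x)) *\<^sub>R \<gamma>" unfolding k by simp
  finally have r: "nrm b x - nrm b y = (- \<delta> / (\<alpha> * cf b x)) *\<^sub>R \<gamma>" .
  \<comment> \<open>Equal normalisations would make \<open>x\<close> a positive multiple of
    \<open>y\<close>, hence equal to it in a reduced system.\<close>
  moreover have "- \<delta> / (\<alpha> * cf b x) \<noteq> 0"
  proof
    assume "- \<delta> / (\<alpha> * cf b x) = 0"
    then have "nrm b x = nrm b y" using r by (metis scaleR_zero_left right_minus_eq)
    then have xy: "x = (cf b x / cf b y) *\<^sub>R y" using xX(1) by (simp add: nrm_def)
    then have "cf b x / cf b y = 1 \<or> cf b x / cf b y = -1"
      using root_scale[OF P_root[OF y(1)]] P_root[OF x(1)] by metis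
    moreover have "cf b x / cf b y > 0" using x y by simp
    ultimately have "cf b x / cf b y = 1" by linarith
    then show False using xy \<open>x \<noteq> y\<close> by (metis scaleR_one)
  qed
  ultimately show ?thesis using that by blast
qed

text \<open>A positive \<open>r\<close> exhibits \<open>x\<close> as a positive combination of
  \<open>y\<close> and \<open>\<gamma>\<close>, the situation of
  \<open>lower_cone_memb\<close>.\<close>

lemma nrm_gap_lower:
  assumes N: "lower N" and x: "x \<in> N" "cf b x > 0" and y: "y \<in> N" "cf b y > 0"
    and \<gamma>: "\<gamma> \<in> P" "cf b \<gamma> = 0" and r: "r > 0" and e: "nrm b x - nrm b y = r *\<^sub>R \<gamma>"
  shows "\<gamma> \<in> N" "x = (cf b x / cf b y) *\<^sub>R y + (cf b x * r) *\<^sub>R \<gamma>"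
proof -
  have "x = cf b x *\<^sub>R nrm b x" using x by (simp add: nrm_def)
  also have "nrm b x = nrm b y + r *\<^sub>R \<gamma>" using e by (simp add: algebra_simps)
  finally show e': "x = (cf b x / cf b y) *\<^sub>R y + (cf b x * r) *\<^sub>R \<gamma>"
    by (simp add: nrm_def scaleR_add_right)
  show "\<gamma> \<in> N"
    by (rule lower_cone_memb[OF N \<gamma> y(1) x(1) y(2) e']) (use x y r in auto)
qed

text \<open>\<open>nrm b (x + y)\<close> is the mean of \<open>nrm b x\<close> and
  \<open>nrm b y\<close> weighted by the coefficients at \<open>b\<close>, so it lies on the segment
  between them.\<close>

lemma nrm_add:
  assumes "cf b x > 0" "cf b y > 0"
  shows "nrm b x - nrm b (x + y) = (cf b y / (cf b x + cf b y)) *\<^sub>R (nrm b x - nrm b y)"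
    and "nrm b (x + y) - nrm b y = (cf b x / (cf b x + cf b y)) *\<^sub>R (nrm b x - nrm b y)"
proof -
  have nz: "cf b x + cf b y \<noteq> 0" using assms by simp
  have 1: "1 / cf b x - 1 / (cf b x + cf b y) = cf b y / (cf b x + cf b y) * (1 / cf b x)"
    "1 / (cf b x + cf b y) = cf b y / (cf b x + cf b y) * (1 / cf b y)"
    "1 / (cf b x + cf b y) = cf b x / (cf b x + cf b y) * (1 / cf b x)"
    "1 / cf b y - 1 / (cf b x + cf b y) = cf b x / (cf b x + cf b y) * (1 / cf b y)"
    using assms nz by (simp_all add: field_simps)
  have "nrm b x - nrm b (x + y) = (1 / cf b x - 1 / (cf b x + cf b y)) *\<^sub>R x - (1 / (cf b x + cf b y)) *\<^sub>R y"
    by (simp add: nrm_def cf_add scaleR_add_right scaleR_diff_left)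
  also have "\<dots> = (cf b y / (cf b x + cf b y)) *\<^sub>R (nrm b x - nrm b y)"
    unfolding 1(1) unfolding 1(2) by (simp add: nrm_def scaleR_diff_right)
  finally show "nrm b x - nrm b (x + y) = (cf b y / (cf b x + cf b y)) *\<^sub>R (nrm b x - nrm b y)" .
  have "nrm b (x + y) - nrm b y = (1 / (cf b x + cf b y)) *\<^sub>R x - (1 / cf b y - 1 / (cf b x + cf b y)) *\<^sub>R y"
    by (simp add: nrm_def cf_add scaleR_add_right scaleR_diff_left)
  also have "\<dots> = (cf b x / (cf b x + cf b y)) *\<^sub>R (nrm b x - nrm b y)"
    unfolding 1(4) unfolding 1(3) by (simp add: nrm_def scaleR_diff_right)
  finally show "nrm b (x + y) - nrm b y = (cf b x / (cf b x + cf b y)) *\<^sub>R (nrm b x - nrm b y)" .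
qed

lemma before_scale: "before b M S x y \<Longrightarrow> c > 0 \<Longrightarrow> nrm b u - nrm b v = c *\<^sub>R (nrm b x - nrm b y) \<Longrightarrow> before b M S u v"
proof -
  assume *: "before b M S x y" "c > 0" "nrm b u - nrm b v = c *\<^sub>R (nrm b x - nrm b y)"
  then obtain r g where "r > 0" "g \<in> S \<or> - g \<in> M - S" "nrm b x - nrm b y = r *\<^sub>R g"
    by (auto simp: before_def)
  then show "before b M S u v" unfolding before_def using * by (intro exI[of _ "c * r"]) auto
qed

section \<open>Biclosed subsets of \<open>N\<close> over a fixed biclosed subset of
  \<open>M\<close>\<close>

context
  fixes N b D M
  assumes N: "lower N"
    and D: "D = {x \<in> N. cf b x > 0}" and M: "M = {x \<in> N. cf b x = 0}"
    and pair: "\<And>x y. x \<in> D \<Longrightarrow> y \<in> D \<Longrightarrow> x \<noteq> y \<Longrightarrow> \<exists>\<gamma>\<in>P. cf b \<gamma> = 0 \<and> dependent {x, y, \<gamma>}"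
begin

lemma split_N: "N = M \<union> D" "M \<inter> D = {}"
proof -
  have "cf b x = 0 \<or> cf b x > 0" if "x \<in> N" for x
    using P_cf_nonneg[of x b] that lower_sub[OF N] by auto
  then show "N = M \<union> D" "M \<inter> D = {}" unfolding D M by auto
qed

lemma lower_M: "lower M"
  unfolding lower_def
proof (intro conjI ballI impI)
  show "M \<subseteq> P" using M lower_sub[OF N] by auto
  fix x y assume xy: "x \<in> P" "y \<in> P" "x + y \<in> M"
  then have "x \<in> N" "y \<in> N" using lowerD[OF N, of x y] M by auto
  moreover have "cf b x = 0 \<and> cf b y = 0"
    using xy M P_cf_nonneg[OF xy(1), of b] P_cf_nonneg[OF xy(2), of b] by (simp add: cf_add)
  ultimately show "x \<in> M" "y \<in> M" using M by auto
qed

text \<open>The normalised roots differ by a nonzero multiple of a root \<open>\<gamma>\<close> of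
  \<open>M\<close>. Exactly one of \<open>\<gamma>\<close>, \<open>- \<gamma>\<close> is admissible
  for \<open>S\<close>, and the sign of the multiple then decides the direction.\<close>

lemma before_total:
  assumes S: "biclosed M S" and xy: "x \<in> D" "y \<in> D" "x \<noteq> y"
  shows "before b M S x y \<or> before b M S y x"
proof -
  have inN: "x \<in> N" "cf b x > 0" "y \<in> N" "cf b y > 0" and inP: "x \<in> P" "y \<in> P"
    using xy D lower_sub[OF N] by auto
  obtain \<gamma> where \<gamma>: "\<gamma> \<in> P" "cf b \<gamma> = 0" "dependent {x, y, \<gamma>}" using pair[OF xy] by auto
  obtain r where r: "r \<noteq> 0" "nrm b x - nrm b y = r *\<^sub>R \<gamma>"
    using nrm_gap[OF inP(1) inN(2) inP(2) inN(4) xy(3) \<gamma>] .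
  have r': "nrm b y - nrm b x = (- r) *\<^sub>R \<gamma>" "nrm b y - nrm b x = r *\<^sub>R (- \<gamma>)"
    "nrm b x - nrm b y = (- r) *\<^sub>R (- \<gamma>)"
    using r(2) minus_diff_eq[of "nrm b x" "nrm b y"] by auto
  have "\<gamma> \<in> N"
  proof (cases "r > 0")
    case True
    then show ?thesis using nrm_gap_lower(1)[OF N inN \<gamma>(1,2) _ r(2)] by simp
  next
    case False
    then show ?thesis using nrm_gap_lower(1)[OF N inN(3,4,1,2) \<gamma>(1,2) _ r'(1)] r(1) by simp
  qed
  then have \<gamma>M: "\<gamma> \<in> M" using \<gamma> M by simp
  show ?thesis
  proof (cases "(r > 0) = (\<gamma> \<in> S)")
    case True
    then have "before b M S x y"
      using beforeI[OF _ _ r(2), of S M] beforeI[OF _ _ r'(3), of S M] \<gamma>M r(1) by (cases "r > 0") auto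
    then show ?thesis ..
  next
    case False
    then have "before b M S y x"
      using beforeI[OF _ _ r'(1), of S M] beforeI[OF _ _ r'(2), of S M] \<gamma>M r(1) by (cases "r > 0") auto
    then show ?thesis ..
  qed
qed

lemma before_irrefl:
  assumes S: "biclosed M S" shows "\<not> before b M S x x"
proof
  assume "before b M S x x"
  then obtain r g where g: "r > 0" "g \<in> S \<or> - g \<in> M - S" "0 = r *\<^sub>R g" by (auto simp: before_def)
  then have "g = 0" by simp
  then have "0 \<in> P" using g biclosed_sub[OF S] lower_sub[OF lower_M] by auto
  then show False using P_root zero_not_root by blast
qed

text \<open>By totality a failure closes a cycle; the differences around it sum to zero, which
  \<open>signed_no_relation\<close> forbids.\<close>

lemma before_trans:
  assumes S: "biclosed M S" and xyz: "x \<in> D" "y \<in> D" "z \<in> D"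
    and lt: "before b M S x y" "before b M S y z"
  shows "before b M S x z"
proof (rule ccontr)
  assume n: "\<not> ?thesis"
  obtain r g where g: "r > 0" "g \<in> S \<or> - g \<in> M - S" "nrm b x - nrm b y = r *\<^sub>R g"
    using lt(1) by (auto simp: before_def)
  obtain s h where h: "s > 0" "h \<in> S \<or> - h \<in> M - S" "nrm b y - nrm b z = s *\<^sub>R h"
    using lt(2) by (auto simp: before_def)
  show False
  proof (cases "x = z")
    case True
    then have "r *\<^sub>R g = - (s *\<^sub>R h)" using g(3) h(3) by (metis minus_diff_eq)
    \<comment> \<open>A cycle of length two has only two differences; halving one of them supplies
      the third term.\<close>
    moreover have "(s / 2) *\<^sub>R h + (s / 2) *\<^sub>R h = s *\<^sub>R h" by (simp flip: scaleR_add_left)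
    ultimately have "r *\<^sub>R g + (s / 2) *\<^sub>R h + (s / 2) *\<^sub>R h = 0"
      by (simp only: add.assoc) simp
    then show False using signed_no_relation[OF lower_M S g(2) h(2) h(2), of r "s/2" "s/2"] g h by simp
  next
    case False
    then have "before b M S z x" using before_total[OF S xyz(1,3)] n by simp
    then obtain t k where k: "t > 0" "k \<in> S \<or> - k \<in> M - S" "nrm b z - nrm b x = t *\<^sub>R k"
      by (auto simp: before_def)
    have "r *\<^sub>R g + s *\<^sub>R h + t *\<^sub>R k = 0" by (simp flip: g(3) h(3) k(3))
    then show False using signed_no_relation[OF lower_M S g(2) h(2) k(2)] g h k by simp
  qed
qed

lemma sum_in_D: "x \<in> N \<Longrightarrow> y \<in> N \<Longrightarrow> x \<in> D \<or> y \<in> D \<Longrightarrow> x + y \<in> N \<Longrightarrow> x + y \<in> D"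
  using D P_cf_nonneg[of x b] P_cf_nonneg[of y b] lower_sub[OF N] by (auto simp: cf_add)

lemma biclosed_M:
  assumes S: "biclosed N S" shows "biclosed M (S \<inter> M)"
proof -
  have "x + y \<in> S" if "x \<in> S" "y \<in> S" "x + y \<in> M" for x y
    using biclosed_add[OF S that(1,2)] that(3) split_N(1) by blast
  moreover have "x + y \<notin> S" if "x \<in> M - S" "y \<in> M - S" "x + y \<in> M" for x y
    using biclosed_add[OF biclosed_Diff[OF S], of x y] that split_N(1) by blast
  ultimately show ?thesis unfolding biclosed_def rel_closed_def by blast
qed

text \<open>If \<open>g\<close> is in \<open>S\<close>, then \<open>x\<close> is a positive
  combination of \<open>y\<close> and \<open>g\<close>. If \<open>- g\<close> is in the complement,
  then \<open>y\<close> is one of \<open>x\<close> and \<open>- g\<close>, so that \<open>x\<close>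
  outside \<open>S\<close> would force \<open>y\<close> outside.\<close>

lemma biclosed_down:
  assumes S: "biclosed N S" and y: "y \<in> S \<inter> D" and x: "x \<in> D" and bf: "before b M (S \<inter> M) x y"
  shows "x \<in> S"
proof -
  have inN: "x \<in> N" "cf b x > 0" "y \<in> N" "cf b y > 0" using x y D by auto
  obtain r g where r: "r > 0" and g: "g \<in> S \<inter> M \<or> - g \<in> M - S \<inter> M" and e: "nrm b x - nrm b y = r *\<^sub>R g"
    using bf by (auto simp: before_def)
  from g show "x \<in> S"
  proof
    assume gS: "g \<in> S \<inter> M"
    then have "g \<in> P" "cf b g = 0" using M lower_sub[OF N] by auto
    from biclosed_convex[OF N S _ _ inN(1) nrm_gap_lower(2)[OF N inN this r e]]
    show ?thesis using gS y inN r by auto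
  next
    assume gS: "- g \<in> M - S \<inter> M"
    then have gP: "- g \<in> P" "cf b (- g) = 0" using M lower_sub[OF N] by auto
    have e': "nrm b y - nrm b x = r *\<^sub>R (- g)" using e by (metis minus_diff_eq scaleR_minus_right)
    show ?thesis
    proof (rule ccontr)
      assume xS: "x \<notin> S"
      from biclosed_convex[OF N biclosed_Diff[OF S] _ _ inN(3) nrm_gap_lower(2)[OF N inN(3,4,1,2) gP r e']]
      have "y \<in> N - S" using gS xS split_N inN r by auto
      then show False using y by simp
    qed
  qed
qed

text \<open>Three effects suffice: sums inside \<open>M\<close> are governed by \<open>S\<close>,
  adding a root of \<open>M\<close> to a root of \<open>D\<close> moves its normalisation in the
  direction of that root, and a sum of two roots of \<open>D\<close> lies between them in the
  order.\<close>

lemma biclosed_Un: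
  assumes S: "biclosed M S" and T: "T \<subseteq> D" "\<forall>y\<in>T. \<forall>x\<in>D. before b M S x y \<longrightarrow> x \<in> T"
  shows "biclosed N (S \<union> T)"
proof -
  have SM: "S \<subseteq> M" using biclosed_sub[OF S] .
  have gap: "nrm b (x + g) - nrm b x = (1 / cf b x) *\<^sub>R g" if "x \<in> D" "g \<in> M" for x g
    using that by (simp add: D M nrm_def cf_add scaleR_add_right)
  have mixed1: "x + g \<in> T" if "x \<in> T" "g \<in> S" "x + g \<in> D" for x g
  proof -
    have xD: "x \<in> D" using T that by auto
    have "before b M S (x + g) x" unfolding before_def
      using gap[OF xD, of g] that SM xD D by (intro exI[of _ "1 / cf b x"]) auto
    then show ?thesis using T that by blast
  qed
  have mixed2: "x + g \<notin> T" if "x \<in> D - T" "g \<in> M - S" "x + g \<in> D" for x g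
  proof
    assume xg: "x + g \<in> T"
    have "nrm b x - nrm b (x + g) = (1 / cf b x) *\<^sub>R (- g)"
      using gap[of x g] that by (metis DiffD1 minus_diff_eq scaleR_minus_right)
    then have "before b M S x (x + g)" unfolding before_def
      using that D by (intro exI[of _ "1 / cf b x"] conjI exI[of _ "- g"]) auto
    then show False using T that xg by blast
  qed
  have between: "before b M S x (x + y) \<and> before b M S (x + y) y"
    if "x \<in> D" "y \<in> D" "before b M S x y" for x y
    using before_scale[OF that(3) _ nrm_add(1)] before_scale[OF that(3) _ nrm_add(2)] that D by simp
  \<comment> \<open>The order compares distinct roots only; twice a root is never a root of a
    reduced system.\<close>
  have nodouble: "x + y \<in> D \<Longrightarrow> x \<in> D \<Longrightarrow> x \<noteq> y" for x y
  proof
    assume "x + y \<in> D" "x \<in> D" "x = y"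
    then have "2 *\<^sub>R x \<in> \<Phi>" "x \<in> \<Phi>" using D lower_sub[OF N] P_root by (auto simp: scaleR_2)
    then show False using root_scale by fastforce
  qed
  \<comment> \<open>One equivalence serves both the closedness of \<open>S \<union> T\<close> and
    that of its complement.\<close>
  have dd: "x + y \<in> T \<longleftrightarrow> x \<in> T" if "x \<in> D" "y \<in> D" "x + y \<in> D" "x \<in> T \<longleftrightarrow> y \<in> T" for x y
  proof -
    have "x \<noteq> y" using nodouble that by blast
    then have "before b M S x y \<or> before b M S y x" using before_total[OF S] that by blast
    then consider "before b M S x y" | "before b M S y x" by blast
    then show ?thesis
    proof cases
      case 1
      then show ?thesis using between[OF that(1,2)] T that by blast
    next
      case 2
      then show ?thesis using between[OF that(2,1)] T that by (simp add: add.commute) blast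
    qed
  qed
  have c1: "x + y \<in> S \<union> T" if "x \<in> S \<union> T" "y \<in> S \<union> T" "x + y \<in> N" for x y
  proof -
    have inN: "x \<in> N" "y \<in> N" using that SM T split_N by auto
    from that(1,2) consider "x \<in> S" "y \<in> S" | "x \<in> S" "y \<in> T" | "x \<in> T" "y \<in> S" | "x \<in> T" "y \<in> T" by blast
    then show ?thesis
    proof cases
      case 1
      then have "x \<in> M" "y \<in> M" using SM by auto
      then have "x + y \<in> M" using that(3) M by (auto simp: cf_add)
      then show ?thesis using biclosed_add[OF S] 1 by blast
    next
      case 2
      then have "y + x \<in> D" using sum_in_D[OF inN _ that(3)] T by (auto simp: add.commute)
      then show ?thesis using mixed1[OF 2(2,1)] by (simp add: add.commute)
    next
      case 3
      then have "x + y \<in> D" using sum_in_D[OF inN _ that(3)] T by auto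
      then show ?thesis using mixed1[OF 3] by simp
    next
      case 4
      then have "x + y \<in> D" using sum_in_D[OF inN _ that(3)] T by auto
      then show ?thesis using dd[of x y] 4 T by auto
    qed
  qed
  have c2: "x + y \<notin> S \<union> T" if "x \<in> N - (S \<union> T)" "y \<in> N - (S \<union> T)" "x + y \<in> N" for x y
  proof -
    have inN: "x \<in> N" "y \<in> N" using that by auto
    have "x \<in> M - S \<or> x \<in> D - T" "y \<in> M - S \<or> y \<in> D - T" using that(1,2) split_N(1) by auto
    then consider "x \<in> M - S" "y \<in> M - S" | "x \<in> M - S" "y \<in> D - T" | "x \<in> D - T" "y \<in> M - S"
      | "x \<in> D - T" "y \<in> D - T"
      by blast
    then show ?thesis
    proof cases
      case 1
      then have "x + y \<in> M" using that(3) M by (auto simp: cf_add)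
      then show ?thesis using biclosed_add[OF biclosed_Diff[OF S] 1] T split_N by blast
    next
      case 2
      then have "y + x \<in> D" using sum_in_D[OF inN _ that(3)] by (auto simp: add.commute)
      then show ?thesis using mixed2[OF 2(2,1)] SM split_N by (auto simp: add.commute)
    next
      case 3
      then have "x + y \<in> D" using sum_in_D[OF inN _ that(3)] by auto
      then show ?thesis using mixed2[OF 3] SM split_N by auto
    next
      case 4
      then have "x + y \<in> D" using sum_in_D[OF inN _ that(3)] by auto
      then show ?thesis using dd[of x y] 4 SM split_N by auto
    qed
  qed
  show ?thesis unfolding biclosed_def rel_closed_def
    using c1 c2 SM T split_N(1) by blast
qed

text \<open>The order on \<open>D\<close> depends on \<open>S\<close>, but the number of its
  down-sets of each size does not, so the double sum becomes a product.\<close>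

lemma weyl_poly_factor: "weyl_poly N = weyl_poly M * (\<Sum>k = 0..card D. monom 1 k)"
proof -
  define DS where "DS S = {T. T \<subseteq> D \<and> (\<forall>y\<in>T. \<forall>x\<in>D. before b M S x y \<longrightarrow> x \<in> T)}" for S
  have fin: "finite N" "finite M" "finite D"
    using finite_P lower_sub[OF N] split_N(1) by (metis finite_subset, metis finite_Un finite_subset, metis finite_Un finite_subset)
  have finDS: "finite (DS S)" for S using fin by (auto simp: DS_def intro: finite_subset[of _ "Pow D"])
  have inner: "(\<Sum>T\<in>DS S. monom (1::int) (card T)) = (\<Sum>k = 0..card D. monom 1 k)" if "biclosed M S" for S
  proof -
    have "bij_betw card (DS S) {0..card D}" unfolding DS_def
      using card_bij_down_sets[OF fin(3), of "before b M S"] before_irrefl[OF that]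
        before_trans[OF that] before_total[OF that] by blast
    then show ?thesis by (rule sum.reindex_bij_betw)
  qed
  have "weyl_poly N = (\<Sum>(S, T)\<in>(SIGMA S:{S. biclosed M S}. DS S). monom 1 (card S + card T))"
    unfolding weyl_poly_def
  proof (rule sum.reindex_bij_witness[where j = "\<lambda>S. (S \<inter> M, S \<inter> D)" and i = "\<lambda>(S, T). S \<union> T"])
    fix S assume "S \<in> {S. biclosed N S}"
    then have S: "biclosed N S" by simp
    have SN: "S \<subseteq> N" using biclosed_sub[OF S] .
    then show "(case (S \<inter> M, S \<inter> D) of (S, T) \<Rightarrow> S \<union> T) = S" using split_N by auto
    show "(S \<inter> M, S \<inter> D) \<in> (SIGMA S:{S. biclosed M S}. DS S)"
      using biclosed_M[OF S] biclosed_down[OF S] by (auto simp: DS_def)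
    have "card S = card (S \<inter> M \<union> S \<inter> D)" using SN split_N(1) by (intro arg_cong[of _ _ card]) auto
    also have "\<dots> = card (S \<inter> M) + card (S \<inter> D)"
      using fin split_N(2) by (intro card_Un_disjoint) auto
    finally show "(case (S \<inter> M, S \<inter> D) of (S, T) \<Rightarrow> monom 1 (card S + card T)) = monom (1::int) (card S)"
      by simp
  next
    fix ST assume "ST \<in> (SIGMA S:{S. biclosed M S}. DS S)"
    then obtain S T where ST: "ST = (S, T)" "biclosed M S" "T \<in> DS S" by auto
    have "S \<subseteq> M" "T \<subseteq> D" using ST biclosed_sub by (auto simp: DS_def)
    then show "(\<lambda>S. (S \<inter> M, S \<inter> D)) (case ST of (S, T) \<Rightarrow> S \<union> T) = ST" using ST split_N(2) by auto
    show "(case ST of (S, T) \<Rightarrow> S \<union> T) \<in> {S. biclosed N S}"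
      using ST biclosed_Un by (auto simp: DS_def)
  qed
  also have "\<dots> = (\<Sum>S | biclosed M S. \<Sum>T\<in>DS S. monom 1 (card S + card T))"
    by (rule sum.Sigma[symmetric]) (use finDS finite_biclosed[OF fin(2)] in auto)
  also have "\<dots> = (\<Sum>S | biclosed M S. monom 1 (card S) * (\<Sum>T\<in>DS S. monom 1 (card T)))"
    by (simp add: sum_distrib_left mult_monom)
  also have "\<dots> = (\<Sum>S | biclosed M S. monom 1 (card S) * (\<Sum>k = 0..card D. monom 1 k))"
    by (intro sum.cong) (auto simp: inner)
  finally show ?thesis by (simp add: weyl_poly_def sum_distrib_right)
qed

text \<open>Descent from a root of \<open>D\<close> by one simple root stays in \<open>D\<close>, so
  the occurring heights form an interval starting at 1; injectivity makes each occur once.\<close>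

lemma heights_D:
  assumes b: "b \<in> \<Delta>" and inj: "inj_on H D"
  shows "card {x \<in> D. H x = real j} = (if 1 \<le> j \<and> j \<le> card D then 1 else 0)"
proof -
  have DP: "D \<subseteq> P" using D lower_sub[OF N] by auto
  have fin: "finite D" using DP finite_P finite_subset by blast
  have hinj: "inj_on hn D" using inj H_hn DP by (metis (no_types, lifting) inj_on_def subsetD)
  have step: "\<exists>z\<in>D. hn z = hn y - 1" if y: "y \<in> D" "hn y > 1" for y
  proof -
    have yP: "y \<in> P" "cf b y > 0" "y \<in> N" using y D DP by auto
    have "y \<noteq> b" using y H_simple[OF b] H_hn[OF simple_P[OF b]] by auto
    then obtain a where a: "a \<in> \<Delta>" "y - a \<in> P" "cf b (y - a) > 0" using descent[OF yP(1,2) _ b] by blast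
    have "y - a \<in> N" using lowerD[OF N a(2) simple_P[OF a(1)]] yP by simp
    then have "y - a \<in> D" using a D by simp
    moreover have "real (hn (y - a)) = real (hn y) - 1"
      using H_hn[OF a(2)] H_hn[OF yP(1)] a by (simp add: H_diff H_simple)
    then have "hn (y - a) = hn y - 1" using y by linarith
    ultimately show ?thesis by blast
  qed
  have down: "y \<in> D \<Longrightarrow> hn y = j + k \<Longrightarrow> j \<ge> 1 \<Longrightarrow> j \<in> hn ` D" for y k j
  proof (induction k arbitrary: y)
    case (Suc k)
    then obtain z where "z \<in> D" "hn z = hn y - 1" using step[of y] by auto
    then show ?case using Suc by auto
  qed force
  have ge1: "hn y \<ge> 1" if "y \<in> D" for y using H_ge_1[of y] H_hn[of y] that DP by auto
  have "hn ` D = {1..card D}"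
  proof (cases "D = {}")
    case False
    define m where "m = Max (hn ` D)"
    have "m \<in> hn ` D" unfolding m_def using fin False by (intro Max_in) auto
    then obtain y where y: "y \<in> D" "hn y = m" by auto
    have "{1..m} \<subseteq> hn ` D"
    proof
      fix j assume "j \<in> {1..m}"
      then show "j \<in> hn ` D" using down[OF y(1), of j "m - j"] y by auto
    qed
    moreover have "hn ` D \<subseteq> {1..m}" using ge1 fin by (auto simp: m_def)
    ultimately have e: "hn ` D = {1..m}" by blast
    then have "card D = m" using card_image[OF hinj] by simp
    then show ?thesis using e by simp
  qed simp
  moreover have eq: "{x \<in> D. H x = real j} = {x \<in> D. hn x = j}" using H_hn DP by auto
  ultimately show ?thesis
  proof (cases "j \<in> hn ` D")
    case True
    then obtain y where y: "y \<in> D" "hn y = j" by auto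
    then have "{x \<in> D. hn x = j} = {y}" using hinj by (auto dest: inj_onD)
    then show ?thesis using eq True \<open>hn ` D = {1..card D}\<close> by auto
  next
    case False
    then have "{x \<in> D. hn x = j} = {}" by auto
    then have "card {x \<in> D. H x = real j} = 0" unfolding eq by (metis card.empty)
    then show ?thesis using False \<open>hn ` D = {1..card D}\<close> by auto
  qed
qed

end

end


context based_root_system
begin

section \<open>Root strings\<close>

text \<open>For \<open>x\<close> not proportional to \<open>a\<close> this is one less than the
  number of roots on the \<open>a\<close>-string through \<open>x\<close>. As a maximum over the
  whole string it is visibly constant along it.\<close>

definition string_top :: "'a \<Rightarrow> 'a \<Rightarrow> real" where
  "string_top a x = Max {cartan (x + of_int k *\<^sub>R a) a |k. x + of_int k *\<^sub>R a \<in> \<Phi>}"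

lemma cartan_shift: "a \<in> \<Phi> \<Longrightarrow> cartan (x + c *\<^sub>R a) a = cartan x a + 2 * c"
  using root_sq_pos[of a] by (simp add: inner_add_left field_simps)

lemma finite_string: "finite {cartan (x + of_int k *\<^sub>R a) a |k. x + of_int k *\<^sub>R a \<in> \<Phi>}"
  by (rule finite_subset[OF _ finite_imageI[OF finite_roots, of "\<lambda>z. cartan z a"]]) auto

lemma string_top_shift: "string_top a (x + of_int j *\<^sub>R a) = string_top a x"
proof -
  have "{cartan (x + of_int j *\<^sub>R a + of_int k *\<^sub>R a) a |k. x + of_int j *\<^sub>R a + of_int k *\<^sub>R a \<in> \<Phi>}
    = {cartan (x + of_int k *\<^sub>R a) a |k. x + of_int k *\<^sub>R a \<in> \<Phi>}" (is "?L = ?R")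
  proof (intro set_eqI iffI)
    fix z assume "z \<in> ?L"
    then obtain k where "z = cartan (x + of_int j *\<^sub>R a + of_int k *\<^sub>R a) a"
      "x + of_int j *\<^sub>R a + of_int k *\<^sub>R a \<in> \<Phi>" by auto
    moreover have "x + of_int j *\<^sub>R a + of_int k *\<^sub>R a = x + of_int (j + k) *\<^sub>R a"
      by (simp add: scaleR_add_left add.assoc)
    ultimately show "z \<in> ?R" by (metis (mono_tags, lifting) mem_Collect_eq)
  next
    fix z assume "z \<in> ?R"
    then obtain k where "z = cartan (x + of_int k *\<^sub>R a) a" "x + of_int k *\<^sub>R a \<in> \<Phi>" by auto
    moreover have "x + of_int k *\<^sub>R a = x + of_int j *\<^sub>R a + of_int (k - j) *\<^sub>R a"
      by (simp add: scaleR_diff_left)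
    ultimately show "z \<in> ?L" by (metis (mono_tags, lifting) mem_Collect_eq)
  qed
  then show ?thesis by (simp add: string_top_def)
qed

lemma string_top_add: "string_top a (x + a) = string_top a x"
  and string_top_diff: "string_top a (x - a) = string_top a x"
  using string_top_shift[of a x 1] string_top_shift[of a x "-1"] by simp_all

lemma cartan_le_string_top: "x \<in> \<Phi> \<Longrightarrow> cartan x a \<le> string_top a x"
  unfolding string_top_def by (rule Max_ge[OF finite_string]) (auto intro!: exI[of _ 0])

lemma string_top_attained:
  assumes "x \<in> \<Phi>"
  obtains k where "x + of_int k *\<^sub>R a \<in> \<Phi>" "string_top a x = cartan (x + of_int k *\<^sub>R a) a"
proof -
  have "cartan (x + of_int 0 *\<^sub>R a) a \<in> {cartan (x + of_int k *\<^sub>R a) a |k. x + of_int k *\<^sub>R a \<in> \<Phi>}"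
    using assms by (intro CollectI exI[of _ 0]) auto
  then have "string_top a x \<in> {cartan (x + of_int k *\<^sub>R a) a |k. x + of_int k *\<^sub>R a \<in> \<Phi>}"
    unfolding string_top_def by (intro Max_in finite_string) blast
  then show ?thesis using that by auto
qed

lemma reflect_int:
  assumes "a \<in> \<Phi>" "x \<in> \<Phi>"
  obtains m where "cartan x a = of_int m" "x - of_int m *\<^sub>R a \<in> \<Phi>"
proof -
  obtain m where m: "cartan x a = of_int m" using cartan_int[OF assms] by (rule Ints_cases)
  show thesis using that[OF m] reflect[OF assms] unfolding m by blast
qed

lemma neg_cartan_le_string_top:
  assumes "a \<in> \<Phi>" "x \<in> \<Phi>" shows "- cartan x a \<le> string_top a x"
proof -
  obtain m where m: "cartan x a = of_int m" "x - of_int m *\<^sub>R a \<in> \<Phi>" using reflect_int[OF assms] .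
  have e: "x - of_int m *\<^sub>R a = x + of_int (- m) *\<^sub>R a" by simp
  have "cartan (x + of_int (- m) *\<^sub>R a) a = - cartan x a"
    unfolding cartan_shift[OF assms(1)] m(1) by simp
  moreover have "cartan (x + of_int (- m) *\<^sub>R a) a \<le> string_top a (x + of_int (- m) *\<^sub>R a)"
    by (rule cartan_le_string_top) (use m(2) in simp)
  ultimately show ?thesis unfolding string_top_shift by linarith
qed

lemma not_multiple:
  assumes "a \<in> \<Phi>" "x \<in> \<Phi>" "x \<noteq> a" "x \<noteq> - a" shows "x \<noteq> c *\<^sub>R a"
proof
  assume x: "x = c *\<^sub>R a"
  then have "c = 1 \<or> c = -1" using root_scale[OF assms(1), of c] assms(2) by blast
  then show False using x assms(3,4) by auto
qed

text \<open>For a negative Cartan integer a single addition works. Otherwise every root of the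
  string above \<open>x\<close> pairs positively with \<open>a\<close>, so one can walk down from
  the top, root by root, to \<open>x + a\<close>.\<close>

lemma string_up_iff:
  assumes a: "a \<in> \<Phi>" and x: "x \<in> \<Phi>" "x \<noteq> a" "x \<noteq> - a"
  shows "x + a \<in> \<Phi> \<longleftrightarrow> cartan x a < string_top a x"
proof
  assume "x + a \<in> \<Phi>"
  then have "cartan (x + a) a \<le> string_top a x"
    using cartan_le_string_top string_top_add by metis
  moreover have "cartan (x + a) a = cartan x a + 2" using cartan_shift[OF a, of x 1] by (simp only: scaleR_one)
  ultimately show "cartan x a < string_top a x" by linarith
next
  assume lt: "cartan x a < string_top a x"
  show "x + a \<in> \<Phi>"
  proof (cases "cartan x a < 0")
    case True
    then have "x \<bullet> a < 0" using root_sq_pos[OF a] by (simp add: divide_less_0_iff)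
    then show ?thesis using root_add[OF x(1) a x(3)] by simp
  next
    case False
    obtain k where k: "x + of_int k *\<^sub>R a \<in> \<Phi>" "string_top a x = cartan (x + of_int k *\<^sub>R a) a"
      using string_top_attained[OF x(1)] .
    have "(0::real) < of_int k" using lt k(2) unfolding cartan_shift[OF a] by linarith
    then have "k > 0" by simp
    have "x + (of_nat (Suc n)) *\<^sub>R a \<in> \<Phi> \<Longrightarrow> x + a \<in> \<Phi>" for n
    proof (induction n)
      case (Suc n)
      let ?z = "x + of_nat (Suc (Suc n)) *\<^sub>R a"
      have "0 \<le> cartan x a" using False by (simp only: not_less)
      then have "cartan ?z a > 0" unfolding cartan_shift[OF a] by (rule add_nonneg_pos) simp
      then have pos: "?z \<bullet> a > 0" using root_sq_pos[OF a] by (simp add: zero_less_divide_iff)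
      have "?z \<noteq> a"
      proof
        assume "?z = a"
        moreover have "x = ?z - of_nat (Suc (Suc n)) *\<^sub>R a" by simp
        ultimately have "x = a - of_nat (Suc (Suc n)) *\<^sub>R a" by metis
        then have "x = (1 - of_nat (Suc (Suc n))) *\<^sub>R a" by (simp only: scaleR_diff_left scaleR_one)
        then show False using not_multiple[OF a x] by blast
      qed
      then have "?z - a \<in> \<Phi>" using root_diff[OF Suc.prems a _ pos] by simp
      moreover have "?z - a = x + of_nat (Suc n) *\<^sub>R a" by (simp add: algebra_simps scaleR_2)
      ultimately show ?case using Suc.IH by metis
    qed simp
    moreover have "(of_nat (Suc (nat k - 1)) :: real) = of_int k" using \<open>k > 0\<close> by simp
    ultimately show ?thesis using k(1) by metis
  qed
qed

text \<open>The reflection in \<open>a\<close> reverses the string and negates the Cartan integer,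
  so going down from \<open>x\<close> is going up from its mirror image \<open>y\<close>.\<close>

lemma string_down_iff:
  assumes a: "a \<in> \<Phi>" and x: "x \<in> \<Phi>" "x \<noteq> a" "x \<noteq> - a"
  shows "x - a \<in> \<Phi> \<longleftrightarrow> - cartan x a < string_top a x"
proof
  assume "x - a \<in> \<Phi>"
  then have "- cartan (x - a) a \<le> string_top a x"
    using neg_cartan_le_string_top[OF a] string_top_diff by metis
  moreover have "cartan (x - a) a = cartan x a - 2"
    using cartan_shift[OF a, of x "-1"] by (simp only: scaleR_minus_left scaleR_one add_uminus_conv_diff)
  ultimately show "- cartan x a < string_top a x" by linarith
next
  assume lt: "- cartan x a < string_top a x"
  obtain m where m: "cartan x a = of_int m" "x - of_int m *\<^sub>R a \<in> \<Phi>" using reflect_int[OF a x(1)] .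
  define y where "y = x + of_int (- m) *\<^sub>R a"
  have yR: "y \<in> \<Phi>" using m by (simp add: y_def)
  have y: "cartan y a = - of_int m" unfolding y_def cartan_shift[OF a] m(1) by simp
  have ne: "y \<noteq> c *\<^sub>R a" for c
  proof
    assume "y = c *\<^sub>R a"
    then have "x = (c + of_int m) *\<^sub>R a" by (simp add: y_def algebra_simps)
    then show False using not_multiple[OF a x] by blast
  qed
  have "cartan y a < string_top a y" unfolding y using lt m(1) string_top_shift[of a x "- m"] y_def by metis
  moreover have ya: "y \<noteq> a" "y \<noteq> - a" using ne[of 1] ne[of "-1"] by simp_all
  ultimately have "y + a \<in> \<Phi>" using string_up_iff[OF a yR ya] by blast
  moreover have "cartan (y + a) a = cartan y a + 2" using cartan_shift[OF a, of y 1] by (simp only: scaleR_one)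
  ultimately have "y + a - (- of_int m + 2) *\<^sub>R a \<in> \<Phi>" using reflect[OF a] y by metis
  moreover have "y + a - (- of_int m + 2) *\<^sub>R a = x - a" by (simp add: y_def algebra_simps scaleR_2)
  ultimately show "x - a \<in> \<Phi>" by metis
qed

lemma string_top_parity:
  assumes a: "a \<in> \<Phi>" and x: "x \<in> \<Phi>"
  obtains k :: int where "string_top a x = cartan x a + 2 * of_int k"
  using string_top_attained[OF x, of a] cartan_shift[OF a] by metis

lemma string_top_le_3:
  assumes a: "a \<in> \<Phi>" and x: "x \<in> \<Phi>" "x \<noteq> a" "x \<noteq> - a"
  shows "string_top a x \<le> 3"
proof -
  obtain k where k: "x + of_int k *\<^sub>R a \<in> \<Phi>" "string_top a x = cartan (x + of_int k *\<^sub>R a) a"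
    using string_top_attained[OF x(1)] .
  have "x + of_int k *\<^sub>R a \<noteq> c *\<^sub>R a" for c
  proof
    assume "x + of_int k *\<^sub>R a = c *\<^sub>R a"
    then have "x = (c - of_int k) *\<^sub>R a" by (simp add: algebra_simps)
    then show False using not_multiple[OF a x] by blast
  qed
  from this[of 1] this[of "-1"] have "\<bar>cartan (x + of_int k *\<^sub>R a) a\<bar> \<le> 3"
    by (intro abs_cartan_le_3[OF k(1) a]) auto
  then show ?thesis using k(2) by linarith
qed

text \<open>With top value at most 2, a step up is possible only for the pairs (-2, 2), (-1, 1), (0,
  2) of Cartan integer and top value, so the weight depends on the Cartan integer alone. At -1 the
  top values 1 and 3 would give different weights.\<close>

lemma up_weight_value:
  assumes a: "a \<in> \<Phi>" and x: "x \<in> \<Phi>" "x \<noteq> a" "x \<noteq> - a" and up: "x + a \<in> \<Phi>" and T: "string_top a x \<noteq> 3"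
    and m: "cartan x a = of_int m"
  shows "m \<in> {-2, -1, 0}" "(string_top a x - cartan x a) / 2 = (if m = -2 then 2 else 1)"
proof -
  obtain k :: int where k: "string_top a x = of_int (m + 2 * k)"
    using string_top_parity[OF a x(1)] m by (metis of_int_add of_int_mult of_int_numeral)
  have "of_int (m + 2 * k) \<le> (3::real)" using string_top_le_3[OF a x] k by metis
  then have "m + 2 * k \<le> 3" by linarith
  moreover have "m + 2 * k \<noteq> 3" using T k by auto
  moreover have "of_int m < (of_int (m + 2 * k)::real)" using string_up_iff[OF a x] up k m by metis
  then have "m < m + 2 * k" by linarith
  moreover have "- of_int m \<le> (of_int (m + 2 * k)::real)" using neg_cartan_le_string_top[OF a x(1)] k m by metis
  then have "- m \<le> m + 2 * k" by linarith
  ultimately have "k \<ge> 1" "m + 2 * k \<le> 2" "m + k \<ge> 0" by linarith+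
  then show "m \<in> {-2, -1, 0}" by auto
  then have "k = (if m = -2 then 2 else 1)"
    using \<open>k \<ge> 1\<close> \<open>m + 2 * k \<le> 2\<close> \<open>m + k \<ge> 0\<close> by auto
  then show "(string_top a x - cartan x a) / 2 = (if m = -2 then 2 else 1)" unfolding k m by simp
qed

lemma down_weight_value:
  assumes a: "a \<in> \<Phi>" and x: "x \<in> \<Phi>" "x \<noteq> a" "x \<noteq> - a" and dn: "x - a \<in> \<Phi>" and T: "string_top a x \<noteq> 3"
    and m: "cartan x a = of_int m"
  shows "m \<in> {0, 1, 2}" "(string_top a x + cartan x a) / 2 = (if m = 2 then 2 else 1)"
proof -
  obtain k :: int where k: "string_top a x = of_int (m + 2 * k)"
    using string_top_parity[OF a x(1)] m by (metis of_int_add of_int_mult of_int_numeral)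
  have "of_int (m + 2 * k) \<le> (3::real)" using string_top_le_3[OF a x] k by metis
  then have "m + 2 * k \<le> 3" by linarith
  moreover have "m + 2 * k \<noteq> 3" using T k by auto
  moreover have "- of_int m < (of_int (m + 2 * k)::real)" using string_down_iff[OF a x] dn k m by metis
  then have "- m < m + 2 * k" by linarith
  moreover have "of_int m \<le> (of_int (m + 2 * k)::real)" using cartan_le_string_top[OF x(1), of a] k m by metis
  then have "m \<le> m + 2 * k" by linarith
  ultimately have "k \<ge> 0" "m + 2 * k \<le> 2" "m + k \<ge> 1" by linarith+
  then show "m \<in> {0, 1, 2}" by auto
  then have "m + k = (if m = 2 then 2 else 1)"
    using \<open>k \<ge> 0\<close> \<open>m + 2 * k \<le> 2\<close> \<open>m + k \<ge> 1\<close> by auto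
  moreover have "(string_top a x + cartan x a) / 2 = of_int (m + k)" unfolding k m by simp
  ultimately show "(string_top a x + cartan x a) / 2 = (if m = 2 then 2 else 1)" by simp
qed

text \<open>Without the fourth root, \<open>(d + a) \<bullet> b\<close> and
  \<open>(d + b) \<bullet> a\<close> are nonnegative while \<open>(d + a) \<bullet> (d + b)\<close>
  and \<open>a \<bullet> b\<close> are at most 0; together this gives
  \<open>d \<bullet> d \<le> a \<bullet> b \<le> 0\<close>.\<close>

lemma diamond:
  assumes R: "a \<in> \<Phi>" "b \<in> \<Phi>" "d \<in> \<Phi>" "d + a \<in> \<Phi>" "d + b \<in> \<Phi>"
    and ab: "a \<noteq> b" "a - b \<notin> \<Phi>" and nz: "d + a + b \<noteq> 0"
  shows "d + a + b \<in> \<Phi>"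
proof (rule ccontr)
  assume s: "\<not> ?thesis"
  have "d + a \<noteq> - b" "d + b \<noteq> - a" using nz by (auto simp: eq_neg_iff_add_eq_0 add_ac)
  then have xb: "(d + a) \<bullet> b \<ge> 0" and ya: "(d + b) \<bullet> a \<ge> 0"
    using root_add[OF R(4,2)] root_add[OF R(5,1)] s by (force simp: add_ac)+
  have xy: "(d + a) \<bullet> (d + b) \<le> 0"
    using root_diff[OF R(4,5)] ab by force
  have ab': "a \<bullet> b \<le> 0" using root_diff[OF R(1,2)] ab by force
  have "d \<bullet> d \<le> 0"
    using xb ya xy ab' by (simp add: inner_add_left inner_add_right inner_commute)
  then show False using root_sq_pos[OF R(3)] by simp
qed

end


section \<open>Excluding strings of length four\<close>

text \<open>\<open>U, V\<close> and \<open>i, j\<close> are the Cartan integers, in both orders, of a root \<open>b\<close> with a short root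
  \<open>a\<close> and a long root \<open>\<phi>\<close> of \<open>G\<^sub>2\<close>; the inequalities say that each of the six positive roots
  of \<open>G\<^sub>2\<close> has Cartan product less than 4 with \<open>b\<close>.\<close>

lemma g2_pairing_zero:
  fixes U V i j :: int
  assumes sgn: "U > 0 \<longleftrightarrow> i > 0" "U < 0 \<longleftrightarrow> i < 0" "V > 0 \<longleftrightarrow> j > 0" "V < 0 \<longleftrightarrow> j < 0"
    and tie: "3 * V * i = U * j"
    and lt: "U * i < 4" "V * j < 4" "(U + 3 * V) * (i + j) < 4" "(2 * U + 3 * V) * (2 * i + j) < 4"
      "(U + V) * (3 * i + j) < 4" "(U + 2 * V) * (3 * i + 2 * j) < 4"
  shows "U = 0 \<and> V = 0"
proof -
  \<comment> \<open>The tie relation makes all six inequalities linear in \<open>t\<close>,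
    \<open>w\<close>, \<open>x\<close>; the only quadratic relation left is
    \<open>t * w = 3 * (x * x)\<close>.\<close>
  define t w x where "t = U * i" and "w = V * j" and "x = V * i"
  have Uj: "U * j = 3 * x" using tie by (simp add: x_def)
  have tw: "t * w = 3 * (x * x)"
  proof -
    have "t * w = (U * j) * x" by (simp add: t_def w_def x_def mult_ac)
    then show ?thesis unfolding Uj by simp
  qed
  have b: "t < 4" "w < 4" "t + 6 * x + 3 * w < 4" "4 * t + 12 * x + 3 * w < 4"
    "3 * t + 6 * x + w < 4" "3 * t + 12 * x + 4 * w < 4"
    using lt Uj by (simp_all add: t_def w_def x_def algebra_simps)
  have nn: "t \<ge> 0" "w \<ge> 0" and z: "t = 0 \<Longrightarrow> U = 0" "w = 0 \<Longrightarrow> V = 0"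
    using sgn unfolding t_def w_def by (auto simp: zero_le_mult_iff)
  have zz: "t = 0 \<longleftrightarrow> w = 0"
  proof
    assume "t = 0"
    then have "x = 0" using tw by simp
    then show "w = 0" using b(6) nn \<open>t = 0\<close> by linarith
  next
    assume "w = 0"
    then have "x = 0" using tw by simp
    then show "t = 0" using b(4) nn \<open>w = 0\<close> by linarith
  qed
  have "t = 0"
  proof (rule ccontr)
    assume "t \<noteq> 0"
    then have tw1: "t \<in> {1, 2, 3}" "w \<in> {1, 2, 3}" using zz nn b by auto
    then have "t * w \<le> 9" by auto
    then have "x * x \<le> 3" using tw by simp
    moreover have "2 * 2 \<le> \<bar>x\<bar> * \<bar>x\<bar>" if "\<bar>x\<bar> \<ge> 2" using that by (intro mult_mono) auto
    ultimately have "\<bar>x\<bar> < 2" by force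
    \<comment> \<open>The value 0 contradicts \<open>t * w > 0\<close>. Otherwise
      \<open>t * w = 3\<close>, and for either order of 1 and 3 one of the linear bounds
      fails.\<close>
    then have "x = -1 \<or> x = 0 \<or> x = 1" by linarith
    then show False using tw1 tw b by auto
  qed
  then show ?thesis using zz z by simp
qed

context based_root_system
begin

text \<open>A Cartan integer -3 generates a G2 with short root \<open>a\<close> and long root
  \<open>\<phi>\<close>. Pairing \<open>b\<close> with all six positive roots of this G2 leaves no
  room for a nonzero Cartan integer unless \<open>b\<close> lies in its plane, so the G2 splits off
  as a component.\<close>

lemma g2_root_cases:
  assumes R: "a \<in> \<Phi>" "\<phi> \<in> \<Phi>" "b \<in> \<Phi>" and c3: "cartan \<phi> a = -3"
  shows "b \<in> span {a, \<phi>} \<or> b \<bullet> a = 0 \<and> b \<bullet> \<phi> = 0"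
    and "cartan a \<phi> = -1" and "\<phi> + a \<in> \<Phi>" and "\<phi> + 2 *\<^sub>R a \<in> \<Phi>"
proof -
  define n where "n = a \<bullet> a"
  have n: "n > 0" using root_sq_pos[OF R(1)] by (simp add: n_def)
  have pa: "\<phi> \<bullet> a = - 3 / 2 * n" using c3 n by (simp add: n_def field_simps)
  have "\<phi> = a \<Longrightarrow> \<phi> \<bullet> a = n" "\<phi> = - a \<Longrightarrow> \<phi> \<bullet> a = - n" by (simp_all add: n_def)
  then have ne: "\<phi> \<noteq> a" "\<phi> \<noteq> - a" using pa n by auto
  obtain m where m: "cartan a \<phi> = of_int m" using cartan_int[OF R(2,1)] by (rule Ints_cases)
  have "cartan \<phi> a * cartan a \<phi> < 4" by (rule cartan_prod_lt_4[OF R(2,1) ne])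
  then have "of_int (- 3 * m) < (4::real)" unfolding c3 m by simp
  then have m1: "- 3 * m < 4" by linarith
  have pp: "\<phi> \<bullet> \<phi> > 0" using root_sq_pos[OF R(2)] .
  have mm: "of_int m = - 3 * n / (\<phi> \<bullet> \<phi>)" using m pa by (simp add: inner_commute)
  also have "\<dots> < 0" using n pp by (simp add: divide_simps)
  finally have "m < 0" by simp
  then have "m = -1" using m1 by linarith
  then show ca: "cartan a \<phi> = -1" using m by simp
  have pp3: "\<phi> \<bullet> \<phi> = 3 * n" using mm \<open>m = -1\<close> pp by (simp add: field_simps)
  have "\<phi> \<bullet> a < 0" using pa n by simp
  then show r2: "\<phi> + a \<in> \<Phi>" by (rule root_add[OF R(2,1) ne(2)])
  have "cartan (\<phi> + a) a = -1" using cartan_shift[OF R(1), of \<phi> 1] unfolding c3 by simp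
  then have "\<phi> + a - (-1) *\<^sub>R a \<in> \<Phi>" using reflect[OF R(1) r2] by metis
  then show r3: "\<phi> + 2 *\<^sub>R a \<in> \<Phi>" by (simp add: scaleR_2 add.assoc)
  have "\<phi> - (-3) *\<^sub>R a \<in> \<Phi>" using reflect[OF R(1,2)] unfolding c3 .
  then have r4: "\<phi> + 3 *\<^sub>R a \<in> \<Phi>" by simp
  have "cartan (\<phi> + 3 *\<^sub>R a) \<phi> = -1"
    using pp3 pa n by (simp add: inner_add_left inner_commute[of a \<phi>] field_simps)
  then have "\<phi> + 3 *\<^sub>R a - (-1) *\<^sub>R \<phi> \<in> \<Phi>" using reflect[OF R(2) r4] by metis
  then have r5: "2 *\<^sub>R \<phi> + 3 *\<^sub>R a \<in> \<Phi>" by (simp add: scaleR_2 add_ac)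
  show "b \<in> span {a, \<phi>} \<or> b \<bullet> a = 0 \<and> b \<bullet> \<phi> = 0"
  proof (cases "b \<in> span {a, \<phi>}")
    case out: False
    have nR: "b \<noteq> x *\<^sub>R \<phi> + y *\<^sub>R a" "b \<noteq> - (x *\<^sub>R \<phi> + y *\<^sub>R a)" for x y
    proof -
      have "x *\<^sub>R \<phi> + y *\<^sub>R a \<in> span {a, \<phi>}" by (intro span_add span_scale span_base) auto
      then show "b \<noteq> x *\<^sub>R \<phi> + y *\<^sub>R a" "b \<noteq> - (x *\<^sub>R \<phi> + y *\<^sub>R a)"
        using out span_neg by blast+
    qed
    define l where "l = b \<bullet> b"
    have l: "l > 0" using root_sq_pos[OF R(3)] by (simp add: l_def)
    obtain U V i j where UV: "cartan b a = of_int U" "cartan b \<phi> = of_int V" "cartan a b = of_int i" "cartan \<phi> b = of_int j"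
      using cartan_int R by (metis Ints_cases)
    have e: "2 * (b \<bullet> a) = of_int U * n" "2 * (b \<bullet> \<phi>) = of_int V * (3 * n)"
      "2 * (b \<bullet> a) = of_int i * l" "2 * (b \<bullet> \<phi>) = of_int j * l"
    proof -
      have "2 * (b \<bullet> a) = cartan b a * n" using n by (simp add: n_def)
      then show "2 * (b \<bullet> a) = of_int U * n" unfolding UV .
      have "2 * (b \<bullet> \<phi>) = cartan b \<phi> * (3 * n)" unfolding pp3 using n by simp
      then show "2 * (b \<bullet> \<phi>) = of_int V * (3 * n)" unfolding UV .
      have "2 * (a \<bullet> b) = cartan a b * l" using l by (simp add: l_def)
      then show "2 * (b \<bullet> a) = of_int i * l" unfolding UV unfolding inner_commute[of a b] .
      have "2 * (\<phi> \<bullet> b) = cartan \<phi> b * l" using l by (simp add: l_def)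
      then show "2 * (b \<bullet> \<phi>) = of_int j * l" unfolding UV unfolding inner_commute[of \<phi> b] .
    qed
    \<comment> \<open>\<open>c\<close> is the squared length relative to that of \<open>a\<close>, 1
      for short and 3 for long roots; \<open>w\<close> and \<open>k\<close> are the Cartan integers
      of \<open>b\<close> with the tested root, in the two orders.\<close>
    have prod: "w * k < 4" if r: "x *\<^sub>R \<phi> + y *\<^sub>R a \<in> \<Phi>"
      and nrm: "(x *\<^sub>R \<phi> + y *\<^sub>R a) \<bullet> (x *\<^sub>R \<phi> + y *\<^sub>R a) = c * n" and c: "c > 0"
      and w: "x * (3 * of_int V) + y * of_int U = c * of_int w" and k: "of_int k = x * of_int j + y * of_int i"
      for x y c :: real and w k :: int
    proof -
      let ?r = "x *\<^sub>R \<phi> + y *\<^sub>R a"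
      have br: "2 * (b \<bullet> ?r) = x * (2 * (b \<bullet> \<phi>)) + y * (2 * (b \<bullet> a))"
        by (simp add: inner_add_right algebra_simps)
      have "2 * (b \<bullet> ?r) = (x * (3 * of_int V) + y * of_int U) * n"
        unfolding br unfolding e(1,2) by (simp add: algebra_simps)
      then have 1: "cartan b ?r = of_int w" unfolding nrm w using n c by simp
      have "2 * (?r \<bullet> b) = (x * of_int j + y * of_int i) * l"
        unfolding inner_commute[of ?r b] br unfolding e(3,4) by (simp add: algebra_simps)
      then have 2: "cartan ?r b = of_int k" unfolding k l_def[symmetric] using l by simp
      have "of_int (w * k) < (4::real)"
        using cartan_prod_lt_4[OF R(3) r nR] unfolding 1 2 by simp
      then show ?thesis by linarith
    qed
    have nsq: "(x *\<^sub>R \<phi> + y *\<^sub>R a) \<bullet> (x *\<^sub>R \<phi> + y *\<^sub>R a) = (3 * x * x - 3 * x * y + y * y) * n" for x y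
      using pp3 pa by (simp add: inner_add_left inner_add_right inner_commute[of a \<phi>] n_def[symmetric] algebra_simps)
    have "U * i < 4" by (rule prod[of 0 1 1]) (use R nsq[of 0 1] in auto)
    moreover have "V * j < 4" by (rule prod[of 1 0 3]) (use R nsq[of 1 0] in auto)
    moreover have "(U + 3 * V) * (i + j) < 4" by (rule prod[of 1 1 1]) (use r2 nsq[of 1 1] in auto)
    moreover have "(2 * U + 3 * V) * (2 * i + j) < 4" by (rule prod[of 1 2 1]) (use r3 nsq[of 1 2] in auto)
    moreover have "(U + V) * (3 * i + j) < 4" by (rule prod[of 1 3 3]) (use r4 nsq[of 1 3] in auto)
    moreover have "(U + 2 * V) * (3 * i + 2 * j) < 4" by (rule prod[of 2 3 3]) (use r5 nsq[of 2 3] in auto)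
    moreover have "of_int (3 * V * i) = (of_int (U * j) :: real)"
    proof -
      have "of_int (3 * V * i) * (n * l) = (2 * (b \<bullet> \<phi>)) * (2 * (b \<bullet> a))"
        unfolding e(2,3) by simp
      also have "\<dots> = of_int (U * j) * (n * l)" unfolding e(1,4) by simp
      finally show ?thesis using n l by simp
    qed
    then have "3 * V * i = U * j" by linarith
    moreover have sg: "W > 0 \<longleftrightarrow> k > 0" "W < 0 \<longleftrightarrow> k < 0" if "of_int W * c = of_int k * d" "c > 0" "d > 0"
      for W k :: int and c d :: real
    proof -
      have "of_int W * c > 0 \<longleftrightarrow> of_int k * d > 0" "of_int W * c < 0 \<longleftrightarrow> of_int k * d < 0" using that by simp_all
      then show "W > 0 \<longleftrightarrow> k > 0" "W < 0 \<longleftrightarrow> k < 0" using that(2,3)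
        by (simp_all add: zero_less_mult_iff mult_less_0_iff)
    qed
    have "of_int U * n = of_int i * l" "of_int V * (3 * n) = of_int j * l" using e by simp_all
    from sg[OF this(1) n l] sg[OF this(2) _ l]
    have "U > 0 \<longleftrightarrow> i > 0" "U < 0 \<longleftrightarrow> i < 0" "V > 0 \<longleftrightarrow> j > 0" "V < 0 \<longleftrightarrow> j < 0" using n by auto
    ultimately have "U = 0 \<and> V = 0" by (intro g2_pairing_zero[of U i V j])
    then have "2 * (b \<bullet> a) = 0" "2 * (b \<bullet> \<phi>) = 0" using e(1,2) by simp_all
    then show ?thesis by simp
  qed simp
qed

text \<open>Such a root would lie neither in the plane of the G2 nor orthogonal to it.\<close>

lemma g2_perp:
  assumes R: "a \<in> \<Phi>" "\<phi> \<in> \<Phi>" "b \<in> \<Phi>" and c3: "cartan \<phi> a = -3" and perp: "b \<bullet> a = 0" "b \<bullet> \<phi> = 0"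
    and v: "v \<in> span {a, \<phi>}" "v \<noteq> 0" and e: "e \<noteq> 0" and z: "v + e *\<^sub>R b \<in> \<Phi>"
  shows False
proof -
  have orth: "u \<bullet> w = 0" if "u \<bullet> a = 0" "u \<bullet> \<phi> = 0" "w \<in> span {a, \<phi>}" for u w
    using orthogonal_to_span[of w "{a, \<phi>}" u] that by (auto simp: orthogonal_def)
  show False using g2_root_cases(1)[OF R(1,2) z c3]
  proof
    assume "v + e *\<^sub>R b \<in> span {a, \<phi>}"
    then have "(1 / e) *\<^sub>R ((v + e *\<^sub>R b) - v) \<in> span {a, \<phi>}" using v by (intro span_scale span_diff)
    then have "b \<in> span {a, \<phi>}" using e by simp
    then show False using orth[OF perp] root_sq_pos[OF R(3)] by simp
  next
    assume "(v + e *\<^sub>R b) \<bullet> a = 0 \<and> (v + e *\<^sub>R b) \<bullet> \<phi> = 0"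
    then have "v \<bullet> a = 0" "v \<bullet> \<phi> = 0" using perp by (simp_all add: inner_add_left)
    then show False using orth[OF _ _ v(1), of v] v by simp
  qed
qed

text \<open>The Cartan matrix of G2 has determinant 1, so \<open>b\<close> has integral coordinates
  in \<open>a\<close> and \<open>\<phi>\<close>. Comparing coefficients at \<open>b\<close> makes
  the second one 1; the first is squeezed to 0 by positivity of \<open>\<phi>\<close> and the bound
  on \<open>cartan b a\<close>.\<close>

lemma g2_simple_eq:
  assumes ab: "a \<in> \<Delta>" "b \<in> \<Delta>" "a \<noteq> b" and \<phi>: "\<phi> \<in> \<Phi>" and c3: "cartan \<phi> a = -3"
    and sp: "b \<in> span {a, \<phi>}" and nn: "cf b \<phi> \<ge> 0"
  shows "b = \<phi>"
proof -
  note R = simple_sub[THEN subsetD, OF ab(1)] simple_sub[THEN subsetD, OF ab(2)]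
  obtain \<alpha> \<beta> where b: "b = \<alpha> *\<^sub>R a + \<beta> *\<^sub>R \<phi>"
  proof -
    obtain \<alpha> where "b - \<alpha> *\<^sub>R a \<in> span {\<phi>}" using sp by (auto simp: span_breakdown_eq)
    then obtain \<beta> where "b - \<alpha> *\<^sub>R a = \<beta> *\<^sub>R \<phi>" by (auto simp: span_singleton)
    then show thesis using that[of \<alpha> \<beta>] by (simp add: algebra_simps)
  qed
  obtain U V where UV: "cartan b a = of_int U" "cartan b \<phi> = of_int V"
    using cartan_int R \<phi> by (metis Ints_cases)
  have c1: "cartan a \<phi> = -1" using g2_root_cases(2)[OF R(1) \<phi> R(2) c3] .
  have "cartan b a = 2 * \<alpha> + \<beta> * cartan \<phi> a"
    unfolding b using root_sq_pos[OF R(1)] by (simp add: inner_add_left field_simps)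
  then have u: "of_int U = 2 * \<alpha> - 3 * \<beta>" unfolding UV c3 by simp
  have "cartan b \<phi> = \<alpha> * cartan a \<phi> + 2 * \<beta>"
    unfolding b using root_sq_pos[OF \<phi>] by (simp add: inner_add_left field_simps)
  then have v: "of_int V = 2 * \<beta> - \<alpha>" unfolding UV c1 by simp
  have \<beta>: "\<beta> = of_int (U + 2 * V)" and \<alpha>: "\<alpha> = of_int (2 * U + 3 * V)" using u v by simp_all
  have one: "1 = \<beta> * cf b \<phi>"
    using arg_cong[OF b, of "cf b"] ab by (simp add: cf_add cf_scale cf_simple)
  then have "cf b \<phi> \<noteq> 0" by auto
  then have \<phi>P: "\<phi> \<in> P" using P_of_cf_pos[OF \<phi>, of b] nn by simp
  obtain k where k: "cf b \<phi> = real k" using P_cf_nat[OF \<phi>P] by (rule Nats_cases)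
  have "of_int ((U + 2 * V) * int k) = (1::real)" using one unfolding \<beta> k by simp
  then have "(U + 2 * V) * int k = 1" by linarith
  then have "U + 2 * V = 1" unfolding zmult_eq_1_iff by linarith
  then have \<beta>1: "\<beta> = 1" using \<beta> by simp
  have "0 = \<alpha> + cf a \<phi>"
    using arg_cong[OF b, of "cf a"] ab \<beta>1 by (simp add: cf_add cf_scale cf_simple)
  then have "\<alpha> \<le> 0" using P_cf_nonneg[OF \<phi>P, of a] by linarith
  moreover have "b \<noteq> - a" using P_not_neg simple_P ab by metis
  then have "\<bar>cartan b a\<bar> \<le> 3" using abs_cartan_le_3[OF R(2,1)] ab by metis
  then have "of_int U \<ge> (-3::real)" unfolding UV by linarith
  then have "\<alpha> \<ge> 0" using u \<beta>1 by linarith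
  ultimately show ?thesis using b \<beta>1 by simp
qed

lemma string_bottom_g2:
  assumes a: "a \<in> \<Phi>" and x: "x \<in> \<Phi>" and T: "string_top a x = 3"
  obtains l :: int where "x + of_int l *\<^sub>R a \<in> \<Phi>" "cartan (x + of_int l *\<^sub>R a) a = -3"
proof -
  obtain k where k: "x + of_int k *\<^sub>R a \<in> \<Phi>" "string_top a x = cartan (x + of_int k *\<^sub>R a) a"
    using string_top_attained[OF x] .
  have c: "cartan (x + of_int k *\<^sub>R a) a = 3" using k(2) T by (simp only:)
  have "x + of_int k *\<^sub>R a - 3 *\<^sub>R a \<in> \<Phi>" using reflect[OF a k(1)] unfolding c .
  moreover have e: "x + of_int k *\<^sub>R a - 3 *\<^sub>R a = x + of_int (k - 3) *\<^sub>R a" by (simp add: algebra_simps)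
  moreover have "cartan (x + of_int (k - 3) *\<^sub>R a) a = -3"
  proof -
    have "C + 2 * (K - 3) = -3" if "C + 2 * K = 3" for C K :: real using that by simp
    from this[OF c[unfolded cartan_shift[OF a]]]
    show ?thesis unfolding cartan_shift[OF a] by (simp only: of_int_diff of_int_numeral)
  qed
  ultimately show ?thesis using that by metis
qed

lemma P_cf_bound: "z \<in> \<Phi> \<Longrightarrow> a \<in> \<Delta> \<Longrightarrow> b \<noteq> a \<Longrightarrow> cf b z \<noteq> 0 \<Longrightarrow> \<bar>cartan z a\<bar> \<le> 3"
  using simple_sub by (intro abs_cartan_le_3) (auto simp: cf_neg cf_simple)

text \<open>The bottom root of a string of four spans a G2 with \<open>a\<close>. As
  \<open>d + b\<close> is a root, \<open>b\<close> lies in that plane and equals the bottom root.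
  Then \<open>d + b\<close> and \<open>d + b + a\<close> both have coefficient 2 at
  \<open>b\<close>, whereas G2 has only one such root.\<close>

lemma diamond_no_g2_bottom:
  assumes ab: "a \<in> \<Delta>" "b \<in> \<Delta>" "a \<noteq> b" and d: "d \<in> P" "d + b \<in> \<Phi>" "d + b + a \<in> \<Phi>"
  shows "string_top a d \<noteq> 3"
proof
  assume T: "string_top a d = 3"
  note R = simple_sub[THEN subsetD, OF ab(1)] simple_sub[THEN subsetD, OF ab(2)]
  obtain l :: int where l: "d + of_int l *\<^sub>R a \<in> \<Phi>" "cartan (d + of_int l *\<^sub>R a) a = -3"
    using string_bottom_g2[OF R(1) P_root[OF d(1)] T] .
  define \<phi> where "\<phi> = d + of_int l *\<^sub>R a"
  have \<phi>: "\<phi> \<in> \<Phi>" and c3: "cartan \<phi> a = -3" using l unfolding \<phi>_def .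
  have dv: "d = \<phi> - of_int l *\<^sub>R a" by (simp add: \<phi>_def)
  have "d \<in> span {a, \<phi>}" unfolding dv by (intro span_diff span_scale span_base) auto
  moreover have "d \<noteq> 0" using root_nz[OF P_root[OF d(1)]] .
  ultimately have "\<not> (b \<bullet> a = 0 \<and> b \<bullet> \<phi> = 0)"
    using g2_perp[OF R(1) \<phi> R(2) c3, of d 1] d by auto
  then have "b \<in> span {a, \<phi>}" using g2_root_cases(1)[OF R(1) \<phi> R(2) c3] by blast
  moreover have "cf b \<phi> \<ge> 0" using P_cf_nonneg[OF d(1), of b] ab by (simp add: \<phi>_def cf_add cf_scale cf_simple)
  ultimately have b\<phi>: "b = \<phi>" by (rule g2_simple_eq[OF ab \<phi> c3])
  have y: "d + b = 2 *\<^sub>R b + (- of_int l) *\<^sub>R a" using dv b\<phi> by (simp add: scaleR_2)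
  have s: "d + b + a = 2 *\<^sub>R b + (1 - of_int l) *\<^sub>R a" unfolding y by (simp add: algebra_simps)
  have c2: "cartan (2 *\<^sub>R b + c *\<^sub>R a) a = -6 + 2 * c" for c
  proof -
    have "cartan (2 *\<^sub>R b) a = 2 * cartan b a" by simp
    then show ?thesis unfolding cartan_shift[OF R(1)] using c3 b\<phi> by (simp only:) 
  qed
  have cfb: "cf b (2 *\<^sub>R b + c *\<^sub>R a) \<noteq> 0" for c using ab by (simp add: cf_add cf_scale cf_simple)
  have "\<bar>-6 + 2 * (- real_of_int l)\<bar> \<le> 3" "\<bar>-6 + 2 * (1 - real_of_int l)\<bar> \<le> 3"
    using P_cf_bound[OF d(2) ab(1), of b] P_cf_bound[OF d(3) ab(1), of b] cfb ab(3)
    unfolding s unfolding y c2 by blast+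
  then have "real_of_int (2 * l) \<le> of_int (- 3)" "of_int (- 7) \<le> real_of_int (2 * l)" by simp_all
  then have "2 * l \<le> - 3" "- 7 \<le> 2 * l" unfolding of_int_le_iff .
  \<comment> \<open>The Cartan bounds leave two values; in either case one of the two roots is twice
    another root.\<close>
  then consider "l = -2" | "l = -3" by linarith
  then show False
  proof cases
    case 1
    then have "d + b = 2 *\<^sub>R (\<phi> + a)" using y b\<phi> by (simp add: scaleR_add_right)
    then show False using root_scale[OF g2_root_cases(3)[OF R(1) \<phi> R(2) c3], of 2] d(2) by simp
  next
    case 2
    then have "d + b + a = 2 *\<^sub>R (\<phi> + 2 *\<^sub>R a)" using s b\<phi> by (simp add: scaleR_add_right)
    then show False using root_scale[OF g2_root_cases(4)[OF R(1) \<phi> R(2) c3], of 2] d(3) by simp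
  qed
qed

text \<open>Again \<open>b\<close> is the bottom root, now of the string through
  \<open>d + b\<close>. Hence \<open>d\<close> is a multiple of \<open>a\<close>, and
  \<open>d + a\<close> would be twice \<open>a\<close> or 0.\<close>

lemma diamond_no_g2_top:
  assumes ab: "a \<in> \<Delta>" "b \<in> \<Delta>" "a \<noteq> b" and d: "d \<in> P" "d + a \<in> \<Phi>" "d + b \<in> \<Phi>"
  shows "string_top a (d + b) \<noteq> 3"
proof
  assume T: "string_top a (d + b) = 3"
  note R = simple_sub[THEN subsetD, OF ab(1)] simple_sub[THEN subsetD, OF ab(2)]
  obtain l :: int where l: "d + b + of_int l *\<^sub>R a \<in> \<Phi>" "cartan (d + b + of_int l *\<^sub>R a) a = -3"
    using string_bottom_g2[OF R(1) d(3) T] .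
  define \<phi> where "\<phi> = d + b + of_int l *\<^sub>R a"
  have \<phi>: "\<phi> \<in> \<Phi>" and c3: "cartan \<phi> a = -3" using l unfolding \<phi>_def .
  have dv: "d + b = \<phi> - of_int l *\<^sub>R a" by (simp add: \<phi>_def)
  have "d + b \<in> span {a, \<phi>}" unfolding dv by (intro span_diff span_scale span_base) auto
  moreover have "d + b \<noteq> 0" using root_nz[OF d(3)] .
  ultimately have "\<not> (b \<bullet> a = 0 \<and> b \<bullet> \<phi> = 0)"
    using g2_perp[OF R(1) \<phi> R(2) c3, of "d + b" "-1"] P_root[OF d(1)] by auto
  then have "b \<in> span {a, \<phi>}" using g2_root_cases(1)[OF R(1) \<phi> R(2) c3] by blast
  moreover have "cf b \<phi> \<ge> 0" using P_cf_nonneg[OF d(1), of b] ab by (simp add: \<phi>_def cf_add cf_scale cf_simple)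
  ultimately have "b = \<phi>" by (rule g2_simple_eq[OF ab \<phi> c3])
  then have e: "d = (- of_int l) *\<^sub>R a" using dv by simp
  then have "- real_of_int l = 1 \<or> - real_of_int l = -1" using root_scale[OF R(1)] P_root[OF d(1)] by metis
  then have "d = a \<or> d = - a" using e by auto
  then have "d + a = 2 *\<^sub>R a \<or> d + a = 0" by (auto simp: scaleR_2)
  then show False using root_scale[OF R(1), of 2] d(2) zero_not_root by auto
qed

end


context based_root_system
begin

section \<open>The height distribution of a lower set\<close>

lemma simple_cartan_sign:
  assumes ab: "a \<in> \<Delta>" "b \<in> \<Delta>" "a \<noteq> b" and m: "cartan b a = of_int c" and m': "cartan a b = of_int c'"
  shows "c \<le> 0" "c' \<le> 0" "c = 0 \<longleftrightarrow> c' = 0" "c * c' < 4"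
    and "2 * (a \<bullet> b) = of_int c * (a \<bullet> a)" "2 * (a \<bullet> b) = of_int c' * (b \<bullet> b)"
proof -
  note R = simple_sub[THEN subsetD, OF ab(1)] simple_sub[THEN subsetD, OF ab(2)]
  note sq = root_sq_pos[OF R(1)] root_sq_pos[OF R(2)]
  have "2 * (b \<bullet> a) = cartan b a * (a \<bullet> a)" using sq by simp
  then show 1: "2 * (a \<bullet> b) = of_int c * (a \<bullet> a)" unfolding m by (simp add: inner_commute)
  have "2 * (a \<bullet> b) = cartan a b * (b \<bullet> b)" using sq by simp
  then show 2: "2 * (a \<bullet> b) = of_int c' * (b \<bullet> b)" unfolding m' .
  have "of_int c * (a \<bullet> a) \<le> 0" "of_int c' * (b \<bullet> b) \<le> 0"
    using simple_inner_nonpos[OF ab] 1 2 by linarith+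
  then show "c \<le> 0" "c' \<le> 0" using sq by (simp_all add: mult_le_0_iff)
  have "of_int c * (a \<bullet> a) = 0 \<longleftrightarrow> of_int c' * (b \<bullet> b) = 0" using 1 2 by linarith
  then show "c = 0 \<longleftrightarrow> c' = 0" using sq by simp
  have "a \<noteq> - b" using P_not_neg simple_P ab by metis
  then have "of_int (c' * c) < (4::real)" using cartan_prod_lt_4[OF R ab(3)] unfolding m m' by simp
  then have "c' * c < 4" by linarith
  then show "c * c' < 4" by (simp add: mult.commute)
qed

text \<open>By Pythagoras \<open>cartan a (d + a)\<close> is 2|a|^2 / (|a|^2 + |d|^2), an integer
  strictly between 0 and 2.\<close>

lemma orthogonal_add_root:
  assumes R: "a \<in> \<Phi>" "d \<in> \<Phi>" "d + a \<in> \<Phi>" and o: "d \<bullet> a = 0"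
  shows "d \<bullet> d = a \<bullet> a"
proof -
  note sq = root_sq_pos[OF R(1)] root_sq_pos[OF R(2)]
  have n: "(d + a) \<bullet> (d + a) = d \<bullet> d + a \<bullet> a" using o by (simp add: inner_add_left inner_add_right inner_commute)
  obtain m where m: "cartan a (d + a) = of_int m" using cartan_int[OF R(3,1)] by (rule Ints_cases)
  have e: "2 * (a \<bullet> a) = of_int m * (d \<bullet> d + a \<bullet> a)"
  proof -
    have "2 * (a \<bullet> (d + a)) = cartan a (d + a) * ((d + a) \<bullet> (d + a))" using root_sq_pos[OF R(3)] by simp
    then have "2 * (a \<bullet> (d + a)) = of_int m * (d \<bullet> d + a \<bullet> a)" unfolding m unfolding n .
    moreover have "a \<bullet> (d + a) = a \<bullet> a" using o by (simp add: inner_add_right inner_commute)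
    ultimately show ?thesis by simp
  qed
  have "of_int m * (d \<bullet> d + a \<bullet> a) > 0" using e sq by linarith
  then have "m > 0" using sq by (simp add: zero_less_mult_iff)
  moreover have "m < 2"
  proof (rule ccontr)
    assume "\<not> m < 2"
    then have "2 \<le> (of_int m::real)" by linarith
    then have "2 * (d \<bullet> d + a \<bullet> a) \<le> of_int m * (d \<bullet> d + a \<bullet> a)" using sq by (intro mult_right_mono) auto
    then have "2 * (d \<bullet> d + a \<bullet> a) \<le> 2 * (a \<bullet> a)" unfolding e[symmetric] .
    moreover have "\<not> 2 * (D + A) \<le> 2 * A" if "0 < D" for D A :: real using that by (simp add: distrib_left)
    ultimately show False using sq(2) by blast
  qed
  ultimately have "m = 1" by linarith
  then show ?thesis using e by simp
qed

text \<open>On these patterns the two sides of the weight identity would disagree. They fail, in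
  this order, because \<open>cartan b (d + a)\<close> would be -1/2, \<open>cartan a d\<close> would
  lie strictly between -1 and 0, \<open>d + a + b\<close> would have length 0, and \<open>a\<close>
  and \<open>b\<close> would be both equally long and of different lengths.\<close>

lemma diamond_excluded:
  assumes ab: "a \<in> \<Delta>" "b \<in> \<Delta>" "a \<noteq> b"
    and d: "d \<in> \<Phi>" "d + a \<in> \<Phi>" "d + b \<in> \<Phi>" "d + a + b \<in> \<Phi>"
    and i: "cartan b a = of_int c" "cartan a b = of_int c'" "cartan d a = of_int A" "cartan d b = of_int B"
  shows "\<not> (c = -1 \<and> c' = -1 \<and> A = 0 \<and> B = 0)" "\<not> (c = -1 \<and> c' = -1 \<and> A = -1 \<and> B = -1)"
    "\<not> (c = -2 \<and> c' = -1 \<and> A = 0 \<and> B = -1)" "\<not> (c = -1 \<and> c' = -2 \<and> A = 0 \<and> B = 0)"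
proof -
  note R = simple_sub[THEN subsetD, OF ab(1)] simple_sub[THEN subsetD, OF ab(2)]
  note sq = root_sq_pos[OF R(1)] root_sq_pos[OF R(2)] root_sq_pos[OF d(1)]
  note cc = simple_cartan_sign(5,6)[OF ab i(1,2)]
  have "2 * (d \<bullet> a) = cartan d a * (a \<bullet> a)" "2 * (d \<bullet> b) = cartan d b * (b \<bullet> b)" using sq by simp_all
  then have dA: "2 * (d \<bullet> a) = of_int A * (a \<bullet> a)" and dB: "2 * (d \<bullet> b) = of_int B * (b \<bullet> b)"
    unfolding i by auto
  have s: "(d + a + b) \<bullet> (d + a + b) = d \<bullet> d + a \<bullet> a + b \<bullet> b + 2 * (d \<bullet> a) + 2 * (d \<bullet> b) + 2 * (a \<bullet> b)"
    by (simp add: inner_add_left inner_add_right inner_commute)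
  have spos: "(d + a + b) \<bullet> (d + a + b) > 0" using root_sq_pos[OF d(4)] .
  have A0: "d \<bullet> d = a \<bullet> a" if "A = 0" using orthogonal_add_root[OF R(1) d(1,2)] dA that by simp
  have B0: "d \<bullet> d = b \<bullet> b" if "B = 0" using orthogonal_add_root[OF R(2) d(1,3)] dB that by simp
  show "\<not> (c = -1 \<and> c' = -1 \<and> A = 0 \<and> B = 0)"
  proof
    assume *: "c = -1 \<and> c' = -1 \<and> A = 0 \<and> B = 0"
    then have n: "d \<bullet> d = a \<bullet> a" "b \<bullet> b = a \<bullet> a" "2 * (a \<bullet> b) = - (a \<bullet> a)" "d \<bullet> a = 0" "d \<bullet> b = 0"
    proof -
      show 1: "d \<bullet> d = a \<bullet> a" using A0 * by blast
      have "d \<bullet> d = b \<bullet> b" using B0 * by blast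
      then show "b \<bullet> b = a \<bullet> a" using 1 by linarith
      show "2 * (a \<bullet> b) = - (a \<bullet> a)" using cc(1) * by simp
      show "d \<bullet> a = 0" "d \<bullet> b = 0" using dA dB * by simp_all
    qed
    obtain m where m: "cartan b (d + a) = of_int m" using cartan_int[OF d(2) R(2)] by (rule Ints_cases)
    have "2 * (b \<bullet> (d + a)) = cartan b (d + a) * ((d + a) \<bullet> (d + a))" using root_sq_pos[OF d(2)] by simp
    then have "2 * (b \<bullet> (d + a)) = of_int m * ((d + a) \<bullet> (d + a))" unfolding m .
    then have "- (a \<bullet> a) = of_int m * (2 * (a \<bullet> a))"
      using n by (simp add: inner_add_left inner_add_right inner_commute)
    then have "(2 * of_int m + 1) * (a \<bullet> a) = 0" by (simp add: algebra_simps)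
    then have "of_int (2 * m + 1) = (0 :: real)" using sq(1) by simp
    then have "2 * m + 1 = 0" unfolding of_int_eq_0_iff .
    then show False by presburger
  qed
  show "\<not> (c = -1 \<and> c' = -1 \<and> A = -1 \<and> B = -1)"
  proof
    assume *: "c = -1 \<and> c' = -1 \<and> A = -1 \<and> B = -1"
    then have n: "b \<bullet> b = a \<bullet> a" "2 * (a \<bullet> b) = - (a \<bullet> a)" "2 * (d \<bullet> a) = - (a \<bullet> a)" "2 * (d \<bullet> b) = - (a \<bullet> a)"
    proof -
      show 1: "2 * (a \<bullet> b) = - (a \<bullet> a)" using cc(1) * by simp
      have "2 * (a \<bullet> b) = - (b \<bullet> b)" using cc(2) * by simp
      then show 2: "b \<bullet> b = a \<bullet> a" using 1 by linarith
      show "2 * (d \<bullet> a) = - (a \<bullet> a)" using dA * by simp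
      have "2 * (d \<bullet> b) = - (b \<bullet> b)" using dB * by simp
      then show "2 * (d \<bullet> b) = - (a \<bullet> a)" using 2 by linarith
    qed
    have lt: "d \<bullet> d > a \<bullet> a" using spos unfolding s n by simp
    obtain m where m: "cartan a d = of_int m" using cartan_int[OF d(1) R(1)] by (rule Ints_cases)
    have "2 * (a \<bullet> d) = cartan a d * (d \<bullet> d)" using sq by simp
    then have e: "- (a \<bullet> a) = of_int m * (d \<bullet> d)" unfolding m using n by (simp add: inner_commute)
    then have "of_int m * (d \<bullet> d) < 0" using sq by linarith
    then have "m < 0" using sq by (simp add: mult_less_0_iff)
    then have "of_int m \<le> (-1::real)" by linarith
    then have "of_int m * (d \<bullet> d) \<le> -1 * (d \<bullet> d)" using sq by (intro mult_right_mono) auto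
    then show False using e lt by simp
  qed
  show "\<not> (c = -2 \<and> c' = -1 \<and> A = 0 \<and> B = -1)"
  proof
    assume *: "c = -2 \<and> c' = -1 \<and> A = 0 \<and> B = -1"
    have "d \<bullet> d = a \<bullet> a" using A0 * by blast
    moreover have "2 * (a \<bullet> b) = - 2 * (a \<bullet> a)" using cc(1) * by simp
    moreover have "2 * (a \<bullet> b) = - (b \<bullet> b)" using cc(2) * by simp
    moreover have "2 * (d \<bullet> a) = 0" using dA * by simp
    moreover have "2 * (d \<bullet> b) = - (b \<bullet> b)" using dB * by simp
    ultimately show False using spos unfolding s by linarith
  qed
  show "\<not> (c = -1 \<and> c' = -2 \<and> A = 0 \<and> B = 0)"
  proof
    assume *: "c = -1 \<and> c' = -2 \<and> A = 0 \<and> B = 0"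
    then have "d \<bullet> d = a \<bullet> a" "d \<bullet> d = b \<bullet> b" using A0 B0 by blast+
    moreover have "2 * (a \<bullet> b) = - (a \<bullet> a)" using cc(1) * by simp
    moreover have "2 * (a \<bullet> b) = - 2 * (b \<bullet> b)" using cc(2) * by simp
    ultimately show False using sq by linarith
  qed
qed

text \<open>For \<open>c = 0\<close> the sides agree factor by factor. Otherwise the bounds make the
  first factor on the left and the last on the right equal to 1, and the excluded patterns are
  exactly those that violate the remaining equality.\<close>

lemma diamond_case_check:
  fixes A B c c' :: int
  assumes "A \<in> {-2, -1, 0}" "A + c \<in> {-2, -1, 0}" "B + 2 \<in> {0, 1, 2}" "B + c' + 2 \<in> {0, 1, 2}"
    and "c \<le> 0" "c' \<le> 0" "c = 0 \<longleftrightarrow> c' = 0" "c * c' < 4"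
    and "\<not> (c = -1 \<and> c' = -1 \<and> A = 0 \<and> B = 0)" "\<not> (c = -1 \<and> c' = -1 \<and> A = -1 \<and> B = -1)"
    "\<not> (c = -2 \<and> c' = -1 \<and> A = 0 \<and> B = -1)" "\<not> (c = -1 \<and> c' = -2 \<and> A = 0 \<and> B = 0)"
  shows "(if A = -2 then 2 else 1) * (if B + 2 = 2 then 2 else 1) =
    (if A + c = -2 then 2 else 1) * (if B + c' + 2 = 2 then 2 else (1::real))"
proof -
  have bd: "-2 \<le> A" "A \<le> 0" "-2 \<le> A + c" "-2 \<le> B" "B \<le> 0" "-2 \<le> B + c'" using assms(1-4) by auto
  show ?thesis
  proof (cases "c = 0")
    case True
    then show ?thesis using assms(7) by simp
  next
    case False
    then have neg: "c < 0" "c' < 0" using assms(5-7) by linarith+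
    then have "c = -1 \<or> c = -2" "c' = -1 \<or> c' = -2" using bd by linarith+
    moreover have "\<not> (c = -2 \<and> c' = -2)" using assms(8) by auto
    ultimately consider "c = -1" "c' = -1" | "c = -1" "c' = -2" | "c = -2" "c' = -1" by blast
    then have "B = 0 \<longleftrightarrow> A + c = -2"
    proof cases
      case 1
      then show ?thesis using bd assms(9,10) by presburger
    next
      case 2
      then show ?thesis using bd assms(12) by presburger
    next
      case 3
      then show ?thesis using bd assms(11) by presburger
    qed
    moreover have "A \<noteq> -2" "B + c' + 2 \<noteq> 2" using bd neg by linarith+
    ultimately show ?thesis by simp
  qed
qed

text \<open>With strings of four roots excluded, each weight is a function of one Cartan integer and
  the identity becomes a finite check. It expresses that raising by \<open>a\<close> commutes with
  lowering by \<open>b\<close>.\<close>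

lemma diamond_weights:
  assumes ab: "a \<in> \<Delta>" "b \<in> \<Delta>" "a \<noteq> b" and d: "d \<in> P" "d + a \<in> P" "d + b \<in> P" "d + a + b \<in> P"
  shows "(string_top a d - cartan d a) / 2 * ((string_top b (d + b) + cartan (d + b) b) / 2) =
    (string_top a (d + b) - cartan (d + b) a) / 2 * ((string_top b (d + a + b) + cartan (d + a + b) b) / 2)"
proof -
  note R = simple_sub[THEN subsetD, OF ab(1)] simple_sub[THEN subsetD, OF ab(2)]
  note dR = d[THEN P_root]
  have s': "d + b + a \<in> \<Phi>" using dR(4) by (simp add: add_ac)
  note aP = simple_P[OF ab(1)] and bP = simple_P[OF ab(2)]
  have no_a: "z \<noteq> a" "z \<noteq> - a" if "z \<in> P" "z + a \<in> \<Phi>" for z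
    using root_scale[OF R(1), of 2] that P_not_neg[OF that(1) aP] by (auto simp: scaleR_2)
  have no_b: "z \<noteq> b" "z \<noteq> - b" if "z \<in> P" "z - b \<in> \<Phi>" for z
    using that P_not_neg[OF that(1) bP] zero_not_root by auto
  obtain A where A: "cartan d a = of_int A" using cartan_int[OF R(1) dR(1)] by (rule Ints_cases)
  obtain B where B: "cartan d b = of_int B" using cartan_int[OF R(2) dR(1)] by (rule Ints_cases)
  obtain c where c: "cartan b a = of_int c" using cartan_int[OF R(1,2)] by (rule Ints_cases)
  obtain c' where c': "cartan a b = of_int c'" using cartan_int[OF R(2,1)] by (rule Ints_cases)
  note i = A B c c'
  have ia: "cartan (d + b) a = of_int (A + c)"
  proof -
    have "cartan (d + b) a = cartan d a + cartan b a"
      by (simp only: inner_add_left add_divide_distrib distrib_left)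
    then show ?thesis unfolding i of_int_add .
  qed
  have ib: "cartan (d + b) b = of_int (B + 2)"
    using cartan_shift[OF R(2), of d 1] unfolding i scaleR_one of_int_add by (simp only: of_int_numeral mult_1_right)
  have is': "cartan (d + a + b) b = of_int (B + c' + 2)"
  proof -
    have "cartan (d + a) b = cartan d b + cartan a b"
      by (simp only: inner_add_left add_divide_distrib distrib_left)
    then have "cartan (d + a) b = of_int (B + c')" unfolding i of_int_add .
    then show ?thesis using cartan_shift[OF R(2), of "d + a" 1]
      unfolding scaleR_one of_int_add[of "B + c'"] by (simp only: of_int_numeral mult_1_right)
  qed
  have T1: "string_top a d \<noteq> 3" by (rule diamond_no_g2_bottom[OF ab d(1) dR(3) s'])
  have T2: "string_top a (d + b) \<noteq> 3" by (rule diamond_no_g2_top[OF ab d(1) dR(2,3)])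
  have "string_top b d \<noteq> 3" by (rule diamond_no_g2_bottom[OF ab(2,1) ab(3)[symmetric] d(1) dR(2,4)])
  then have T3: "string_top b (d + b) \<noteq> 3" unfolding string_top_add .
  have "string_top b (d + a) \<noteq> 3" by (rule diamond_no_g2_top[OF ab(2,1) ab(3)[symmetric] d(1) dR(3,2)])
  then have T4: "string_top b (d + a + b) \<noteq> 3" unfolding string_top_add .
  have m: "d + b - b \<in> \<Phi>" "d + a + b - b \<in> \<Phi>" using dR by simp_all
  note v1 = up_weight_value[OF R(1) dR(1) no_a[OF d(1) dR(2)] dR(2) T1 i(1)]
  note v2 = up_weight_value[OF R(1) dR(3) no_a[OF d(3) s'] s' T2 ia]
  note v3 = down_weight_value[OF R(2) dR(3) no_b[OF d(3) m(1)] m(1) T3 ib]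
  note v4 = down_weight_value[OF R(2) dR(4) no_b[OF d(4) m(2)] m(2) T4 is']
  note cs = simple_cartan_sign(1-4)[OF ab i(3,4)] and ex = diamond_excluded[OF ab dR i(3,4,1,2)]
  have "(if A = -2 then 2 else 1) * (if B + 2 = 2 then 2 else 1) =
    (if A + c = -2 then 2 else 1) * (if B + c' + 2 = 2 then 2 else (1::real))"
    using diamond_case_check[OF v1(1) v2(1) v3(1) v4(1) cs ex] .
  then show ?thesis unfolding v1(2) v2(2) v3(2) v4(2) .
qed

text \<open>The weights of the raising and lowering operator of the \<open>sl\<^sub>2\<close> of \<open>a\<close> on the \<open>a\<close>-string of \<open>z\<close>,
  an irreducible representation of highest weight \<open>string_top a z\<close>.\<close>

definition up :: "'a \<Rightarrow> 'a \<Rightarrow> real" where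
  "up a z = (if z \<in> P \<and> z + a \<in> P then (string_top a z - cartan z a) / 2 else 0)"

definition down :: "'a \<Rightarrow> 'a \<Rightarrow> real" where
  "down a z = (if z \<in> P \<and> z - a \<in> P then (string_top a z + cartan z a) / 2 else 0)"

text \<open>This is [e, f] = h on an sl2-module: (T - m + 2)(T + m) - (T + m + 2)(T - m) = 4m. At an
  end of the string the factor T + m or T - m vanishes, so the default 0 in \<open>up\<close> and
  \<open>down\<close> agrees with the formula.\<close>

lemma up_down_diag:
  assumes a: "a \<in> \<Delta>" and x: "x \<in> P" "x \<noteq> a"
  shows "up a (x - a) * down a x - down a (x + a) * up a x = cartan x a"
proof -
  note R = simple_sub[THEN subsetD, OF a] P_root[OF x(1)]
  have xa: "x \<noteq> - a" using P_not_neg x(1) simple_P[OF a] by blast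
  have up: "x + a \<in> P \<longleftrightarrow> x + a \<in> \<Phi>" using P_add x simple_P[OF a] P_root by blast
  have dn: "x - a \<in> P \<longleftrightarrow> x - a \<in> \<Phi>"
  proof
    assume xR: "x - a \<in> \<Phi>"
    have "x \<notin> \<Delta>" using xR simple_diff_not_root a by blast
    then have "H x \<noteq> 1" using P_H_1_simple x by blast
    then have "H (x - a) > 0" using H_ge_1[OF x(1)] a by (simp add: H_diff H_simple)
    then show "x - a \<in> P" using P_of_H_pos xR by blast
  qed (rule P_root)
  define T m where "T = string_top a x" and "m = cartan x a"
  have sh: "cartan (x - a) a = m - 2" "cartan (x + a) a = m + 2"
  proof -
    show "cartan (x + a) a = m + 2" using cartan_shift[OF R(1), of x 1] unfolding m_def scaleR_one by simp
    show "cartan (x - a) a = m - 2" using cartan_shift[OF R(1), of x "-1"] unfolding m_def by (simp only: scaleR_minus_left scaleR_one add_uminus_conv_diff)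
  qed
  have 1: "up a (x - a) * down a x = (T - (m - 2)) / 2 * ((T + m) / 2)"
  proof (cases "x - a \<in> P")
    case True
    then show ?thesis using x unfolding up_def down_def sh string_top_diff T_def[symmetric] m_def[symmetric] by simp
  next
    case False
    then have "\<not> - m < T" using string_down_iff[OF R x(2) xa] dn unfolding m_def T_def by blast
    moreover have "- m \<le> T" using neg_cartan_le_string_top[OF R] unfolding m_def T_def .
    ultimately have "T + m = 0" by linarith
    then show ?thesis using False by (simp add: up_def)
  qed
  have 2: "down a (x + a) * up a x = (T + (m + 2)) / 2 * ((T - m) / 2)"
  proof (cases "x + a \<in> P")
    case True
    then show ?thesis using x unfolding up_def down_def sh string_top_add T_def[symmetric] m_def[symmetric] by simp
  next
    case False
    then have "\<not> m < T" using string_up_iff[OF R x(2) xa] up unfolding m_def T_def by blast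
    moreover have "m \<le> T" using cartan_le_string_top[OF R(2)] unfolding m_def T_def .
    ultimately have "T - m = 0" by linarith
    then show ?thesis using False by (simp add: down_def)
  qed
  show ?thesis unfolding 1 2 m_def[symmetric] by (simp add: field_simps)
qed

text \<open>With \<open>d = x - a\<close>, the lemma \<open>diamond\<close>, applied to the roots
  and to their negatives, shows that \<open>d\<close> and \<open>d + a + b\<close> are positive
  roots together or not at all; in the latter case both sides are 0. Height at least 2 keeps
  \<open>d\<close> from being 0.\<close>

lemma up_down_off_diag:
  assumes ab: "a \<in> \<Delta>" "b \<in> \<Delta>" "a \<noteq> b" and x: "x \<in> P" "H x \<ge> 2" and y: "x - a + b \<in> P"
  shows "up a (x - a) * down b (x - a + b) = down b (x + b) * up a (x - a + b)"
proof -
  note R = simple_sub[THEN subsetD, OF ab(1)] simple_sub[THEN subsetD, OF ab(2)]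
  define d where "d = x - a"
  have xd: "x = d + a" "x - a = d" "x - a + b = d + b" "x + b = d + a + b" by (simp_all add: d_def)
  have Hd: "H d \<ge> 1" using x ab by (simp add: d_def H_diff H_simple)
  have s: "d + a + b \<in> P \<longleftrightarrow> d \<in> P"
  proof
    assume "d \<in> P"
    have "H (d + a + b) > 0" using Hd ab by (simp add: H_add H_simple)
    moreover from this have "d + a + b \<noteq> 0" using H_zero by auto
    then have "d + a + b \<in> \<Phi>"
      using diamond[OF R P_root[OF \<open>d \<in> P\<close>]] x y xd ab simple_diff_not_root P_root by metis
    ultimately show "d + a + b \<in> P" using P_of_H_pos by blast
  next
    assume s: "d + a + b \<in> P"
    let ?s = "- (d + a + b)"
    have e: "?s + a = - (d + b)" "?s + b = - (d + a)" "?s + a + b = - d" by simp_all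
    have "?s \<in> \<Phi>" "?s + a \<in> \<Phi>" "?s + b \<in> \<Phi>"
      unfolding e root_minus_iff using s x y xd P_root by auto
    moreover have "?s + a + b \<noteq> 0" unfolding e(3) using Hd H_zero by auto
    ultimately have "?s + a + b \<in> \<Phi>" using diamond[OF R] ab simple_diff_not_root by blast
    then show "d \<in> P" unfolding e(3) root_minus_iff using P_of_H_pos Hd by force
  qed
  show ?thesis
  proof (cases "d \<in> P")
    case True
    then have dP: "d \<in> P" "d + a \<in> P" "d + b \<in> P" "d + a + b \<in> P" using s x y xd by auto
    have "d + b + a \<in> P" using dP(4) by (simp add: add_ac)
    then show ?thesis unfolding xd up_def down_def using dP diamond_weights[OF ab dP] by (simp add: mult.commute)
  next
    case False
    then show ?thesis unfolding xd up_def down_def using s by simp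
  qed
qed

section \<open>A substitute for the principal sl2-triple\<close>

lemma ht_as_coroot_combination: "\<exists>w. \<forall>x. H x = (\<Sum>a\<in>\<Delta>. w a * cartan x a)"
proof -
  \<comment> \<open>\<open>\<rho>\<close> represents the height as an inner product; it is half the
    sum of the positive coroots. Its coordinates in the simple roots are then rescaled to simple
    coroots.\<close>
  define \<rho> :: 'a where "\<rho> = (\<Sum>i\<in>Basis. H i *\<^sub>R i)"
  have Hsum: "H (\<Sum>i\<in>A. f i) = (\<Sum>i\<in>A. H (f i))" for A and f :: "'a \<Rightarrow> 'a"
    by (induction A rule: infinite_finite_induct) (auto simp: H_zero H_add)
  have \<rho>: "x \<bullet> \<rho> = H x" for x
  proof -
    have "H x = H (\<Sum>i\<in>Basis. (x \<bullet> i) *\<^sub>R i)" by (simp add: euclidean_representation)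
    also have "\<dots> = (\<Sum>i\<in>Basis. (x \<bullet> i) * H i)" by (simp add: Hsum H_scale)
    also have "\<dots> = x \<bullet> \<rho>" by (simp add: \<rho>_def inner_sum_right mult.commute)
    finally show ?thesis by simp
  qed
  have "H x = (\<Sum>a\<in>\<Delta>. (cf a \<rho> * (a \<bullet> a) / 2) * cartan x a)" for x
  proof -
    have "H x = x \<bullet> (\<Sum>a\<in>\<Delta>. cf a \<rho> *\<^sub>R a)" by (simp only: cf_expand[symmetric] \<rho>)
    also have "\<dots> = (\<Sum>a\<in>\<Delta>. cf a \<rho> * (x \<bullet> a))" by (simp add: inner_sum_right)
    also have "\<dots> = (\<Sum>a\<in>\<Delta>. (cf a \<rho> * (a \<bullet> a) / 2) * cartan x a)"
    proof (rule sum.cong)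
      fix a assume "a \<in> \<Delta>"
      then have "a \<bullet> a > 0" using simple_sub root_sq_pos by auto
      then show "cf a \<rho> * (x \<bullet> a) = (cf a \<rho> * (a \<bullet> a) / 2) * cartan x a" by simp
    qed simp
    finally show ?thesis .
  qed
  then show ?thesis by (intro exI[of _ "\<lambda>a. cf a \<rho> * (a \<bullet> a) / 2"] allI)
qed

definition raise :: "('a \<Rightarrow> real) \<Rightarrow> 'a \<Rightarrow> real" where
  "raise v z = (\<Sum>a\<in>\<Delta>. up a (z - a) * v (z - a))"

text \<open>Coordinates, in the simple coroots, of the Cartan element that acts by the height. As
  coefficients of \<open>sink\<close> they make the diagonal commutators add up to the
  height.\<close>

definition coweight :: "'a \<Rightarrow> real" where
  "coweight = (SOME w. \<forall>x. H x = (\<Sum>a\<in>\<Delta>. w a * cartan x a))"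

definition sink :: "('a \<Rightarrow> real) \<Rightarrow> 'a \<Rightarrow> real" where
  "sink v z = (\<Sum>a\<in>\<Delta>. coweight a * down a (z + a) * v (z + a))"

lemma coweight: "H x = (\<Sum>a\<in>\<Delta>. coweight a * cartan x a)"
  unfolding coweight_def using someI_ex[OF ht_as_coroot_combination] by blast

text \<open>\<open>raise\<close> and \<open>sink\<close> imitate the adjoint action of a principal \<open>sl\<^sub>2\<close>-triple on the positive part
  of the semisimple Lie algebra, without its structure constants.\<close>

lemma commutator:
  assumes v: "\<And>z. z \<notin> P \<Longrightarrow> v z = 0" and x: "x \<in> P" "H x \<ge> 2"
  shows "raise (sink v) x - sink (raise v) x = H x * v x"
proof -
  have "raise (sink v) x = (\<Sum>a\<in>\<Delta>. \<Sum>b\<in>\<Delta>. coweight b * v (x - a + b) * (up a (x - a) * down b (x - a + b)))"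
    by (simp add: raise_def sink_def sum_distrib_left mult_ac)
  moreover have "sink (raise v) x = (\<Sum>a\<in>\<Delta>. \<Sum>b\<in>\<Delta>. coweight b * v (x - a + b) * (down b (x + b) * up a (x - a + b)))"
  proof -
    have "sink (raise v) x = (\<Sum>b\<in>\<Delta>. \<Sum>a\<in>\<Delta>. coweight b * v (x + b - a) * (down b (x + b) * up a (x + b - a)))"
      by (simp add: raise_def sink_def sum_distrib_left mult_ac)
    also have "\<dots> = (\<Sum>a\<in>\<Delta>. \<Sum>b\<in>\<Delta>. coweight b * v (x + b - a) * (down b (x + b) * up a (x + b - a)))"
      by (rule sum.swap)
    finally show ?thesis by (simp add: diff_add_eq)
  qed
  ultimately have "raise (sink v) x - sink (raise v) x = (\<Sum>a\<in>\<Delta>. \<Sum>b\<in>\<Delta>. coweight b * v (x - a + b) *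
      (up a (x - a) * down b (x - a + b) - down b (x + b) * up a (x - a + b)))"
    by (simp add: sum_subtractf right_diff_distrib)
  also have "\<dots> = (\<Sum>a\<in>\<Delta>. \<Sum>b\<in>\<Delta>. if a = b then coweight a * cartan x a * v x else 0)"
  proof (intro sum.cong refl)
    fix a b assume ab: "a \<in> \<Delta>" "b \<in> \<Delta>"
    show "coweight b * v (x - a + b) * (up a (x - a) * down b (x - a + b) - down b (x + b) * up a (x - a + b))
      = (if a = b then coweight a * cartan x a * v x else 0)"
    proof (cases "a = b")
      case True
      have "x \<noteq> a" using x H_simple ab by auto
      then have e: "up a (x - a) * down a x - down a (x + a) * up a x = cartan x a"
        by (rule up_down_diag[OF ab(1) x(1)])
      show ?thesis unfolding True[symmetric] diff_add_cancel unfolding e by (simp only: simp_thms if_True mult_ac)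
    next
      case False
      \<comment> \<open>Off the diagonal the two products agree if \<open>x - a + b\<close> is
        positive; otherwise \<open>v\<close> vanishes there.\<close>
      then show ?thesis using v[of "x - a + b"] up_down_off_diag[OF ab False x] by (cases "x - a + b \<in> P") auto
    qed
  qed
  also have "\<dots> = (\<Sum>a\<in>\<Delta>. coweight a * cartan x a * v x)"
    using finite_simple by (intro sum.cong refl) (simp add: sum.delta)
  also have "\<dots> = H x * v x" unfolding coweight[of x] by (simp only: sum_distrib_right)
  finally show ?thesis .
qed

definition in_layer :: "real \<Rightarrow> ('a \<Rightarrow> real) \<Rightarrow> bool" where
  "in_layer h v \<longleftrightarrow> (\<forall>z. v z \<noteq> 0 \<longrightarrow> z \<in> P \<and> H z = h)"

lemma raise_layer:
  assumes "in_layer h v" shows "in_layer (h + 1) (raise v)"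
  unfolding in_layer_def
proof (intro allI impI)
  fix z assume "raise v z \<noteq> 0"
  then obtain a where a: "a \<in> \<Delta>" "up a (z - a) * v (z - a) \<noteq> 0"
    unfolding raise_def by (meson sum.not_neutral_contains_not_neutral)
  then have "up a (z - a) \<noteq> 0" "v (z - a) \<noteq> 0" by auto
  then have "z \<in> P" "H (z - a) = h" using assms by (auto simp: up_def in_layer_def split: if_splits)
  then show "z \<in> P \<and> H z = h + 1" using a by (simp add: H_diff H_simple)
qed

text \<open>\<open>commutator\<close> covers positive roots of height at least 2. Elsewhere all
  terms vanish separately: \<open>raise v\<close> lives in height at least 3, and raising never
  reaches height 1.\<close>

lemma sink_raise:
  assumes v: "in_layer h v" and h: "h \<ge> 2"
  shows "sink (raise v) z = raise (sink v) z - h * v z"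
proof (cases "z \<in> P \<and> H z \<ge> 2")
  case True
  then have "raise (sink v) z - sink (raise v) z = H z * v z"
    using commutator[of v z] v by (auto simp: in_layer_def)
  moreover have "H z * v z = h * v z" using v by (auto simp: in_layer_def)
  ultimately show ?thesis by simp
next
  case False
  have "v z = 0" using False v h by (auto simp: in_layer_def)
  moreover have "sink (raise v) z = 0" unfolding sink_def
  proof (rule sum.neutral, rule ballI)
    fix a assume a: "a \<in> \<Delta>"
    show "coweight a * down a (z + a) * raise v (z + a) = 0"
    proof (cases "z \<in> P")
      case True
      then have "H (z + a) < h + 1" using False h a by (simp add: H_add H_simple)
      then have "raise v (z + a) = 0" using raise_layer[OF v] by (auto simp: in_layer_def)
      then show ?thesis by simp
    qed (simp add: down_def)
  qed
  moreover have "raise (sink v) z = 0" unfolding raise_def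
  proof (rule sum.neutral, rule ballI)
    fix a assume a: "a \<in> \<Delta>"
    show "up a (z - a) * sink v (z - a) = 0"
    proof (cases "z \<in> P \<and> z - a \<in> P")
      case True
      then show ?thesis using False H_ge_1[of "z - a"] a by (simp add: H_diff H_simple)
    qed (auto simp: up_def)
  qed
  ultimately show ?thesis by simp
qed

text \<open>If \<open>sink v = 0\<close> then \<open>sink (raise\<^sup>k\<^sup>+\<^sup>1 v)\<close> is a nonzero multiple of \<open>raise\<^sup>k v\<close>, and \<open>raise\<close> is nilpotent.\<close>

lemma sink_injective:
  assumes v: "in_layer h v" and h: "h \<ge> 2" and s: "\<And>z. sink v z = 0"
  shows "v z = 0"
proof -
  define u where "u k = (raise ^^ k) v" for k
  have lay: "in_layer (h + real k) (u k)" for k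
  proof (induction k)
    case (Suc k)
    then show ?case using raise_layer[OF Suc] by (simp add: u_def add_ac)
  qed (use v in \<open>simp add: u_def\<close>)
  have us: "u (Suc k) = raise (u k)" for k by (simp add: u_def)
  have lad: "\<exists>C>0. \<forall>z. sink (u (Suc k)) z = - C * u k z" for k
  proof (induction k)
    case 0
    have "raise (sink v) z = 0" for z by (simp add: raise_def s)
    then have "sink (u (Suc 0)) z = - h * u 0 z" for z
      using sink_raise[OF v h] by (simp add: u_def)
    then show ?case using h by (intro exI[of _ h]) auto
  next
    case (Suc k)
    then obtain C where C: "C > 0" "\<And>z. sink (u (Suc k)) z = - C * u k z" by blast
    then have "sink (u (Suc k)) = (\<lambda>z. - C * u k z)" by blast
    then have "raise (sink (u (Suc k))) z = - C * u (Suc k) z" for z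
      unfolding us[of k] by (simp add: raise_def sum_distrib_left mult_ac sum_negf)
    \<comment> \<open>Each step adds the height of the current layer to the constant, so the
      constants stay positive.\<close>
    then have "sink (u (Suc (Suc k))) z = - (C + (h + real (Suc k))) * u (Suc k) z" for z
      using sink_raise[OF lay[of "Suc k"], of z] h unfolding us[of "Suc k"] by (simp add: algebra_simps)
    then show ?case using C h by (intro exI[of _ "C + (h + real (Suc k))"]) auto
  qed
  define K where "K = Suc (Max (hn ` P))"
  have top: "u K z = 0" for z
  proof (rule ccontr)
    assume "u K z \<noteq> 0"
    then have z: "z \<in> P" "H z = h + real K" using lay[of K] by (auto simp: in_layer_def)
    then have "hn z \<le> Max (hn ` P)" using finite_P by (intro Max_ge) auto
    then show False using z H_hn[OF z(1)] h by (simp add: K_def)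
  qed
  have "(\<forall>z. u k z = 0) \<Longrightarrow> (\<forall>z. u 0 z = 0)" for k
  proof (induction k)
    case (Suc k)
    obtain C where C: "C > 0" "\<And>z. sink (u (Suc k)) z = - C * u k z" using lad by blast
    have "sink (u (Suc k)) z = 0" for z using Suc.prems by (simp add: sink_def)
    then have "\<forall>z. u k z = 0" using C by simp
    then show ?case using Suc.IH by blast
  qed
  then have "\<forall>z. u 0 z = 0" using top by blast
  then show ?thesis by (simp add: u_def)
qed

end

text \<open>Gaussian elimination: the equation of \<open>z\<close> is solved for an unknown
  \<open>x0\<close> with nonzero coefficient, and the other equations are rewritten without
  it.\<close>

lemma exists_nonzero_kernel:
  fixes k :: "'c \<Rightarrow> 'b \<Rightarrow> real"
  assumes "finite B" "finite A" "card B < card A"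
  shows "\<exists>v. (\<forall>x. x \<notin> A \<longrightarrow> v x = 0) \<and> (\<exists>x. v x \<noteq> 0) \<and> (\<forall>z\<in>B. (\<Sum>x\<in>A. k z x * v x) = 0)"
  using assms
proof (induction B arbitrary: A k rule: finite_induct)
  case empty
  then obtain x where "x \<in> A" by fastforce
  then show ?case by (intro exI[of _ "\<lambda>y. if y = x then 1 else 0"]) auto
next
  case (insert z B)
  show ?case
  proof (cases "\<forall>x\<in>A. k z x = 0")
    case True
    have "card B < card A" using insert by simp
    then obtain v where "\<forall>x. x \<notin> A \<longrightarrow> v x = 0" "\<exists>x. v x \<noteq> 0" "\<forall>z\<in>B. (\<Sum>x\<in>A. k z x * v x) = 0"
      using insert.IH[OF insert.prems(1)] by blast
    then show ?thesis using True by (intro exI[of _ v]) auto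
  next
    case False
    then obtain x0 where x0: "x0 \<in> A" "k z x0 \<noteq> 0" by blast
    have "card B < card (A - {x0})" using insert x0 by simp
    then obtain v where v: "\<forall>x. x \<notin> A - {x0} \<longrightarrow> v x = 0" "\<exists>x. v x \<noteq> 0"
      "\<forall>z'\<in>B. (\<Sum>x\<in>A - {x0}. (k z' x - k z' x0 * k z x / k z x0) * v x) = 0"
      using insert.IH[of "A - {x0}" "\<lambda>z' x. k z' x - k z' x0 * k z x / k z x0"] insert.prems by blast
    define S where "S = (\<Sum>x\<in>A - {x0}. k z x * v x)"
    define u where "u = v(x0 := - S / k z x0)"
    have su: "(\<Sum>x\<in>A. k z' x * u x) = k z' x0 * (- S / k z x0) + (\<Sum>x\<in>A - {x0}. k z' x * v x)" for z'
    proof -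
      have "(\<Sum>x\<in>A. k z' x * u x) = k z' x0 * u x0 + (\<Sum>x\<in>A - {x0}. k z' x * u x)"
        using insert.prems(1) x0 by (simp add: sum.remove)
      also have "(\<Sum>x\<in>A - {x0}. k z' x * u x) = (\<Sum>x\<in>A - {x0}. k z' x * v x)"
        by (rule sum.cong) (auto simp: u_def)
      finally show ?thesis by (simp add: u_def)
    qed
    have "(\<Sum>x\<in>A. k z x * u x) = 0" unfolding su using x0 by (simp add: S_def)
    moreover have "(\<Sum>x\<in>A. k z' x * u x) = 0" if "z' \<in> B" for z'
    proof -
      have "0 = (\<Sum>x\<in>A - {x0}. (k z' x - k z' x0 * k z x / k z x0) * v x)" using v(3) that by simp
      also have "\<dots> = (\<Sum>x\<in>A - {x0}. k z' x * v x) - k z' x0 / k z x0 * S"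
        by (simp add: S_def sum_distrib_left sum_subtractf algebra_simps)
      finally show ?thesis unfolding su by simp
    qed
    moreover obtain x1 where "v x1 \<noteq> 0" using v(2) by blast
    then have "u x1 \<noteq> 0" using v(1) by (auto simp: u_def)
    moreover have "\<forall>x. x \<notin> A \<longrightarrow> u x = 0" using v(1) x0 by (auto simp: u_def)
    ultimately show ?thesis by (intro exI[of _ u]) auto
  qed
qed

context based_root_system
begin

text \<open>A larger upper layer would give the lowering operator between the two layers of
  \<open>N\<close> a nonzero kernel vector \<open>v\<close>. Outside the lower layer of
  \<open>N\<close> the function \<open>sink v\<close> vanishes too, because lowering a root of
  \<open>N\<close> stays in \<open>N\<close>; this contradicts
  \<open>sink_injective\<close>.\<close>

lemma lower_layer_antimono:
  assumes N: "lower N" and h: "h \<ge> 1"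
  shows "card {x \<in> N. H x = real (Suc h)} \<le> card {x \<in> N. H x = real h}"
proof (rule ccontr)
  let ?A = "{x \<in> N. H x = real (Suc h)}" and ?B = "{x \<in> N. H x = real h}"
  assume "\<not> card ?A \<le> card ?B"
  moreover have fin: "finite ?A" "finite ?B" using finite_subset[OF lower_sub[OF N] finite_P] by auto
  ultimately obtain v where v: "\<forall>x. x \<notin> ?A \<longrightarrow> v x = 0" "\<exists>x. v x \<noteq> 0"
    "\<forall>z\<in>?B. (\<Sum>x\<in>?A. (if x - z \<in> \<Delta> then coweight (x - z) * down (x - z) x else 0) * v x) = 0"
    using exists_nonzero_kernel[of ?B ?A "\<lambda>z x. if x - z \<in> \<Delta> then coweight (x - z) * down (x - z) x else 0"]
    by auto
  have lay: "in_layer (real (Suc h)) v" using v(1) lower_sub[OF N] by (auto simp: in_layer_def)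
  have s: "sink v z = 0" for z
  proof (cases "z \<in> ?B")
    case True
    \<comment> \<open>The sum over simple roots is rewritten over the roots
      \<open>x = z + a\<close>, the matrix form in which the kernel vector was found.\<close>
    have "sink v z = (\<Sum>a\<in>{a \<in> \<Delta>. z + a \<in> ?A}. coweight a * down a (z + a) * v (z + a))"
      unfolding sink_def by (rule sum.mono_neutral_right) (use v(1) finite_simple in auto)
    also have "\<dots> = (\<Sum>x\<in>{x \<in> ?A. x - z \<in> \<Delta>}. coweight (x - z) * down (x - z) x * v x)"
      by (rule sum.reindex_bij_witness[of _ "\<lambda>x. x - z" "\<lambda>a. z + a"]) auto
    also have "\<dots> = (\<Sum>x\<in>?A. (if x - z \<in> \<Delta> then coweight (x - z) * down (x - z) x else 0) * v x)"
      by (rule sum.mono_neutral_cong_left) (use fin in auto)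
    finally show ?thesis using v(3) True by simp
  next
    case False
    show ?thesis unfolding sink_def
    proof (rule sum.neutral, rule ballI, rule ccontr)
      fix a assume a: "a \<in> \<Delta>" and "coweight a * down a (z + a) * v (z + a) \<noteq> 0"
      then have "down a (z + a) \<noteq> 0" "v (z + a) \<noteq> 0" by auto
      then have "z \<in> P" "z + a \<in> ?A" using v(1) by (auto simp: down_def split: if_splits)
      then have "z \<in> ?B" using lowerD[OF N _ simple_P[OF a]] a by (auto simp: H_add H_simple)
      then show False using False by simp
    qed
  qed
  have "v z = 0" for z using sink_injective[OF lay _ s] h by simp
  then show False using v(2) by blast
qed

end


section \<open>Exponents\<close>

text \<open>\<open>exponent_product\<close> as a function of the height distribution alone, so that
  distributions of different sets can be added.\<close>

definition conj_product :: "(nat \<Rightarrow> nat) \<Rightarrow> int poly" where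
  "conj_product l = (\<Prod>i = 1..l 1. \<Sum>k = 0..card {j. 1 \<le> j \<and> l j \<ge> l 1 - i + 1}. monom 1 k)"

lemma exponent_product_eq: "exponent_product \<Delta> P I = conj_product (ht_count \<Delta> P I)"
  by (simp add: exponent_product_def ideal_exponent_def conj_product_def)

lemma conj_product_cong:
  assumes "\<And>j. j \<ge> 1 \<Longrightarrow> l j = l' j" shows "conj_product l = conj_product l'"
proof -
  have "{j. 1 \<le> j \<and> l j \<ge> l 1 - i + 1} = {j. 1 \<le> j \<and> l' j \<ge> l' 1 - i + 1}" for i
    using assms by auto
  moreover have "l 1 = l' 1" using assms by simp
  ultimately show ?thesis unfolding conj_product_def by simp
qed

lemma prod_telescope:
  fixes l :: "nat \<Rightarrow> nat" and f :: "nat \<Rightarrow> 'b::comm_monoid_mult"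
  assumes dec: "\<And>j. j \<ge> 1 \<Longrightarrow> l (Suc j) \<le> l j"
  shows "(\<Prod>k\<in>{l (Suc m)<..l 1}. f k) = (\<Prod>j = 1..m. \<Prod>k\<in>{l (Suc j)<..l j}. f k)"
proof (induction m)
  case (Suc m)
  have le: "l (Suc m) \<le> l 1"
  proof (induction m)
    case (Suc k)
    then show ?case using dec[of "Suc k"] by linarith
  qed simp
  have "{l (Suc (Suc m))<..l 1} = {l (Suc (Suc m))<..l (Suc m)} \<union> {l (Suc m)<..l 1}"
    using le dec[of "Suc m"] by auto
  then have "(\<Prod>k\<in>{l (Suc (Suc m))<..l 1}. f k) =
      (\<Prod>k\<in>{l (Suc (Suc m))<..l (Suc m)}. f k) * (\<Prod>k\<in>{l (Suc m)<..l 1}. f k)"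
    by (simp only:) (rule prod.union_disjoint; auto)
  then show ?case unfolding Suc by (simp add: mult.commute)
qed simp

text \<open>The threshold \<open>k = l 1 - i + 1\<close> runs through 1, ..., \<open>l 1\<close>,
  and the exponent equals \<open>j\<close> for the \<open>l j - l (Suc j)\<close> thresholds with
  \<open>l (Suc j) < k \<le> l j\<close>.\<close>

lemma conj_product_formula:
  assumes dec: "\<And>j. j \<ge> 1 \<Longrightarrow> l (Suc j) \<le> l j" and z: "l (Suc n) = 0"
  shows "conj_product l = (\<Prod>j = 1..n. (\<Sum>k = 0..j. monom 1 k) ^ (l j - l (Suc j)))"
proof -
  define c where "c k = card {j. 1 \<le> j \<and> k \<le> l j}" for k
  have le: "l j \<le> l i" if "1 \<le> i" "i \<le> j" for i j
    using that(2)
  proof (induction rule: dec_induct)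
    case (step m)
    then show ?case using dec[of m] that(1) by linarith
  qed simp
  have c: "c k = j" if "j \<ge> 1" "k \<in> {l (Suc j)<..l j}" for j k
  proof -
    have "{i. 1 \<le> i \<and> k \<le> l i} = {1..j}"
    proof (intro set_eqI iffI)
      fix i assume "i \<in> {i. 1 \<le> i \<and> k \<le> l i}"
      then have i: "1 \<le> i" "k \<le> l i" by auto
      have "i \<le> j"
      proof (rule ccontr)
        assume "\<not> i \<le> j"
        then have "l i \<le> l (Suc j)" by (intro le) auto
        then show False using i that by auto
      qed
      then show "i \<in> {1..j}" using i by simp
    next
      fix i assume "i \<in> {1..j}"
      then have "l j \<le> l i" by (intro le) auto
      then show "i \<in> {i. 1 \<le> i \<and> k \<le> l i}" using that \<open>i \<in> {1..j}\<close> by auto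
    qed
    then show ?thesis by (simp add: c_def)
  qed
  have "conj_product l = (\<Prod>k\<in>{l (Suc n)<..l 1}. \<Sum>i = 0..c k. monom 1 i)"
    unfolding conj_product_def c_def
    by (rule prod.reindex_bij_witness[of _ "\<lambda>k. l 1 - k + 1" "\<lambda>i. l 1 - i + 1"]) (use z in auto)
  also have "\<dots> = (\<Prod>j = 1..n. \<Prod>k\<in>{l (Suc j)<..l j}. \<Sum>i = 0..c k. monom 1 i)"
    by (rule prod_telescope) (rule dec)
  also have "\<dots> = (\<Prod>j = 1..n. (\<Sum>k = 0..j. monom 1 k) ^ (l j - l (Suc j)))"
  proof (rule prod.cong)
    fix j assume j: "j \<in> {1..n}"
    have "(\<Prod>k\<in>{l (Suc j)<..l j}. \<Sum>i = 0..c k. monom (1::int) i) = (\<Prod>k\<in>{l (Suc j)<..l j}. \<Sum>i = 0..j. monom 1 i)"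
      by (rule prod.cong) (use c j in auto)
    then show "(\<Prod>k\<in>{l (Suc j)<..l j}. \<Sum>i = 0..c k. monom (1::int) i) = (\<Sum>k = 0..j. monom 1 k) ^ (l j - l (Suc j))"
      by simp
  qed simp
  finally show ?thesis .
qed

text \<open>In the product formula the multiplicity of an exponent is a difference of consecutive
  values, hence additive; monotonicity keeps the truncated subtraction exact.\<close>

lemma conj_product_add:
  assumes "\<And>j. j \<ge> 1 \<Longrightarrow> l (Suc j) \<le> l j" "\<And>j. j \<ge> 1 \<Longrightarrow> l' (Suc j) \<le> l' j"
    and "l (Suc n) = 0" "l' (Suc n) = 0"
  shows "conj_product (\<lambda>j. l j + l' j) = conj_product l * conj_product l'"
proof -
  have "conj_product (\<lambda>j. l j + l' j) =
      (\<Prod>j = 1..n. (\<Sum>k = 0..j. monom 1 k) ^ (l j + l' j - (l (Suc j) + l' (Suc j))))"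
    by (rule conj_product_formula) (use assms in \<open>auto intro: add_mono\<close>)
  also have "\<dots> = (\<Prod>j = 1..n. (\<Sum>k = 0..j. monom 1 k) ^ (l j - l (Suc j)) * (\<Sum>k = 0..j. monom 1 k) ^ (l' j - l' (Suc j)))"
  proof (rule prod.cong)
    fix j assume "j \<in> {1..n}"
    then have "l j + l' j - (l (Suc j) + l' (Suc j)) = (l j - l (Suc j)) + (l' j - l' (Suc j))"
      using assms(1,2)[of j] by simp
    then show "(\<Sum>k = 0..j. monom (1::int) k) ^ (l j + l' j - (l (Suc j) + l' (Suc j))) =
      (\<Sum>k = 0..j. monom 1 k) ^ (l j - l (Suc j)) * (\<Sum>k = 0..j. monom 1 k) ^ (l' j - l' (Suc j))"
      by (simp only: power_add)
  qed simp
  also have "\<dots> = conj_product l * conj_product l'"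
    using conj_product_formula[of l n] conj_product_formula[of l' n] assms by (simp add: prod.distrib)
  finally show ?thesis .
qed

lemma conj_product_single:
  assumes "m \<ge> 1"
  shows "conj_product (\<lambda>j. if 1 \<le> j \<and> j \<le> m then 1 else 0) = (\<Sum>k = 0..m. monom 1 k)"
proof -
  have "{j. 1 \<le> j \<and> (if 1 \<le> j \<and> j \<le> m then 1 else 0) \<ge> (1::nat)} = {1..m}" by auto
  then show ?thesis using assms by (simp add: conj_product_def)
qed

text \<open>A sum landing in one part involves no root of the other, so closedness decouples into
  conditions on the two traces.\<close>

lemma weyl_poly_Un:
  assumes fin: "finite N1" "finite N2" and disj: "N1 \<inter> N2 = {}"
    and sep1: "\<And>x y. x \<in> N1 \<union> N2 \<Longrightarrow> y \<in> N1 \<union> N2 \<Longrightarrow> x + y \<in> N1 \<Longrightarrow> x \<in> N1 \<and> y \<in> N1"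
    and sep2: "\<And>x y. x \<in> N1 \<union> N2 \<Longrightarrow> y \<in> N1 \<union> N2 \<Longrightarrow> x + y \<in> N2 \<Longrightarrow> x \<in> N2 \<and> y \<in> N2"
  shows "weyl_poly (N1 \<union> N2) = weyl_poly N1 * weyl_poly N2"
proof -
  have "weyl_poly (N1 \<union> N2) = (\<Sum>(S, T)\<in>{S. biclosed N1 S} \<times> {T. biclosed N2 T}. monom 1 (card S + card T))"
    unfolding weyl_poly_def
  proof (rule sum.reindex_bij_witness[where j = "\<lambda>S. (S \<inter> N1, S \<inter> N2)" and i = "\<lambda>(S, T). S \<union> T"])
    fix S assume "S \<in> {S. biclosed (N1 \<union> N2) S}"
    then have S: "biclosed (N1 \<union> N2) S" by simp
    have SN: "S \<subseteq> N1 \<union> N2" using biclosed_sub[OF S] .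
    then show "(case (S \<inter> N1, S \<inter> N2) of (S, T) \<Rightarrow> S \<union> T) = S" by auto
    have sub: "biclosed N' (S \<inter> N')" if "N' \<subseteq> N1 \<union> N2" for N'
    proof -
      have "x + y \<in> S" if "x \<in> S" "y \<in> S" "x + y \<in> N'" for x y
        using biclosed_add[OF S that(1,2)] that(3) \<open>N' \<subseteq> N1 \<union> N2\<close> by blast
      moreover have "x + y \<notin> S" if "x \<in> N' - S" "y \<in> N' - S" "x + y \<in> N'" for x y
        using biclosed_add[OF biclosed_Diff[OF S], of x y] that \<open>N' \<subseteq> N1 \<union> N2\<close> by blast
      ultimately show ?thesis unfolding biclosed_def rel_closed_def by blast
    qed
    from sub[of N1] sub[of N2]
    show "(S \<inter> N1, S \<inter> N2) \<in> {S. biclosed N1 S} \<times> {T. biclosed N2 T}" by auto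
    have "card S = card (S \<inter> N1 \<union> S \<inter> N2)" using SN by (intro arg_cong[of _ _ card]) auto
    also have "\<dots> = card (S \<inter> N1) + card (S \<inter> N2)"
      using fin disj by (intro card_Un_disjoint) auto
    finally show "(case (S \<inter> N1, S \<inter> N2) of (S, T) \<Rightarrow> monom 1 (card S + card T)) = monom (1::int) (card S)"
      by simp
  next
    fix ST assume "ST \<in> {S. biclosed N1 S} \<times> {T. biclosed N2 T}"
    then obtain S T where ST: "ST = (S, T)" "biclosed N1 S" "biclosed N2 T" by auto
    note sub = biclosed_sub[OF ST(2)] biclosed_sub[OF ST(3)]
    show "(\<lambda>S. (S \<inter> N1, S \<inter> N2)) (case ST of (S, T) \<Rightarrow> S \<union> T) = ST" using ST sub disj by auto
    have cl: "x + y \<in> A \<union> B" if "biclosed N1 A" "biclosed N2 B" and xy: "x \<in> A \<union> B" "y \<in> A \<union> B" "x + y \<in> N1 \<union> N2" for A B x y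
    proof -
      note sub' = biclosed_sub[OF that(1)] biclosed_sub[OF that(2)]
      have xyN: "x \<in> N1 \<union> N2" "y \<in> N1 \<union> N2" using xy sub' by auto
      from xy(3) show ?thesis
      proof
        assume s: "x + y \<in> N1"
        then have "x \<in> N1" "y \<in> N1" using sep1[OF xyN] by auto
        then have "x \<in> A" "y \<in> A" using xy sub' disj by auto
        then show ?thesis using biclosed_add[OF that(1)] s by blast
      next
        assume s: "x + y \<in> N2"
        then have "x \<in> N2" "y \<in> N2" using sep2[OF xyN] by auto
        then have "x \<in> B" "y \<in> B" using xy sub' disj by auto
        then show ?thesis using biclosed_add[OF that(2)] s by blast
      qed
    qed
    have dif: "N1 \<union> N2 - (S \<union> T) = (N1 - S) \<union> (N2 - T)" using sub disj by auto
    have "biclosed (N1 \<union> N2) (S \<union> T)"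
      unfolding biclosed_def rel_closed_def dif
      using cl[OF ST(2,3)] cl[OF biclosed_Diff[OF ST(2)] biclosed_Diff[OF ST(3)]] sub by blast
    then show "(case ST of (S, T) \<Rightarrow> S \<union> T) \<in> {S. biclosed (N1 \<union> N2) S}" using ST by simp
  qed
  also have "\<dots> = (\<Sum>(S, T)\<in>{S. biclosed N1 S} \<times> {T. biclosed N2 T}. monom 1 (card S) * monom 1 (card T))"
    by (simp add: mult_monom)
  also have "\<dots> = weyl_poly N1 * weyl_poly N2"
    by (simp add: weyl_poly_def sum_product sum.cartesian_product)
  finally show ?thesis .
qed

section \<open>Layer counts and restriction to parabolic subsystems\<close>

context based_root_system
begin

definition layer_count :: "'a set \<Rightarrow> nat \<Rightarrow> nat" where
  "layer_count N j = card {x \<in> N. H x = real j}"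

lemma layer_count_dec: "lower N \<Longrightarrow> j \<ge> 1 \<Longrightarrow> layer_count N (Suc j) \<le> layer_count N j"
  unfolding layer_count_def by (rule lower_layer_antimono)

lemma layer_count_large:
  assumes "lower N" shows "layer_count N (Suc (Max (hn ` P))) = 0"
proof -
  have "{x \<in> N. H x = real (Suc (Max (hn ` P)))} = {}"
  proof -
    have False if x: "x \<in> N" "H x = real (Suc (Max (hn ` P)))" for x
    proof -
      have "x \<in> P" using x lower_sub[OF assms] by auto
      then have "hn x \<le> Max (hn ` P)" using finite_P by (intro Max_ge) auto
      then show False using x H_hn[OF \<open>x \<in> P\<close>] by simp
    qed
    then show ?thesis by blast
  qed
  then show ?thesis unfolding layer_count_def by (simp only: card.empty)
qed

lemma layer_count_Un:
  assumes "finite M" "finite D" "M \<inter> D = {}"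
  shows "layer_count (M \<union> D) j = layer_count M j + layer_count D j"
proof -
  have "{x \<in> M \<union> D. H x = real j} = {x \<in> M. H x = real j} \<union> {x \<in> D. H x = real j}" by auto
  then show ?thesis unfolding layer_count_def using assms by (simp only:) (rule card_Un_disjoint; auto)
qed

lemma parabolicI:
  assumes \<Delta>': "\<Delta>' \<subseteq> \<Delta>" and x: "x \<in> P" and z: "\<And>c. c \<in> \<Delta> - \<Delta>' \<Longrightarrow> cf c x = 0"
  shows "x \<in> parabolic \<Phi> \<Delta>'"
proof -
  have "\<forall>c. \<exists>k::int. cf c x = of_int k"
    using P_cf_nat[OF x] by (metis Nats_cases of_int_of_nat_eq)
  then obtain k :: "'a \<Rightarrow> int" where k: "\<And>c. cf c x = of_int (k c)" by metis
  have "(\<Sum>c\<in>\<Delta>. cf c x *\<^sub>R c) = (\<Sum>c\<in>\<Delta>'. cf c x *\<^sub>R c)"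
    by (rule sum.mono_neutral_right) (use \<Delta>' z finite_simple in auto)
  then have "x = (\<Sum>c\<in>\<Delta>'. of_int (k c) *\<^sub>R c)" unfolding k[symmetric] by (simp only: cf_expand[symmetric])
  then show ?thesis using P_root[OF x] unfolding parabolic_def by blast
qed

lemma parabolic_cf:
  assumes "\<Delta>' \<subseteq> \<Delta>" "x \<in> parabolic \<Phi> \<Delta>'" "c \<notin> \<Delta>'" shows "cf c x = 0"
proof -
  obtain k :: "'a \<Rightarrow> int" where "x = (\<Sum>c\<in>\<Delta>'. of_int (k c) *\<^sub>R c)" using assms(2) by (auto simp: parabolic_def)
  then show ?thesis using cf_comb[OF assms(1), of "\<lambda>c. of_int (k c)" c] assms(3) by simp
qed

text \<open>Coordinates in part of an independent set agree with those in the whole set; thus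
  exponents of a parabolic subsystem can be read off from heights in \<open>\<Phi>\<close>.\<close>

lemma ht_parabolic:
  assumes \<Delta>': "\<Delta>' \<subseteq> \<Delta>" and x: "x \<in> parabolic \<Phi> \<Delta>'" shows "ht \<Delta>' x = H x"
proof -
  obtain k :: "'a \<Rightarrow> int" where "x = (\<Sum>c\<in>\<Delta>'. of_int (k c) *\<^sub>R c)" using x by (auto simp: parabolic_def)
  then have "x \<in> span \<Delta>'" by (simp add: span_sum span_scale span_base)
  then have e: "representation \<Delta> x = representation \<Delta>' x" by (rule representation_extend[OF indep _ \<Delta>'])
  have "H x = (\<Sum>c\<in>\<Delta>'. cf c x)" unfolding ht_def
    by (rule sum.mono_neutral_right) (use \<Delta>' finite_simple parabolic_cf[OF \<Delta>' x] in auto)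
  then show ?thesis by (simp add: ht_def e)
qed

section \<open>The factorisation\<close>

abbreviation parabolic_hyp :: bool where
  "parabolic_hyp \<equiv> \<forall>\<Delta>' J. \<Delta>' \<subset> \<Delta> \<longrightarrow> root_ideal (parabolic \<Phi> \<Delta>' \<inter> P) J \<longrightarrow>
     poincare_poly (parabolic \<Phi> \<Delta>' \<inter> P) J = exponent_product \<Delta>' (parabolic \<Phi> \<Delta>' \<inter> P) J"

text \<open>Inside the parabolic subsystem the complement of a lower set is an ideal, which makes
  the hypothesis available.\<close>

lemma weyl_poly_parabolic:
  assumes hyp: parabolic_hyp and \<Delta>': "\<Delta>' \<subset> \<Delta>" and N: "lower N" "N \<subseteq> parabolic \<Phi> \<Delta>'"
  shows "weyl_poly N = conj_product (layer_count N)"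
proof -
  define P' where "P' = parabolic \<Phi> \<Delta>' \<inter> P"
  have NP: "N \<subseteq> P'" using N lower_sub[OF N(1)] by (auto simp: P'_def)
  then have dd: "P' - (P' - N) = N" by auto
  have "root_ideal P' (P' - N)"
    unfolding root_ideal_def using lowerD[OF N(1)] by (auto simp: P'_def)
  then have "poincare_poly P' (P' - N) = exponent_product \<Delta>' P' (P' - N)"
    using hyp \<Delta>' unfolding P'_def by blast
  moreover have "ht_count \<Delta>' P' (P' - N) = layer_count N"
  proof
    fix j
    have "{x \<in> N. ht \<Delta>' x = real j} = {x \<in> N. H x = real j}"
      using ht_parabolic[of \<Delta>'] \<Delta>' N(2) by auto
    then show "ht_count \<Delta>' P' (P' - N) j = layer_count N j" by (simp add: ht_count_def layer_count_def dd)
  qed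
  ultimately show ?thesis by (simp add: poincare_poly_eq exponent_product_eq dd)
qed

text \<open>By \<open>lower_support\<close> every simple root in the support of a root of
  \<open>N\<close> belongs to \<open>N\<close>, so \<open>N\<close> lives in the subsystem of the
  simple roots it contains.\<close>

lemma weyl_poly_not_full_support:
  assumes hyp: parabolic_hyp and N: "lower N" and "\<not> \<Delta> \<subseteq> N"
  shows "weyl_poly N = conj_product (layer_count N)"
proof (rule weyl_poly_parabolic[OF hyp _ N])
  show "\<Delta> \<inter> N \<subset> \<Delta>" using assms(3) by auto
  show "N \<subseteq> parabolic \<Phi> (\<Delta> \<inter> N)"
  proof
    fix x assume x: "x \<in> N"
    then have xP: "x \<in> P" using lower_sub[OF N] by auto
    have "cf c x = 0" if "c \<in> \<Delta> - \<Delta> \<inter> N" for c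
      using lower_support[OF N _ x, of c] that P_cf_nonneg[OF xP, of c] by fastforce
    then show "x \<in> parabolic \<Phi> (\<Delta> \<inter> N)" using parabolicI[OF _ xP, of "\<Delta> \<inter> N"] by blast
  qed
qed

lemma weyl_poly_condition_C:
  assumes hyp: parabolic_hyp and N: "lower (P - I)"
    and \<Delta>0: "\<Delta>0 \<subset> \<Delta>" "card \<Delta>0 + 1 = card \<Delta>" and C: "condition_C \<Delta> P I (parabolic \<Phi> \<Delta>0)"
  shows "weyl_poly (P - I) = conj_product (layer_count (P - I))"
proof -
  let ?N = "P - I"
  have "card (\<Delta> - \<Delta>0) = 1" using \<Delta>0 finite_simple by (subst card_Diff_subset) (auto intro: finite_subset)
  then obtain b where b: "\<Delta> - \<Delta>0 = {b}" by (auto simp: card_1_singleton_iff)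
  then have bD: "b \<in> \<Delta>" "b \<notin> \<Delta>0" by auto
  have par: "x \<in> parabolic \<Phi> \<Delta>0 \<longleftrightarrow> cf b x = 0" if "x \<in> P" for x
    using parabolicI[of \<Delta>0 x] parabolic_cf[of \<Delta>0 x b] \<Delta>0 b bD that by auto
  define D M where "D = {x \<in> ?N. cf b x > 0}" and "M = {x \<in> ?N. cf b x = 0}"
  have D_eq: "(P - (parabolic \<Phi> \<Delta>0 \<inter> P)) \<inter> (P - I) = D"
    using par P_cf_nonneg[of _ b] by (auto simp: D_def less_le)
  have ne: "D \<noteq> {}" and inj: "inj_on H D"
    and dep: "\<And>x y. x \<in> D \<Longrightarrow> y \<in> D \<Longrightarrow> x \<noteq> y \<Longrightarrow> \<exists>\<gamma>\<in>parabolic \<Phi> \<Delta>0 \<inter> P. dependent {x, y, \<gamma>}"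
    using C unfolding condition_C_def D_eq Let_def by auto
  have pair: "\<exists>\<gamma>\<in>P. cf b \<gamma> = 0 \<and> dependent {x, y, \<gamma>}" if "x \<in> D" "y \<in> D" "x \<noteq> y" for x y
    using dep[OF that] par by blast
  have split: "?N = M \<union> D" "M \<inter> D = {}" using split_N[OF N D_def M_def pair] by blast+
  have lM: "lower M" using lower_M[OF N D_def M_def pair] by blast
  have fin: "finite M" "finite D" using finite_P by (auto simp: D_def M_def)
  have cD: "card D \<ge> 1" using ne fin by (simp add: Suc_leI card_gt_0_iff)
  have MW: "weyl_poly M = conj_product (layer_count M)"
    by (rule weyl_poly_parabolic[OF hyp \<Delta>0(1) lM]) (use par in \<open>auto simp: M_def\<close>)
  have lD: "layer_count D j = (if 1 \<le> j \<and> j \<le> card D then 1 else 0)" for j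
    unfolding layer_count_def by (rule heights_D[OF N D_def M_def pair bD(1) inj])
  \<comment> \<open>Provides a common cut-off, the largest height, beyond which both distributions
    vanish, as \<open>conj_product_add\<close> requires.\<close>
  have "card D \<le> Max (hn ` P)"
  proof -
    have "layer_count D (card D) \<noteq> 0" unfolding lD using cD by simp
    then obtain x where x: "x \<in> D" "H x = real (card D)"
      unfolding layer_count_def by (metis (mono_tags, lifting) card_eq_0_iff ex_in_conv mem_Collect_eq)
    then have xP: "x \<in> P" by (auto simp: D_def)
    then have "hn x \<le> Max (hn ` P)" using finite_P by (intro Max_ge) auto
    then show ?thesis using H_hn[OF xP] x by simp
  qed
  then have big: "layer_count D (Suc (Max (hn ` P))) = 0" unfolding lD by simp
  have "weyl_poly ?N = conj_product (layer_count M) * (\<Sum>k = 0..card D. monom 1 k)"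
    using weyl_poly_factor[OF N D_def M_def pair] MW by simp
  also have "(\<Sum>k = 0..card D. monom 1 k) = conj_product (layer_count D)"
    unfolding conj_product_single[OF cD, symmetric] by (rule conj_product_cong) (simp only: lD)
  also have "conj_product (layer_count M) * conj_product (layer_count D) =
      conj_product (\<lambda>j. layer_count M j + layer_count D j)"
    by (rule conj_product_add[symmetric, where n = "Max (hn ` P)"])
      (use layer_count_dec[OF lM] layer_count_large[OF lM] big in \<open>auto simp: lD\<close>)
  also have "\<dots> = conj_product (layer_count ?N)"
    unfolding split(1) by (rule conj_product_cong) (rule layer_count_Un[OF fin split(2), symmetric])
  finally show ?thesis .
qed

lemma weyl_poly_reducible:
  assumes hyp: parabolic_hyp and N: "lower (P - I)" and full: "\<Delta> \<subseteq> P - I"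
    and red: "reducible_arrangement (ideal_arrangement P I)"
  shows "weyl_poly (P - I) = conj_product (layer_count (P - I))"
proof -
  let ?N = "P - I"
  obtain V1 V2 A1 A2 where V: "subspace V1" "subspace V2" "{x + y |x y. x \<in> V1 \<and> y \<in> V2} = UNIV"
    and A: "arrangement_in V1 A1" "A1 \<noteq> {}" "arrangement_in V2 A2" "A2 \<noteq> {}"
    and eq: "ideal_arrangement P I = (\<lambda>H. {x + y |x y. x \<in> H \<and> y \<in> V2}) ` A1 \<union>
            (\<lambda>H. {x + y |x y. x \<in> V1 \<and> y \<in> H}) ` A2"
    using red unfolding reducible_arrangement_def by (elim exE conjE) blast
  \<comment> \<open>\<open>V1\<close> and \<open>V2\<close> need not be orthogonal, so the two kinds
    of hyperplanes are told apart by what their normals annihilate: the first kind contains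
    \<open>V2\<close>, the second \<open>V1\<close>.\<close>
  define N1 N2 where "N1 = {\<alpha> \<in> ?N. \<forall>y\<in>V2. \<alpha> \<bullet> y = 0}" and "N2 = {\<alpha> \<in> ?N. \<forall>x\<in>V1. \<alpha> \<bullet> x = 0}"
  have both: "u = 0" if "\<forall>x\<in>V1. u \<bullet> x = 0" "\<forall>y\<in>V2. u \<bullet> y = 0" for u :: 'a
  proof -
    obtain x y where "u = x + y" "x \<in> V1" "y \<in> V2" using V(3) by blast
    then have "u \<bullet> u = 0" using that by (simp add: inner_add_right)
    then show ?thesis by simp
  qed
  have H1: "\<forall>y\<in>V2. \<alpha> \<bullet> y = 0" if "H \<in> A1" "{x. \<alpha> \<bullet> x = 0} = {x + y |x y. x \<in> H \<and> y \<in> V2}" for \<alpha> H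
  proof
    fix y assume y: "y \<in> V2"
    have "0 \<in> H" using A(1) that(1) by (auto simp: arrangement_in_def subspace_0)
    then have "0 + y \<in> {x + y |x y. x \<in> H \<and> y \<in> V2}" using y by blast
    then show "\<alpha> \<bullet> y = 0" unfolding that(2)[symmetric] by simp
  qed
  have H2: "\<forall>x\<in>V1. \<alpha> \<bullet> x = 0" if "H \<in> A2" "{x. \<alpha> \<bullet> x = 0} = {x + y |x y. x \<in> V1 \<and> y \<in> H}" for \<alpha> H
  proof
    fix x assume x: "x \<in> V1"
    have "0 \<in> H" using A(3) that(1) by (auto simp: arrangement_in_def subspace_0)
    then have "x + 0 \<in> {x + y |x y. x \<in> V1 \<and> y \<in> H}" using x by blast
    then show "\<alpha> \<bullet> x = 0" unfolding that(2)[symmetric] by simp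
  qed
  have N_eq: "?N = N1 \<union> N2"
  proof
    show "N1 \<union> N2 \<subseteq> ?N" by (auto simp: N1_def N2_def)
    show "?N \<subseteq> N1 \<union> N2"
    proof
      fix \<alpha> assume \<alpha>: "\<alpha> \<in> ?N"
      then have "{x. \<alpha> \<bullet> x = 0} \<in> ideal_arrangement P I" by (auto simp: ideal_arrangement_def)
      then show "\<alpha> \<in> N1 \<union> N2" unfolding eq using \<alpha> H1 H2 by (fastforce simp: N1_def N2_def)
    qed
  qed
  have disj: "N1 \<inter> N2 = {}"
    using both root_nz P_root by (fastforce simp: N1_def N2_def)
  have ne1: "N1 \<noteq> {}"
  proof -
    obtain H where H: "H \<in> A1" using A by auto
    then have "{x + y |x y. x \<in> H \<and> y \<in> V2} \<in> ideal_arrangement P I" unfolding eq by blast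
    then obtain \<alpha> where "\<alpha> \<in> ?N" "{x. \<alpha> \<bullet> x = 0} = {x + y |x y. x \<in> H \<and> y \<in> V2}"
      by (auto simp: ideal_arrangement_def)
    then show ?thesis using H1[OF H] by (auto simp: N1_def)
  qed
  have ne2: "N2 \<noteq> {}"
  proof -
    obtain H where H: "H \<in> A2" using A by auto
    then have "{x + y |x y. x \<in> V1 \<and> y \<in> H} \<in> ideal_arrangement P I" unfolding eq by blast
    then obtain \<alpha> where "\<alpha> \<in> ?N" "{x. \<alpha> \<bullet> x = 0} = {x + y |x y. x \<in> V1 \<and> y \<in> H}"
      by (auto simp: ideal_arrangement_def)
    then show ?thesis using H2[OF H] by (auto simp: N2_def)
  qed
  define D1 D2 where "D1 = \<Delta> \<inter> N1" and "D2 = \<Delta> \<inter> N2"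
  have D: "\<Delta> = D1 \<union> D2" "D1 \<inter> D2 = {}" "finite D1" "finite D2" "D1 \<subseteq> \<Delta>" "D2 \<subseteq> \<Delta>"
    using full N_eq disj finite_simple by (auto simp: D1_def D2_def)
  have exp: "x = (\<Sum>c\<in>D1. cf c x *\<^sub>R c) + (\<Sum>c\<in>D2. cf c x *\<^sub>R c)" for x
  proof -
    have "(\<Sum>c\<in>\<Delta>. cf c x *\<^sub>R c) = (\<Sum>c\<in>D1. cf c x *\<^sub>R c) + (\<Sum>c\<in>D2. cf c x *\<^sub>R c)"
      by (subst D(1)) (rule sum.union_disjoint[OF D(3,4,2)])
    then show ?thesis by (simp only: cf_expand[symmetric])
  qed
  have o1: "(\<Sum>c\<in>D1. f c *\<^sub>R c) \<bullet> y = 0" if "y \<in> V2" for f y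
    using that by (auto simp: inner_sum_left D1_def N1_def intro!: sum.neutral)
  have o2: "(\<Sum>c\<in>D2. f c *\<^sub>R c) \<bullet> y = 0" if "y \<in> V1" for f y
    using that by (auto simp: inner_sum_left D2_def N2_def intro!: sum.neutral)
  \<comment> \<open>The \<open>D2\<close>-part of a root in \<open>N1\<close> is a difference of
    vectors annihilating \<open>V2\<close> and, as a combination of roots of \<open>N2\<close>,
    annihilates \<open>V1\<close>; so it is 0.\<close>
  have z1: "cf c x = 0" if x: "x \<in> N1" and c: "c \<in> D2" for x c
  proof -
    let ?u = "\<Sum>c\<in>D2. cf c x *\<^sub>R c"
    have "?u = x - (\<Sum>c\<in>D1. cf c x *\<^sub>R c)" using exp[of x] by (metis add_diff_cancel_left')
    then have "?u \<bullet> y = 0" if "y \<in> V2" for y using o1[OF that] x that by (simp add: inner_diff_left N1_def)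
    then have "?u = 0" using both o2 by blast
    then show ?thesis using cf_comb[OF D(6), of "\<lambda>c. cf c x" c] c by (simp add: representation_zero)
  qed
  have z2: "cf c x = 0" if x: "x \<in> N2" and c: "c \<in> D1" for x c
  proof -
    let ?u = "\<Sum>c\<in>D1. cf c x *\<^sub>R c"
    have "?u = x - (\<Sum>c\<in>D2. cf c x *\<^sub>R c)" using exp[of x] by (metis add_diff_cancel_right')
    then have "?u \<bullet> y = 0" if "y \<in> V1" for y using o2[OF that] x that by (simp add: inner_diff_left N2_def)
    then have "?u = 0" using both o1 by blast
    then show ?thesis using cf_comb[OF D(5), of "\<lambda>c. cf c x" c] c by (simp add: representation_zero)
  qed
  have NP: "N1 \<subseteq> P" "N2 \<subseteq> P" by (auto simp: N1_def N2_def)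
  have nz: "\<not> (\<forall>c\<in>\<Delta>. cf c x = 0)" if "x \<in> P" for x using P_nz_cf[OF that] by fastforce
  have part: "cf c x = 0" if "x \<in> P" "y \<in> P" "cf c (x + y) = 0" for x y c
    using that P_cf_nonneg[of x c] P_cf_nonneg[of y c] by (simp add: cf_add)
  \<comment> \<open>A summand of a root of \<open>N1\<close> has no coefficients on
    \<open>D2\<close>; if it were in \<open>N2\<close>, it would have none on \<open>D1\<close>
    either.\<close>
  have s1: "x \<in> N1" if "x \<in> P" "y \<in> P" "x + y \<in> N1" for x y
  proof -
    have "x \<in> ?N" using lowerD[OF N that(1,2)] that(3) N_eq by blast
    moreover have "x \<notin> N2"
    proof
      assume "x \<in> N2"
      then have "\<forall>c\<in>\<Delta>. cf c x = 0" using z2 z1[OF that(3)] part[OF that(1,2)] D(1) by blast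
      then show False using nz that by blast
    qed
    ultimately show ?thesis using N_eq by blast
  qed
  have s2: "x \<in> N2" if "x \<in> P" "y \<in> P" "x + y \<in> N2" for x y
  proof -
    have "x \<in> ?N" using lowerD[OF N that(1,2)] that(3) N_eq by blast
    moreover have "x \<notin> N1"
    proof
      assume "x \<in> N1"
      then have "\<forall>c\<in>\<Delta>. cf c x = 0" using z1 z2[OF that(3)] part[OF that(1,2)] D(1) by blast
      then show False using nz that by blast
    qed
    ultimately show ?thesis using N_eq by blast
  qed
  have l1: "lower N1" unfolding lower_def using NP s1 by (metis add.commute)
  have l2: "lower N2" unfolding lower_def using NP s2 by (metis add.commute)
  \<comment> \<open>Each factor contains a hyperplane, so some root of \<open>N2\<close> has support
    outside \<open>D1\<close>.\<close>
  have D1ne: "D1 \<subset> \<Delta>"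
  proof -
    obtain x where x: "x \<in> N2" using ne2 by auto
    then obtain c where "c \<in> \<Delta>" "cf c x \<noteq> 0" using nz NP by blast
    then show ?thesis using z2[OF x] D by blast
  qed
  have D2ne: "D2 \<subset> \<Delta>"
  proof -
    obtain x where x: "x \<in> N1" using ne1 by auto
    then obtain c where "c \<in> \<Delta>" "cf c x \<noteq> 0" using nz NP by blast
    then show ?thesis using z1[OF x] D by blast
  qed
  have p1: "N1 \<subseteq> parabolic \<Phi> D1" using parabolicI[OF D(5)] z1 NP D(1) by blast
  have p2: "N2 \<subseteq> parabolic \<Phi> D2" using parabolicI[OF D(6)] z2 NP D(1) by blast
  have fin: "finite N1" "finite N2" using finite_subset[OF _ finite_P] NP by auto
  have "weyl_poly ?N = weyl_poly N1 * weyl_poly N2"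
    unfolding N_eq
  proof (rule weyl_poly_Un[OF fin disj])
    fix x y assume "x \<in> N1 \<union> N2" "y \<in> N1 \<union> N2"
    then have xy: "x \<in> P" "y \<in> P" using NP by auto
    show "x + y \<in> N1 \<Longrightarrow> x \<in> N1 \<and> y \<in> N1" using lowerD[OF l1 xy] .
    show "x + y \<in> N2 \<Longrightarrow> x \<in> N2 \<and> y \<in> N2" using lowerD[OF l2 xy] .
  qed
  also have "\<dots> = conj_product (layer_count N1) * conj_product (layer_count N2)"
    using weyl_poly_parabolic[OF hyp D1ne l1 p1] weyl_poly_parabolic[OF hyp D2ne l2 p2] by simp
  also have "\<dots> = conj_product (\<lambda>j. layer_count N1 j + layer_count N2 j)"
    by (rule conj_product_add[symmetric, where n = "Max (hn ` P)"])
      (use layer_count_dec[OF l1] layer_count_dec[OF l2] layer_count_large[OF l1] layer_count_large[OF l2] in auto)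
  also have "\<dots> = conj_product (layer_count ?N)"
    unfolding N_eq by (rule conj_product_cong) (rule layer_count_Un[OF fin disj, symmetric])
  finally show ?thesis .
qed

end

theorem theorem1p26:
  fixes \<Phi> \<Delta> I :: "'a::euclidean_space set"
  assumes "root_system \<Phi>" and "reduced_roots \<Phi>" and "simple_roots \<Phi> \<Delta>"
    and "root_ideal (positive_roots \<Phi> \<Delta>) I"
    and "reducible_arrangement (ideal_arrangement (positive_roots \<Phi> \<Delta>) I) \<or>
         (irreducible_arrangement (ideal_arrangement (positive_roots \<Phi> \<Delta>) I) \<and>
          (\<exists>\<Delta>0. \<Delta>0 \<subset> \<Delta> \<and> card \<Delta>0 + 1 = card \<Delta> \<and>
             condition_C \<Delta> (positive_roots \<Phi> \<Delta>) I (parabolic \<Phi> \<Delta>0)))"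
    and "\<And>\<Delta>' J. \<Delta>' \<subset> \<Delta> \<Longrightarrow> root_ideal (parabolic \<Phi> \<Delta>' \<inter> positive_roots \<Phi> \<Delta>) J \<Longrightarrow>
           poincare_poly (parabolic \<Phi> \<Delta>' \<inter> positive_roots \<Phi> \<Delta>) J =
           exponent_product \<Delta>' (parabolic \<Phi> \<Delta>' \<inter> positive_roots \<Phi> \<Delta>) J"
  shows "poincare_poly (positive_roots \<Phi> \<Delta>) I = exponent_product \<Delta> (positive_roots \<Phi> \<Delta>) I"
  proof -
  interpret based_root_system \<Phi> \<Delta> by unfold_locales (fact assms)+
  note P_def[symmetric, simp]
  have hyp: parabolic_hyp using assms(6) by simp
  have N: "lower (P - I)"
    unfolding lower_def
  proof (intro conjI ballI impI)
    fix a b assume ab: "a \<in> P" "b \<in> P" "a + b \<in> P - I"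
    have "c + d \<in> I" if "c \<in> I" "d \<in> P" "c + d \<in> P" for c d
      using assms(4) that by (simp add: root_ideal_def)
    from this[of a b] this[of b a] show "a \<in> P - I" "b \<in> P - I" using ab by (auto simp: add.commute)
  qed simp
  have "weyl_poly (P - I) = conj_product (layer_count (P - I))"
  \<comment> \<open>The reducible case needs every simple root in the complement, so that the simple
    roots distribute over the two summands.\<close>
  proof (cases "\<Delta> \<subseteq> P - I")
    case False
    then show ?thesis by (rule weyl_poly_not_full_support[OF hyp N])
  next
    case True
    show ?thesis using assms(5) weyl_poly_reducible[OF hyp N True] weyl_poly_condition_C[OF hyp N] by auto
  qed
  moreover have "ht_count \<Delta> P I = layer_count (P - I)"
    by (simp add: fun_eq_iff ht_count_def layer_count_def)
  ultimately show ?thesis by (simp add: poincare_poly_eq exponent_product_eq)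
qed
end
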